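(* Let $(\Psi_l,\Psi_u,\epsilon)$ be a solution of the optimization problem (P) described in the context, let $V_u=-\lambda\log\Psi_l$, and let $V^*$ be the value function. Given the control law $u^\epsilon=-R^{-1}G^T\nabla_xV_u$, let $$J_u=\mathbb{E}_{\omega_t}\left[\phi(x_T)+\int_0^T q(x_t)+\tfrac12(u^\epsilon_t)^TRu^\epsilon_t\,dt\right]$$ be the expected cost of the system when using the control law $u^\epsilon$ (as a function of the initial state). Then, at every initial state in $\Omega$, $$J_u\le V_u\le V^*-\lambda\log\left(1-\min\left\{1,\frac{\epsilon}{\eta}\right\}\right),\qquad \eta=e^{-\|V^*\|_\infty/\lambda}.$$
   Context: Setting. $\mathbb{R}[x]$ denotes real polynomials in $x\in\mathbb{R}^n$, and $\mathbb{R}_+=[0,\infty)$. $\Omega\subset\mathbb{R}^n$ is a compact basic closed semialgebraic set, $\Omega=\{x: g_i(x)\ge 0,\ i=1,\dots,k\}$ with $g_i\in\mathbb{R}[x]$, $0\in\Omega$; its boundary is $\partial\Omega=\{x:\prod_{i=1}^m h_i(x)=0\}$ with $h_i\in\mathbb{R}[x]$; the origin is treated as part of the boundary. The system is $dx_t=(f(x_t)+G(x_t)u_t)\,dt+B(x_t)\,d\omega_t$, where $x_t\in\Omega$, $u_t$ is the (vector) control, $f,G,B$ are vector/matrix valued with entries in $\mathbb{R}[x]$, $f(0)=0$, $G(0)=0$, $B(0)=0$, and $\omega_t$ is a vector Brownian motion with covariance $\Sigma_\epsilon$ (increments $\omega_t-\omega_s\sim\mathcal N(0,\Sigma_\epsilon(t-s))$).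 The cost is $\mathbb{E}_{\omega_t}[J(x,u)]=\mathbb{E}_{\omega_t}\left[\phi(x_T)+\int_0^T q(x_t)+\tfrac12u_t^TRu_t\,dt\right]$, where $T$ is the first time the state reaches $\partial\Omega$ or the origin, $R$ is a positive definite matrix, and $q,\phi\in\mathbb{R}[x]$ map $\Omega\to\mathbb{R}_+$ and are positive definite (zero at $0$, positive on $\Omega\setminus\{0\}$). The expectation is over realizations of the noise. The value function is the minimal expected cost as a function of the initial state. HJB equation: $0=q+(\nabla_xV)^Tf-\tfrac12(\nabla_xV)^TGR^{-1}G^T(\nabla_xV)+\tfrac12\mathrm{Tr}\left((\nabla_{xx}V)B\Sigma_\epsilon B^T\right)$ on $\Omega$ with $V=\phi$ on $\partial\Omega$. It is assumed there is $\lambda>0$ with $\lambda G(x)R^{-1}G(x)^T=B(x)\Sigma_\epsilon B(x)^T=:\Sigma(x)$. With $V=-\lambda\log\Psi$, the HJB equation becomes the linear PDE $0=-\tfrac1\lambda q\Psi+\mathcal L(\Psi)$ on $\Omega$, $\Psi=\psi:=e^{-\phi/\lambda}$ on $\partial\Omega$, where $\mathcal L(\Psi)=f^T(\nabla_x\Psi)+\tfrac12\mathrm{Tr}((\nabla_{xx}\Psi)\Sigma)$. It is assumed that unique viscosity solutions $V^*$ and $\Psi^*$ of these two problems exist; $V^*=-\lambda\log\Psi^*$ is the value function. Norm: $\|F\|_\infty=\sup_{x\in\Omega}|F(x)|$. Problem (P): minimize $\epsilon$ over polynomials $\Psi_l,\Psi_u\in\mathbb{R}[x]$ subject to $\tfrac1\lambda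 q\Psi_l-\mathcal L(\Psi_l)\le 0$ on $\Omega$; $0\le\tfrac1\lambda q\Psi_u-\mathcal L(\Psi_u)$ on $\Omega$; $\Psi_u-\Psi_l\le\epsilon$ on $\Omega$; $0\le\Psi_l\le\psi\le\Psi_u$ on $\partial\Omega$; for each coordinate $i$, $\partial_{x^i}\Psi_l\le0$ at points of $\Omega$ with $x^i\ge0$ and $\partial_{x^i}\Psi_l\ge 0$ at points of $\Omega$ with $x^i\le 0$; and $\Psi_l(0)=1$. It is understood that $\Psi_l>0$ on $\Omega$, so that $V_u=-\lambda\log\Psi_l$ is well defined. The upper bound is read as $+\infty$ when $\epsilon\ge\eta$. *)

theory Defs
  imports "HOL-Probability.Probability"
begin

definition positive_semidefinite :: "real^'n^'n \<Rightarrow> bool" where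
  "positive_semidefinite A \<longleftrightarrow> transpose A = A \<and> (\<forall>x. 0 \<le> x \<bullet> (A *v x))"

definition positive_definite :: "real^'n^'n \<Rightarrow> bool" where
  "positive_definite A \<longleftrightarrow> transpose A = A \<and> (\<forall>x. x \<noteq> 0 \<longrightarrow> 0 < x \<bullet> (A *v x))"

definition positive_definite_on :: "(real^'n) set \<Rightarrow> (real^'n \<Rightarrow> real) \<Rightarrow> bool" where
  "positive_definite_on S q \<longleftrightarrow> q 0 = 0 \<and> (\<forall>x\<in>S - {0}. 0 < q x)"

definition grad :: "(real^'n \<Rightarrow> real) \<Rightarrow> real^'n \<Rightarrow> real^'n" where
  "grad F x = (\<chi> i. frechet_derivative F (at x) (axis i 1))"

definition hess :: "(real^'n \<Rightarrow> real) \<Rightarrow> real^'n \<Rightarrow> real^'n^'n" where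
  "hess F x = jacobian (grad F) (at x)"

definition C2_on :: "(real^'n) set \<Rightarrow> (real^'n \<Rightarrow> real) \<Rightarrow> bool" where
  "C2_on D \<theta> \<longleftrightarrow> (\<forall>x\<in>D. \<theta> differentiable (at x)) \<and>
     (\<forall>x\<in>D. grad \<theta> differentiable (at x)) \<and> continuous_on D (hess \<theta>)"

text \<open>
  The origin counts as a boundary point, both for the Dirichlet conditions and as a stopping point.
\<close>

definition bdry :: "(real^'n) set \<Rightarrow> (real^'n) set" where
  "bdry \<Omega> = insert 0 (frontier \<Omega>)"


section \<open>Viscosity solutions\<close>

text \<open>
  An equation is given by \<open>H x (U x) (grad U x) (hess U x) = 0\<close>, where \<open>H\<close> is
  nonincreasing in the Hessian argument (degenerate ellipticity).
\<close>

type_synonym 'n pde_op = "real^'n \<Rightarrow> real \<Rightarrow> real^'n \<Rightarrow> real^'n^'n \<Rightarrow> real"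

definition viscosity_subsolution :: "(real^'n) set \<Rightarrow> 'n pde_op \<Rightarrow> (real^'n \<Rightarrow> real) \<Rightarrow> bool" where
  "viscosity_subsolution D H U \<longleftrightarrow>
     (\<forall>\<theta>. \<forall>x\<in>D. C2_on D \<theta> \<longrightarrow> (\<forall>\<^sub>F y in at x. U y - \<theta> y \<le> U x - \<theta> x) \<longrightarrow>
        H x (U x) (grad \<theta> x) (hess \<theta> x) \<le> 0)"

definition viscosity_supersolution :: "(real^'n) set \<Rightarrow> 'n pde_op \<Rightarrow> (real^'n \<Rightarrow> real) \<Rightarrow> bool" where
  "viscosity_supersolution D H U \<longleftrightarrow>
     (\<forall>\<theta>. \<forall>x\<in>D. C2_on D \<theta> \<longrightarrow> (\<forall>\<^sub>F y in at x. U x - \<theta> x \<le> U y - \<theta> y) \<longrightarrow>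
        0 \<le> H x (U x) (grad \<theta> x) (hess \<theta> x))"

definition viscosity_solution ::
  "(real^'n) set \<Rightarrow> 'n pde_op \<Rightarrow> (real^'n \<Rightarrow> real) \<Rightarrow> (real^'n \<Rightarrow> real) \<Rightarrow> bool" where
  "viscosity_solution \<Omega> H b U \<longleftrightarrow> continuous_on \<Omega> U \<and> (\<forall>x\<in>bdry \<Omega>. U x = b x) \<and>
     viscosity_subsolution (\<Omega> - bdry \<Omega>) H U \<and> viscosity_supersolution (\<Omega> - bdry \<Omega>) H U"

definition unique_viscosity_solution ::
  "(real^'n) set \<Rightarrow> 'n pde_op \<Rightarrow> (real^'n \<Rightarrow> real) \<Rightarrow> (real^'n \<Rightarrow> real) \<Rightarrow> bool" where
  "unique_viscosity_solution \<Omega> H b U \<longleftrightarrow> viscosity_solution \<Omega> H b U \<and>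
     (\<forall>U'. viscosity_solution \<Omega> H b U' \<longrightarrow> (\<forall>x\<in>\<Omega>. U' x = U x))"

definition noise_cov :: "(real^'n \<Rightarrow> real^'l^'n) \<Rightarrow> real^'l^'l \<Rightarrow> real^'n \<Rightarrow> real^'n^'n" where
  "noise_cov B S\<^sub>\<epsilon> x = B x ** S\<^sub>\<epsilon> ** transpose (B x)"

definition hjb_op :: "(real^'n \<Rightarrow> real) \<Rightarrow> (real^'n \<Rightarrow> real^'n) \<Rightarrow> (real^'n \<Rightarrow> real^'m^'n) \<Rightarrow>
    (real^'n \<Rightarrow> real^'l^'n) \<Rightarrow> real^'l^'l \<Rightarrow> real^'m^'m \<Rightarrow> 'n pde_op" where
  "hjb_op q f G B S\<^sub>\<epsilon> R x r p Y =
     - (q x + p \<bullet> f x - 1/2 * (p \<bullet> ((G x ** matrix_inv R ** transpose (G x)) *v p))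
          + 1/2 * trace (Y ** noise_cov B S\<^sub>\<epsilon> x))"

definition linear_op :: "(real^'n \<Rightarrow> real) \<Rightarrow> (real^'n \<Rightarrow> real^'n) \<Rightarrow>
    (real^'n \<Rightarrow> real^'l^'n) \<Rightarrow> real^'l^'l \<Rightarrow> real \<Rightarrow> 'n pde_op" where
  "linear_op q f B S\<^sub>\<epsilon> lam x r p Y =
     1 / lam * q x * r - (f x \<bullet> p + 1/2 * trace (Y ** noise_cov B S\<^sub>\<epsilon> x))"


section \<open>The optimization problem\<close>

definition gen_L :: "(real^'n \<Rightarrow> real^'n) \<Rightarrow> (real^'n \<Rightarrow> real^'l^'n) \<Rightarrow> real^'l^'l \<Rightarrow>
    (real^'n \<Rightarrow> real) \<Rightarrow> real^'n \<Rightarrow> real" where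
  "gen_L f B S\<^sub>\<epsilon> \<Psi> x = f x \<bullet> grad \<Psi> x + 1/2 * trace (hess \<Psi> x ** noise_cov B S\<^sub>\<epsilon> x)"

definition P_feasible :: "(real^'n) set \<Rightarrow> (real^'n \<Rightarrow> real) \<Rightarrow> (real^'n \<Rightarrow> real^'n) \<Rightarrow>
    (real^'n \<Rightarrow> real^'l^'n) \<Rightarrow> real^'l^'l \<Rightarrow> real \<Rightarrow> (real^'n \<Rightarrow> real) \<Rightarrow>
    (real^'n \<Rightarrow> real) \<Rightarrow> (real^'n \<Rightarrow> real) \<Rightarrow> real \<Rightarrow> bool" where
  "P_feasible \<Omega> q f B S\<^sub>\<epsilon> lam \<psi> \<Psi>l \<Psi>u eps \<longleftrightarrow>
     real_polynomial_function \<Psi>l \<and> real_polynomial_function \<Psi>u \<and>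
     (\<forall>x\<in>\<Omega>. 1 / lam * q x * \<Psi>l x - gen_L f B S\<^sub>\<epsilon> \<Psi>l x \<le> 0) \<and>
     (\<forall>x\<in>\<Omega>. 0 \<le> 1 / lam * q x * \<Psi>u x - gen_L f B S\<^sub>\<epsilon> \<Psi>u x) \<and>
     (\<forall>x\<in>\<Omega>. \<Psi>u x - \<Psi>l x \<le> eps) \<and>
     (\<forall>x\<in>bdry \<Omega>. 0 \<le> \<Psi>l x \<and> \<Psi>l x \<le> \<psi> x \<and> \<psi> x \<le> \<Psi>u x) \<and>
     (\<forall>i. \<forall>x\<in>\<Omega>. (0 \<le> x $ i \<longrightarrow> grad \<Psi>l x $ i \<le> 0) \<and> (x $ i \<le> 0 \<longrightarrow> 0 \<le> grad \<Psi>l x $ i)) \<and>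
     \<Psi>l 0 = 1"

definition P_solution :: "(real^'n) set \<Rightarrow> (real^'n \<Rightarrow> real) \<Rightarrow> (real^'n \<Rightarrow> real^'n) \<Rightarrow>
    (real^'n \<Rightarrow> real^'l^'n) \<Rightarrow> real^'l^'l \<Rightarrow> real \<Rightarrow> (real^'n \<Rightarrow> real) \<Rightarrow>
    (real^'n \<Rightarrow> real) \<Rightarrow> (real^'n \<Rightarrow> real) \<Rightarrow> real \<Rightarrow> bool" where
  "P_solution \<Omega> q f B S\<^sub>\<epsilon> lam \<psi> \<Psi>l \<Psi>u eps \<longleftrightarrow>
     P_feasible \<Omega> q f B S\<^sub>\<epsilon> lam \<psi> \<Psi>l \<Psi>u eps \<and>
     (\<forall>\<Psi>l' \<Psi>u' eps'. P_feasible \<Omega> q f B S\<^sub>\<epsilon> lam \<psi> \<Psi>l' \<Psi>u' eps' \<longrightarrow> eps \<le> eps')"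


section \<open>Brownian motion and the Ito integral\<close>

text \<open>
  Time is indexed by \<^typ>\<open>real\<close>; only times \<open>t \<ge> 0\<close> are used.
\<close>

text \<open>
  A random vector is centred Gaussian if every linear functional of it is a (possibly degenerate)
  centred normal variable.
\<close>

definition centred_gaussian :: "'w measure \<Rightarrow> ('w \<Rightarrow> real^'l) \<Rightarrow> real^'l^'l \<Rightarrow> bool" where
  "centred_gaussian M Z C \<longleftrightarrow> Z \<in> borel_measurable M \<and>
     (\<forall>v. distr M borel (\<lambda>w. v \<bullet> Z w) =
        (if v \<bullet> (C *v v) = 0 then return borel 0
         else density lborel (\<lambda>y. ennreal (normal_density 0 (sqrt (v \<bullet> (C *v v))) y))))"

definition brownian_motion ::
  "'w measure \<Rightarrow> (real \<Rightarrow> 'w measure) \<Rightarrow> real^'l^'l \<Rightarrow> (real \<Rightarrow> 'w \<Rightarrow> real^'l) \<Rightarrow> bool" where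
  "brownian_motion M F S\<^sub>\<epsilon> W \<longleftrightarrow>
     (\<forall>t\<ge>0. W t \<in> borel_measurable (F t)) \<and>
     (AE w in M. W 0 w = 0) \<and>
     (\<forall>w\<in>space M. continuous_on {0..} (\<lambda>t. W t w)) \<and>
     (\<forall>s t. 0 \<le> s \<and> s \<le> t \<longrightarrow>
        centred_gaussian M (\<lambda>w. W t w - W s w) ((t - s) *\<^sub>R S\<^sub>\<epsilon>) \<and>
        prob_space.indep_set M (sets (F s))
          {(\<lambda>w. W t w - W s w) -` A \<inter> space M | A. A \<in> sets borel})"

definition progressive ::
  "(real \<Rightarrow> 'w measure) \<Rightarrow> (real \<Rightarrow> 'w \<Rightarrow> 'a::topological_space) \<Rightarrow> bool" where
  "progressive F Y \<longleftrightarrow>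
     (\<forall>t\<ge>0. (\<lambda>(s, w). Y s w) \<in> borel_measurable (restrict_space borel {0..t} \<Otimes>\<^sub>M F t))"

text \<open>
  Elementary integrands on \<open>[0, t]\<close> are \<open>\<Sum>i<k. \<xi>\<^sub>i 1\<^bsub>(\<tau>\<^sub>i, \<tau>\<^sub>i\<^sub>+\<^sub>1]\<^esub>\<close> with deterministic grid points
  and bounded, matrix-valued \<open>\<xi>\<^sub>i\<close> measurable at time \<open>\<tau>\<^sub>i\<close>. The integral of \<open>H\<close> over \<open>[0, t]\<close> is
  the \<open>L\<^sup>2\<close> limit of elementary integrals; this determines \<open>I\<close> up to null sets.
\<close>

definition elementary ::
  "(real \<Rightarrow> 'w measure) \<Rightarrow> real \<Rightarrow> nat \<Rightarrow> (nat \<Rightarrow> real) \<Rightarrow> (nat \<Rightarrow> 'w \<Rightarrow> real^'l^'n) \<Rightarrow> bool" where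
  "elementary F t k \<tau> \<xi> \<longleftrightarrow> 0 \<le> \<tau> 0 \<and> (\<forall>i<k. \<tau> i \<le> \<tau> (Suc i)) \<and> \<tau> k \<le> t \<and>
     (\<forall>i<k. \<xi> i \<in> borel_measurable (F (\<tau> i)) \<and>
        (\<exists>C. \<forall>w\<in>space (F (\<tau> i)). norm (\<xi> i w) \<le> C))"

definition elem_process ::
  "nat \<Rightarrow> (nat \<Rightarrow> real) \<Rightarrow> (nat \<Rightarrow> 'w \<Rightarrow> real^'l^'n) \<Rightarrow> real \<Rightarrow> 'w \<Rightarrow> real^'l^'n" where
  "elem_process k \<tau> \<xi> s w = (\<Sum>i<k. indicator {\<tau> i<..\<tau> (Suc i)} s *\<^sub>R \<xi> i w)"

definition elem_integral ::
  "(real \<Rightarrow> 'w \<Rightarrow> real^'l) \<Rightarrow> nat \<Rightarrow> (nat \<Rightarrow> real) \<Rightarrow> (nat \<Rightarrow> 'w \<Rightarrow> real^'l^'n) \<Rightarrow> 'w \<Rightarrow> real^'n" where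
  "elem_integral W k \<tau> \<xi> w = (\<Sum>i<k. \<xi> i w *v (W (\<tau> (Suc i)) w - W (\<tau> i) w))"

definition ito_integral :: "'w measure \<Rightarrow> (real \<Rightarrow> 'w measure) \<Rightarrow> (real \<Rightarrow> 'w \<Rightarrow> real^'l) \<Rightarrow> real \<Rightarrow>
    (real \<Rightarrow> 'w \<Rightarrow> real^'l^'n) \<Rightarrow> ('w \<Rightarrow> real^'n) \<Rightarrow> bool" where
  "ito_integral M F W t H I \<longleftrightarrow> progressive F H \<and> I \<in> borel_measurable M \<and>
     (\<exists>k \<tau> \<xi>. (\<forall>j. elementary F t (k j) (\<tau> j) (\<xi> j)) \<and>
        (\<lambda>j. \<integral>\<^sup>+w. (\<integral>\<^sup>+s\<in>{0..t}. ennreal ((norm (elem_process (k j) (\<tau> j) (\<xi> j) s w - H s w))\<^sup>2) \<partial>lborel) \<partial>M)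
           \<longlonglongrightarrow> 0 \<and>
        (\<lambda>j. \<integral>\<^sup>+w. ennreal ((norm (elem_integral W (k j) (\<tau> j) (\<xi> j) w - I w))\<^sup>2) \<partial>M) \<longlonglongrightarrow> 0)"


section \<open>The controlled system and its cost\<close>

definition hit_time :: "(real^'n) set \<Rightarrow> (real \<Rightarrow> 'w \<Rightarrow> real^'n) \<Rightarrow> 'w \<Rightarrow> ereal" where
  "hit_time \<Gamma> X w = (INF t\<in>{t. 0 \<le> t \<and> X t w \<in> \<Gamma>}. ereal t)"

definition before_hit :: "(real^'n) set \<Rightarrow> (real \<Rightarrow> 'w \<Rightarrow> real^'n) \<Rightarrow> 'w \<Rightarrow> real set" where
  "before_hit \<Gamma> X w = {s. 0 \<le> s \<and> ereal s < hit_time \<Gamma> X w}"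

text \<open>
  \<open>X\<close> solves \<open>dX = (f(X) + G(X) u) dt + B(X) dW\<close> from \<open>x0\<close> up to the time \<open>T\<close> at which it first
  hits \<open>bdry \<Omega>\<close>: the integral equation is required for the process stopped at \<open>T\<close>, and neither
  \<open>X\<close> nor \<open>u\<close> is restricted by it after \<open>T\<close>.
\<close>

definition sde_solution :: "'w measure \<Rightarrow> (real \<Rightarrow> 'w measure) \<Rightarrow> (real \<Rightarrow> 'w \<Rightarrow> real^'l) \<Rightarrow>
    (real^'n) set \<Rightarrow> (real^'n \<Rightarrow> real^'n) \<Rightarrow> (real^'n \<Rightarrow> real^'m^'n) \<Rightarrow> (real^'n \<Rightarrow> real^'l^'n) \<Rightarrow>
    real^'n \<Rightarrow> (real \<Rightarrow> 'w \<Rightarrow> real^'m) \<Rightarrow> (real \<Rightarrow> 'w \<Rightarrow> real^'n) \<Rightarrow> bool" where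
  "sde_solution M F W \<Omega> f G B x0 u X \<longleftrightarrow>
     (\<forall>t\<ge>0. X t \<in> borel_measurable (F t)) \<and>
     (\<forall>w\<in>space M. continuous_on {0..} (\<lambda>t. X t w)) \<and>
     (AE w in M. X 0 w = x0) \<and>
     progressive F (\<lambda>s w. indicator (before_hit (bdry \<Omega>) X w) s *\<^sub>R u s w) \<and>
     (\<forall>t\<ge>0.
        (AE w in M. set_integrable lborel ({0..t} \<inter> before_hit (bdry \<Omega>) X w)
           (\<lambda>s. f (X s w) + G (X s w) *v u s w)) \<and>
        ito_integral M F W t
          (\<lambda>s w. indicator (before_hit (bdry \<Omega>) X w) s *\<^sub>R B (X s w))
          (\<lambda>w. X (real_of_ereal (min (ereal t) (hit_time (bdry \<Omega>) X w))) w - x0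
             - (LINT s:{0..t} \<inter> before_hit (bdry \<Omega>) X w|lborel. f (X s w) + G (X s w) *v u s w)))"

text \<open>
  On the event \<open>T = \<infinity>\<close> no terminal cost is incurred. Since \<open>q\<close> is positive away from the origin,
  on this event the running cost is infinite unless the path returns arbitrarily close to the
  origin, where \<open>\<phi>\<close> vanishes.
\<close>

definition expected_cost :: "'w measure \<Rightarrow> (real^'n) set \<Rightarrow> (real^'n \<Rightarrow> real) \<Rightarrow> (real^'n \<Rightarrow> real) \<Rightarrow>
    real^'m^'m \<Rightarrow> (real \<Rightarrow> 'w \<Rightarrow> real^'m) \<Rightarrow> (real \<Rightarrow> 'w \<Rightarrow> real^'n) \<Rightarrow> ennreal" where
  "expected_cost M \<Omega> \<phi> q R u X =
     (\<integral>\<^sup>+w. ((if hit_time (bdry \<Omega>) X w < \<infinity>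
              then ennreal (\<phi> (X (real_of_ereal (hit_time (bdry \<Omega>) X w)) w)) else 0)
           + (\<integral>\<^sup>+s\<in>before_hit (bdry \<Omega>) X w.
                ennreal (q (X s w) + 1/2 * (u s w \<bullet> (R *v u s w))) \<partial>lborel)) \<partial>M)"

definition value_function :: "'w measure \<Rightarrow> (real \<Rightarrow> 'w measure) \<Rightarrow> (real \<Rightarrow> 'w \<Rightarrow> real^'l) \<Rightarrow>
    (real^'n) set \<Rightarrow> (real^'n \<Rightarrow> real^'n) \<Rightarrow> (real^'n \<Rightarrow> real^'m^'n) \<Rightarrow> (real^'n \<Rightarrow> real^'l^'n) \<Rightarrow>
    (real^'n \<Rightarrow> real) \<Rightarrow> (real^'n \<Rightarrow> real) \<Rightarrow> real^'m^'m \<Rightarrow> real^'n \<Rightarrow> ennreal" where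
  "value_function M F W \<Omega> f G B \<phi> q R x0 =
     (INF (u, X)\<in>{(u, X). sde_solution M F W \<Omega> f G B x0 u X}. expected_cost M \<Omega> \<phi> q R u X)"

definition feedback ::
  "(real^'n \<Rightarrow> real^'m^'n) \<Rightarrow> real^'m^'m \<Rightarrow> (real^'n \<Rightarrow> real) \<Rightarrow> real^'n \<Rightarrow> real^'m" where
  "feedback G R V x = - (matrix_inv R *v (transpose (G x) *v grad V x))"

end

theory Submission
  imports Defs
begin

text \<open>
  Since \<open>\<Psi>\<^sub>l\<close> and \<open>\<Psi>\<^sub>u\<close> are polynomials, they can be compared with the viscosity solution \<open>\<Psi>\<^sup>*\<close> by
  testing at an extremum of the difference, where \<open>q > 0\<close> excludes interior extrema of the wrong
  sign. So \<open>\<Psi>\<^sub>l \<le> \<Psi>\<^sup>* \<le> \<Psi>\<^sub>u \<le> \<Psi>\<^sub>l + \<epsilon>\<close>, and taking logarithms, with \<open>\<Psi>\<^sup>* \<ge> \<eta>\<close>, bounds \<open>V\<^sub>u\<close> from above.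

  For the cost bound, the inequality for \<open>\<Psi>\<^sub>l\<close> says that \<open>V\<^sub>u\<close> is a supersolution of the HJB equation,
  i.e. under the feedback control its generator is at most minus the running cost. Dynkin's formula
  is only needed as an inequality, and is obtained without Ito's formula: a third-order Taylor
  bound over one time step of length \<open>d\<close> gives
  \<open>E V(Y\<^sub>t) + E \<integral> l \<le> E V(Y\<^sub>s) + k d powr (3/2)\<close> for the stopped process \<open>Y\<close>, and the errors of \<open>n\<close> steps of
  length \<open>t/n\<close> sum to \<open>O(1 / sqrt n)\<close>. The step uses three facts on an increment \<open>D\<close> of a
  stochastic integral: it is centred, its conditional covariance is given by the isometry, and
  \<open>E |D|\<^sup>4 = O(d\<^sup>2)\<close>. Finally \<open>t \<rightarrow> \<infinity>\<close> by monotone convergence, using \<open>V\<^sub>u \<ge> 0\<close> and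
  \<open>V\<^sub>u \<ge> \<phi>\<close> on the boundary.
\<close>

section \<open>Polynomials\<close>

text \<open>\<open>ito_integral\<close> fixes a stochastic integral for one time only, as an L2
  limit. The integrals up to s and up to t come with unrelated approximating sequences, so an
  increment must first be given approximants of its own, with grid points after s and values within
  the bound of the integrand. Truncation and restart at s serve this purpose. Compactness of
  \<Omega> takes the place of localisation: a stopped path stays in \<Omega>, hence its increments
  are bounded and every moment exists. Outside \<Omega> nothing is known about the coefficients, so
  they are extended by zero there. The cubic Taylor remainder dictates the choice of moments. With
  steps of length \<eta>^2 it has size \<eta>^3, and controlling it takes a moment above the second;
  the fourth is the one that an expansion into independent increments reaches. Gradient and Hessian
  are frozen at the start of a step, and Lipschitz constants bound the error of freezing.
  Nonnegativity of \<open>Vu\<close> comes from \<open>\<Psi>l \<le> \<Psi>s\<close> together with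
  \<open>\<Psi>s \<le> 1\<close>, and the latter from the value function being nonnegative.\<close>

lemma has_derivative_imp_grad:
  assumes "(F has_derivative (\<lambda>h. v \<bullet> h)) (at x)"
  shows "grad F x = v"
  using frechet_derivative_at[OF assms]
  by (metis (no_types, lifting) cart_eq_inner_axis grad_def vec_lambda_beta vec_eq_iff)

text \<open>The polynomial components belong to the induction claim, since the product rule
  multiplies each gradient by the other factor. The field \<open>v\<close> stands in for
  \<open>grad\<close>, which is identified with it afterwards by uniqueness of the
  derivative.\<close>

lemma poly_grad_exists:
  assumes "real_polynomial_function (p :: real^'n \<Rightarrow> real)"
  shows "\<exists>v. (\<forall>i. real_polynomial_function (\<lambda>x. v x $ i)) \<and> (\<forall>x. (p has_derivative (\<lambda>h. v x \<bullet> h)) (at x))"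
  using assms
proof (induction rule: real_polynomial_function.induct)
  case (linear f)
  have "f = (\<lambda>h. (\<chi> i. f (axis i 1)) \<bullet> h)"
  proof
    fix h
    interpret bounded_linear f by fact
    have "f h = f (\<Sum>i\<in>UNIV. h $ i *\<^sub>R axis i 1)"
      using basis_expansion[of h] by (simp add: scalar_mult_eq_scaleR)
    also have "\<dots> = (\<Sum>i\<in>UNIV. h $ i * f (axis i 1))" by (simp add: sum scaleR)
    finally show "f h = (\<chi> i. f (axis i 1)) \<bullet> h" by (simp add: inner_vec_def mult.commute)
  qed
  then show ?case using linear bounded_linear_imp_has_derivative
    by (intro exI[of _ "\<lambda>x. \<chi> i. f (axis i 1)"]) auto
next
  case (const c)
  show ?case by (intro exI[of _ "\<lambda>x. 0"]) auto
next
  case (add f g)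
  then obtain u v where "\<forall>i. real_polynomial_function (\<lambda>x. u x $ i)" "\<forall>x. (f has_derivative (\<lambda>h. u x \<bullet> h)) (at x)"
    "\<forall>i. real_polynomial_function (\<lambda>x. v x $ i)" "\<forall>x. (g has_derivative (\<lambda>h. v x \<bullet> h)) (at x)"
    by blast
  then show ?case
    by (intro exI[of _ "\<lambda>x. u x + v x"]) (auto simp: inner_add_left intro!: has_derivative_add)
next
  case (mult f g)
  then obtain u v where uv: "\<forall>i. real_polynomial_function (\<lambda>x. u x $ i)" "\<forall>x. (f has_derivative (\<lambda>h. u x \<bullet> h)) (at x)"
    "\<forall>i. real_polynomial_function (\<lambda>x. v x $ i)" "\<forall>x. (g has_derivative (\<lambda>h. v x \<bullet> h)) (at x)"
    by blast
  show ?case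
  proof (intro exI[of _ "\<lambda>x. f x *\<^sub>R v x + g x *\<^sub>R u x"] conjI allI)
    fix x
    have "((\<lambda>x. f x * g x) has_derivative (\<lambda>h. f x * (v x \<bullet> h) + (u x \<bullet> h) * g x)) (at x)"
      using uv by (intro has_derivative_mult) auto
    then show "((\<lambda>x. f x * g x) has_derivative (\<bullet>) (f x *\<^sub>R v x + g x *\<^sub>R u x)) (at x)"
      by (rule has_derivative_eq_rhs) (auto simp: inner_add_left algebra_simps)
    fix i show "real_polynomial_function (\<lambda>x. (f x *\<^sub>R v x + g x *\<^sub>R u x) $ i)"
      using uv mult by (simp add: real_polynomial_function.intros)
  qed
qed

lemma poly_has_derivative:
  assumes "real_polynomial_function (p :: real^'n \<Rightarrow> real)"
  shows "(p has_derivative (\<lambda>h. grad p x \<bullet> h)) (at x)"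
  using poly_grad_exists[OF assms] has_derivative_imp_grad by metis

lemma poly_grad:
  assumes "real_polynomial_function (p :: real^'n \<Rightarrow> real)"
  shows "real_polynomial_function (\<lambda>x. grad p x $ i)"
proof -
  from poly_grad_exists[OF assms] obtain v where "\<forall>i. real_polynomial_function (\<lambda>x. v x $ i)"
    "\<forall>x. (p has_derivative (\<lambda>h. v x \<bullet> h)) (at x)" by blast
  moreover from this have "grad p = v" using has_derivative_imp_grad by blast
  ultimately show ?thesis by simp
qed

lemma poly_continuous_on: "real_polynomial_function p \<Longrightarrow> continuous_on A p"
  by (simp add: continuous_on_polymonial_function real_polynomial_function_eq)

lemma poly_grad_continuous_on:
  "real_polynomial_function (p :: real^'n \<Rightarrow> real) \<Longrightarrow> continuous_on A (grad p)"
  using continuous_on_vec_lambda[of A "\<lambda>i x. grad p x $ i"] poly_grad poly_continuous_on by auto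

lemma poly_grad_has_derivative:
  assumes p: "real_polynomial_function (p :: real^'n \<Rightarrow> real)"
  shows "(grad p has_derivative (\<lambda>h. \<chi> i. grad (\<lambda>x. grad p x $ i) x \<bullet> h)) (at x)"
  unfolding has_derivative_componentwise_within[of "grad p"]
  using poly_has_derivative[OF poly_grad[OF p]]
  by (auto simp: Basis_vec_def inner_axis)

text \<open>The row index of \<open>hess\<close> belongs to the first differentiation and the column
  index to the second, so that iterating \<open>poly_grad\<close> makes every entry a
  polynomial.\<close>

lemma poly_hess:
  assumes p: "real_polynomial_function (p :: real^'n \<Rightarrow> real)"
  shows "hess p x $ i $ j = grad (\<lambda>x. grad p x $ i) x $ j"
  using frechet_derivative_at[OF poly_grad_has_derivative[OF p, of x], symmetric]
  by (simp add: hess_def jacobian_def matrix_def inner_axis)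

lemma poly_hess_poly:
  "real_polynomial_function (p :: real^'n \<Rightarrow> real) \<Longrightarrow> real_polynomial_function (\<lambda>x. hess p x $ i $ j)"
  by (simp add: poly_hess poly_grad)

lemma poly_hess_continuous_on:
  "real_polynomial_function (p :: real^'n \<Rightarrow> real) \<Longrightarrow> continuous_on A (hess p)"
  using continuous_on_vec_lambda[of A "\<lambda>i x. hess p x $ i"]
    continuous_on_vec_lambda[of A "\<lambda>j x. hess p x $ i $ j" for i]
    poly_continuous_on[OF poly_hess_poly, of p A] by (simp del: continuous_on_component)

lemma poly_C2_on: "real_polynomial_function p \<Longrightarrow> C2_on D p"
  unfolding C2_on_def
  by (metis poly_has_derivative poly_grad_has_derivative poly_hess_continuous_on differentiableI)

lemma compact_bound:
  assumes "compact \<Omega>" "continuous_on \<Omega> (v :: 'a::topological_space \<Rightarrow> 'b::real_normed_vector)"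
  obtains c where "0 < c" "\<And>x. x \<in> \<Omega> \<Longrightarrow> norm (v x) \<le> c"
proof -
  have "bounded (v ` \<Omega>)" using assms compact_continuous_image compact_imp_bounded by blast
  then show ?thesis using that unfolding bounded_pos by auto
qed

text \<open>The mean value inequality asks for a convex domain and \<Omega> need not be convex, so
  it is applied on a ball that contains \<Omega>.\<close>

lemma poly_lipschitz:
  assumes p: "real_polynomial_function (p :: real^'n \<Rightarrow> real)" and "bounded \<Omega>"
  obtains L where "L-lipschitz_on \<Omega> p"
proof -
  obtain r where r: "\<Omega> \<subseteq> cball 0 r" using bounded_subset_ballD[OF \<open>bounded \<Omega>\<close>, of 0] ball_subset_cball by (meson subset_trans)
  obtain c where c: "0 < c" "\<And>x. x \<in> cball 0 r \<Longrightarrow> norm (grad p x) \<le> c"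
    by (rule compact_bound[OF compact_cball[of 0 r] poly_grad_continuous_on[OF p]]) blast
  have "c-lipschitz_on (cball 0 r) p"
    using c has_derivative_at_withinI[OF poly_has_derivative[OF p]]
  proof (intro bounded_derivative_imp_lipschitz[where f'="\<lambda>x h. grad p x \<bullet> h"])
    fix x assume "x \<in> cball (0::real^'n) r"
    then show "onorm (\<lambda>h. grad p x \<bullet> h) \<le> c"
      using c by (intro onorm_bound order_trans[OF Cauchy_Schwarz_ineq2[unfolded real_norm_def[symmetric]]]
        mult_right_mono) auto
  qed auto
  then show ?thesis using that lipschitz_on_subset r by blast
qed

text \<open>
  Taylor's formula along a segment only involves the directional derivatives
  \<open>p \<mapsto> grad p \<bullet> d\<close>, so the symmetry of the Hessian is never needed.
\<close>

lemma poly_taylor: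
  assumes p: "real_polynomial_function (p :: real^'n \<Rightarrow> real)" and "bounded \<Omega>"
  obtains C where "0 \<le> C" "\<And>x y. x \<in> \<Omega> \<Longrightarrow> y \<in> \<Omega> \<Longrightarrow>
    \<bar>p y - (p x + grad p x \<bullet> (y - x) + 1/2 * ((y - x) \<bullet> (hess p x *v (y - x))))\<bar> \<le> C * norm (y - x) ^ 3"
proof -
  \<comment> \<open>The segment from x to y may leave \<Omega>; the third derivatives are therefore
    bounded on a ball around it.\<close>
  obtain r where r: "\<Omega> \<subseteq> cball 0 r" using bounded_subset_ballD[OF \<open>bounded \<Omega>\<close>, of 0] ball_subset_cball by (meson subset_trans)
  define p3 where "p3 i j x = grad (\<lambda>x. hess p x $ i $ j) x" for i j x
  have "\<exists>c. \<forall>x\<in>cball 0 r. norm (p3 i j x) \<le> c" for i j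
  proof -
    have "continuous_on (cball 0 r) (p3 i j)"
      unfolding p3_def[abs_def] by (intro poly_grad_continuous_on poly_hess_poly p)
    show ?thesis by (rule compact_bound[OF compact_cball \<open>continuous_on (cball 0 r) (p3 i j)\<close>]) blast
  qed
  then have "\<forall>i j. \<exists>c. \<forall>x\<in>cball 0 r. norm (p3 i j x) \<le> c" by blast
  then obtain c where "\<forall>i j. \<forall>x\<in>cball 0 r. norm (p3 i j x) \<le> c i j" by metis
  then have c: "\<And>i j x. x \<in> cball 0 r \<Longrightarrow> norm (p3 i j x) \<le> c i j" by blast
  define C where "C = (\<Sum>i\<in>UNIV. \<Sum>j\<in>UNIV. \<bar>c i j\<bar>)"
  have "\<bar>p y - (p x + grad p x \<bullet> (y - x) + 1/2 * ((y - x) \<bullet> (hess p x *v (y - x))))\<bar> \<le> C / 6 * norm (y - x) ^ 3"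
    if "x \<in> \<Omega>" "y \<in> \<Omega>" for x y
  proof -
    define d where "d = y - x"
    define P2 where "P2 z = (\<Sum>i\<in>UNIV. \<Sum>j\<in>UNIV. d $ i * d $ j * hess p z $ i $ j)" for z
    define P3 where "P3 z = (\<Sum>i\<in>UNIV. \<Sum>j\<in>UNIV. d $ i * d $ j * (p3 i j z \<bullet> d))" for z
    \<comment> \<open>The derivatives of order 0 to 3 of t -> p (x + t d), in the indexed form that
      Maclaurin's theorem asks for.\<close>
    define D where "D m t = (let z = x + t *\<^sub>R d in if m = 0 then p z else if m = 1 then grad p z \<bullet> d
      else if m = 2 then P2 z else P3 z)" for m :: nat and t :: real
    have chain: "((\<lambda>t. f (x + t *\<^sub>R d)) has_real_derivative (grad f (x + t *\<^sub>R d) \<bullet> d)) (at t)"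
      if "real_polynomial_function f" for f t
    proof -
      have "((\<lambda>t. x + t *\<^sub>R d) has_derivative (\<lambda>h. h *\<^sub>R d)) (at t)"
        by (auto intro!: derivative_eq_intros)
      from has_derivative_compose[OF this poly_has_derivative[OF that]] show ?thesis
        by (simp add: has_field_derivative_def mult_commute_abs)
    qed
    have D: "(D m has_real_derivative D (Suc m) t) (at t)" if "m < 3" for m t
    proof -
      have 0: "((\<lambda>t. p (x + t *\<^sub>R d)) has_real_derivative (grad p (x + t *\<^sub>R d) \<bullet> d)) (at t)"
        by (rule chain[OF p])
      have "((\<lambda>t. \<Sum>i\<in>UNIV. grad p (x + t *\<^sub>R d) $ i * d $ i) has_real_derivative
          (\<Sum>i\<in>UNIV. (grad (\<lambda>x. grad p x $ i) (x + t *\<^sub>R d) \<bullet> d) * d $ i)) (at t)"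
        by (intro DERIV_sum DERIV_cmult_right chain[OF poly_grad[OF p]])
      then have 1: "((\<lambda>t. grad p (x + t *\<^sub>R d) \<bullet> d) has_real_derivative P2 (x + t *\<^sub>R d)) (at t)"
        by (simp add: inner_vec_def P2_def poly_hess p sum_distrib_left sum_distrib_right ac_simps)
      have 2: "((\<lambda>t. P2 (x + t *\<^sub>R d)) has_real_derivative P3 (x + t *\<^sub>R d)) (at t)"
        unfolding P2_def P3_def p3_def
        by (intro DERIV_sum DERIV_cmult chain[OF poly_hess_poly[OF p]])
      from that consider "m = 0" | "m = 1" | "m = 2" by linarith
      then show ?thesis using 0 1 2 by cases (simp_all add: D_def[abs_def] Let_def)
    qed
    have "\<exists>t. 0 < t \<and> t < 1 \<and> D 0 1 = (\<Sum>m<3. D m 0 / fact m * 1 ^ m) + D 3 t / fact 3 * 1 ^ 3"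
    proof (rule Maclaurin)
      show "\<forall>m t. m < 3 \<and> 0 \<le> t \<and> t \<le> 1 \<longrightarrow> (D m has_real_derivative D (Suc m) t) (at t)" using D by blast
    qed simp_all
    then obtain t where t: "0 < t" "t < 1" "D 0 1 = (\<Sum>m<3. D m 0 / fact m * 1 ^ m) + D 3 t / fact 3 * 1 ^ 3"
      by (elim exE conjE)
    have eq: "p y - (p x + grad p x \<bullet> d + 1/2 * P2 x) = P3 (x + t *\<^sub>R d) / 6"
      using t(3) by (simp add: D_def d_def lessThan_nat_numeral lessThan_Suc fact_numeral Let_def)
    have P2: "P2 x = d \<bullet> (hess p x *v d)"
      by (simp add: P2_def inner_vec_def matrix_vector_mult_def sum_distrib_left ac_simps)
    have "x + t *\<^sub>R d = (1 - t) *\<^sub>R x + t *\<^sub>R y" by (simp add: d_def scaleR_diff_left scaleR_diff_right)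
    then have seg: "x + t *\<^sub>R d \<in> cball 0 r"
    proof -
      have "x \<in> cball 0 r" "y \<in> cball 0 r" using that r by blast+
      then have "(1 - t) *\<^sub>R x + t *\<^sub>R y \<in> cball 0 r"
        using convexD_alt[OF convex_cball, of x 0 r y t] t by simp
      with \<open>x + t *\<^sub>R d = (1 - t) *\<^sub>R x + t *\<^sub>R y\<close> show ?thesis by simp
    qed
    have "\<bar>P3 (x + t *\<^sub>R d)\<bar> \<le> (\<Sum>i\<in>UNIV. \<Sum>j\<in>UNIV. \<bar>d $ i * d $ j * (p3 i j (x + t *\<^sub>R d) \<bullet> d)\<bar>)"
      unfolding P3_def by (intro order_trans[OF sum_abs] sum_mono sum_abs)
    also have "\<dots> \<le> (\<Sum>i\<in>UNIV. \<Sum>j\<in>UNIV. norm d * norm d * (\<bar>c i j\<bar> * norm d))"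
    proof (intro sum_mono)
      fix i j
      have "\<bar>p3 i j (x + t *\<^sub>R d) \<bullet> d\<bar> \<le> \<bar>c i j\<bar> * norm d"
        by (rule order_trans[OF Cauchy_Schwarz_ineq2], intro mult_right_mono)
           (use c[OF seg, of i j] in auto)
      then show "\<bar>d $ i * d $ j * (p3 i j (x + t *\<^sub>R d) \<bullet> d)\<bar> \<le> norm d * norm d * (\<bar>c i j\<bar> * norm d)"
        unfolding abs_mult by (intro mult_mono component_le_norm_cart) auto
    qed
    also have "\<dots> = C * norm d ^ 3"
      by (simp add: C_def sum_distrib_left power3_eq_cube ac_simps)
    finally show ?thesis unfolding d_def[symmetric] eq[unfolded P2] by (simp add: abs_divide)
  qed
  moreover have "0 \<le> C / 6" by (simp add: C_def sum_nonneg)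
  ultimately show ?thesis using that by blast
qed

section \<open>Logarithms of positive polynomials\<close>

definition outer :: "real^'n \<Rightarrow> real^'m \<Rightarrow> real^'m^'n" where
  "outer v w = (\<chi> i j. v $ i * w $ j)"

lemma outer_mult_vec: "outer v w *v d = (w \<bullet> d) *\<^sub>R v"
  by (simp add: vec_eq_iff outer_def matrix_vector_mult_def inner_vec_def sum_distrib_left sum_distrib_right ac_simps)

lemma trace_outer_mult: "trace (outer v w ** A) = w \<bullet> (A *v v)"
proof -
  have "trace (outer v w ** A) = (\<Sum>i\<in>UNIV. \<Sum>j\<in>UNIV. v $ i * w $ j * A $ j $ i)"
    by (simp add: trace_def outer_def matrix_matrix_mult_def)
  also have "\<dots> = (\<Sum>j\<in>UNIV. \<Sum>i\<in>UNIV. v $ i * w $ j * A $ j $ i)" by (rule sum.swap)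
  also have "\<dots> = w \<bullet> (A *v v)"
    by (simp add: inner_vec_def matrix_vector_mult_def sum_distrib_left ac_simps)
  finally show ?thesis .
qed

text \<open>The norm of \<open>real^'m^'n\<close> is the Frobenius norm, so Cauchy-Schwarz in each
  row is enough.\<close>

lemma norm_matrix_vector_mult_le: "norm ((A :: real^'m^'n) *v x) \<le> norm A * norm x"
proof -
  have "norm (A *v x) \<le> L2_set (\<lambda>i. norm (A $ i) * norm x) UNIV"
    unfolding norm_vec_def[of "A *v x"]
    by (intro L2_set_mono) (auto simp: matrix_vector_mul_component Cauchy_Schwarz_ineq2)
  also have "\<dots> = norm A * norm x"
    by (simp add: norm_vec_def[of A] L2_set_left_distrib)
  finally show ?thesis .
qed

text \<open>The gradient of \<open>- lam * ln \<Psi>\<close> in closed form: a product of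
  polynomials and 1 / \<Psi>, from which bounds and Lipschitz constants on \<Omega> can be read
  off.\<close>

definition log_grad :: "real \<Rightarrow> (real^'n \<Rightarrow> real) \<Rightarrow> real^'n \<Rightarrow> real^'n" where
  "log_grad lam \<Psi> x = - (lam / \<Psi> x) *\<^sub>R grad \<Psi> x"

text \<open>What one more differentiation of \<open>log_grad\<close> gives. It enters only through
  the Taylor bound with this matrix and through its trace against the noise covariance, so it is not
  identified with \<open>hess\<close> of the logarithm.\<close>

definition log_hess :: "real \<Rightarrow> (real^'n \<Rightarrow> real) \<Rightarrow> real^'n \<Rightarrow> real^'n^'n" where
  "log_hess lam \<Psi> x = - (lam / \<Psi> x) *\<^sub>R hess \<Psi> x + (lam / (\<Psi> x)\<^sup>2) *\<^sub>R outer (grad \<Psi> x) (grad \<Psi> x)"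

lemma grad_neg_log:
  assumes "real_polynomial_function \<Psi>" "0 < \<Psi> x"
  shows "grad (\<lambda>x. - lam * ln (\<Psi> x)) x = log_grad lam \<Psi> x"
proof (rule has_derivative_imp_grad)
  have "((\<lambda>x. - lam * ln (\<Psi> x)) has_derivative (\<lambda>h. - lam * ((grad \<Psi> x \<bullet> h) * inverse (\<Psi> x)))) (at x)"
    by (intro has_derivative_mult_right has_derivative_ln poly_has_derivative assms)
  then show "((\<lambda>x. - lam * ln (\<Psi> x)) has_derivative (\<bullet>) (log_grad lam \<Psi> x)) (at x)"
    by (rule has_derivative_eq_rhs) (simp add: log_grad_def fun_eq_iff divide_inverse ac_simps)
qed

text \<open>A lower bound for ln is an upper bound for \<open>- lam * ln\<close>. The difference
  between ln and its second-order Taylor polynomial at a vanishes at a and has derivative (t - a)^2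
  / (a^2 t). This settles b \<ge> a. To the left of a, a^2 t \<ge> m^3 lets the cubic term with
  factor 1 / (3 m^3) reverse the monotonicity.\<close>

lemma ln_ge_second_order:
  fixes a b m :: real
  assumes "0 < m" "m \<le> a" "m \<le> b"
  shows "ln a + (b - a) / a - (b - a)\<^sup>2 / (2 * a\<^sup>2) - \<bar>b - a\<bar> ^ 3 / (3 * m ^ 3) \<le> ln b"
proof -
  define F where "F c t = ln t - (ln a + (t - a) / a - (t - a)\<^sup>2 / (2 * a\<^sup>2)) - c * (t - a) ^ 3" for c t
  have eq: "1 / t - 1 / a + (t - a) / a\<^sup>2 = (t - a)\<^sup>2 / (a\<^sup>2 * t)" if "m \<le> t" for t
  proof -
    have "t \<noteq> 0" "a \<noteq> 0" using assms that by auto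
    then show ?thesis by (simp add: field_simps power2_eq_square)
  qed
  have F': "(F c has_real_derivative ((t - a)\<^sup>2 * (1 / (a\<^sup>2 * t) - 3 * c))) (at t)" if "m \<le> t" for c t
  proof -
    have "(F c has_real_derivative (1 / t - (1 / a - 2 * (t - a) / (2 * a\<^sup>2)) - c * (3 * (t - a)\<^sup>2))) (at t)"
      unfolding F_def using assms that
      by (auto intro!: derivative_eq_intros simp: power2_eq_square) (simp add: field_simps)
    moreover have "1 / t - (1 / a - 2 * (t - a) / (2 * a\<^sup>2)) - c * (3 * (t - a)\<^sup>2) =
        (t - a)\<^sup>2 * (1 / (a\<^sup>2 * t) - 3 * c)"
    proof -
      have "1 / t - (1 / a - 2 * (t - a) / (2 * a\<^sup>2)) - c * (3 * (t - a)\<^sup>2) =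
          (1 / t - 1 / a + (t - a) / a\<^sup>2) - 3 * c * (t - a)\<^sup>2"
        by (subst mult_divide_mult_cancel_left) simp_all
      then show ?thesis unfolding eq[OF that] by (simp add: right_diff_distrib)
    qed
    ultimately show ?thesis by simp
  qed
  have Fa: "F c a = 0" for c by (simp add: F_def)
  show ?thesis
  proof (cases "a \<le> b")
    case True
    have "F 0 a \<le> F 0 b"
    proof (rule DERIV_nonneg_imp_nondecreasing[OF True])
      fix t assume "a \<le> t" "t \<le> b"
      then show "\<exists>y. (F 0 has_real_derivative y) (at t) \<and> 0 \<le> y"
        using F'[of t 0] assms
        by (intro exI[of _ "(t - a)\<^sup>2 * (1 / (a\<^sup>2 * t) - 3 * 0)"] conjI) auto
    qed
    moreover have "0 \<le> \<bar>b - a\<bar> ^ 3 / (3 * m ^ 3)" using assms by simp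
    ultimately show ?thesis by (simp add: Fa) (simp add: F_def)
  next
    case False
    let ?c = "1 / (3 * m ^ 3)"
    have "F ?c b \<ge> F ?c a"
    proof (rule DERIV_nonpos_imp_nonincreasing[of b a "F ?c"])
      show "b \<le> a" using False by simp
      fix t assume t: "b \<le> t" "t \<le> a"
      have "m ^ 3 \<le> a\<^sup>2 * t" using assms t unfolding power3_eq_cube power2_eq_square
        by (intro mult_mono) auto
      then have "1 / (a\<^sup>2 * t) - 3 * ?c \<le> 0" using assms by (simp add: frac_le)
      then show "\<exists>y. (F ?c has_real_derivative y) (at t) \<and> y \<le> 0"
        using F'[of t ?c] assms t
        by (intro exI[of _ "(t - a)\<^sup>2 * (1 / (a\<^sup>2 * t) - 3 * ?c)"] conjI mult_nonneg_nonpos) auto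
    qed
    moreover have "- (?c * (b - a) ^ 3) = \<bar>b - a\<bar> ^ 3 / (3 * m ^ 3)"
    proof -
      have "\<bar>b - a\<bar> ^ 3 = - ((b - a) ^ 3)" using False by (simp add: power3_eq_cube algebra_simps)
      then show ?thesis by simp
    qed
    ultimately show ?thesis by (simp add: Fa) (simp add: F_def)
  qed
qed

lemma compact_pos_lower_bound:
  assumes "compact \<Omega>" "continuous_on \<Omega> \<Psi>" "\<forall>x\<in>\<Omega>. 0 < (\<Psi> x :: real)"
  obtains m where "0 < m" "\<And>x. x \<in> \<Omega> \<Longrightarrow> m \<le> \<Psi> x"
proof (cases "\<Omega> = {}")
  case True
  show ?thesis by (rule that[of 1]) (use True in auto)
next
  case False
  then obtain z where "z \<in> \<Omega>" "\<forall>x\<in>\<Omega>. \<Psi> z \<le> \<Psi> x" using continuous_attains_inf assms by blast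
  then show ?thesis using assms by (intro that[of "\<Psi> z"]) auto
qed

text \<open>The expansion of \<Psi> is inserted into \<open>ln_ge_second_order\<close>. If e is the
  increment of \<Psi>, l its linear part and k its quadratic form, then l, k and l^2 produce exactly
  \<open>log_grad\<close> and \<open>log_hess\<close>, and all else is of third order in the
  distance.\<close>

lemma neg_log_poly_taylor:
  fixes \<Omega> :: "(real^'n) set"
  assumes \<Omega>: "compact \<Omega>" and p: "real_polynomial_function \<Psi>" and pos: "\<forall>x\<in>\<Omega>. 0 < \<Psi> x" and "0 < lam"
  obtains C where "0 \<le> C" "\<And>x y. x \<in> \<Omega> \<Longrightarrow> y \<in> \<Omega> \<Longrightarrow>
    - lam * ln (\<Psi> y) \<le> - lam * ln (\<Psi> x) + log_grad lam \<Psi> x \<bullet> (y - x)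
      + 1/2 * ((y - x) \<bullet> (log_hess lam \<Psi> x *v (y - x))) + C * norm (y - x) ^ 3"
proof -
  obtain m where m: "0 < m" "\<And>x. x \<in> \<Omega> \<Longrightarrow> m \<le> \<Psi> x"
    by (rule compact_pos_lower_bound[OF \<Omega> poly_continuous_on[OF p] pos]) blast
  obtain g where g: "0 < g" "\<And>x. x \<in> \<Omega> \<Longrightarrow> norm (grad \<Psi> x) \<le> g"
    by (rule compact_bound[OF \<Omega> poly_grad_continuous_on[OF p]]) blast
  obtain h where h: "0 < h" "\<And>x. x \<in> \<Omega> \<Longrightarrow> norm (hess \<Psi> x) \<le> h"
    by (rule compact_bound[OF \<Omega> poly_hess_continuous_on[OF p]]) blast
  obtain C1 where C1: "0 \<le> C1" "\<And>x y. x \<in> \<Omega> \<Longrightarrow> y \<in> \<Omega> \<Longrightarrow>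
      \<bar>\<Psi> y - (\<Psi> x + grad \<Psi> x \<bullet> (y - x) + 1/2 * ((y - x) \<bullet> (hess \<Psi> x *v (y - x))))\<bar> \<le> C1 * norm (y - x) ^ 3"
    by (rule poly_taylor[OF p compact_imp_bounded[OF \<Omega>]]) blast
  define r where "r = diameter \<Omega>"
  have r: "norm (y - x) \<le> r" "0 \<le> r" if "x \<in> \<Omega>" "y \<in> \<Omega>" for x y
    using diameter_bounded_bound[OF compact_imp_bounded[OF \<Omega>] that(2,1)] diameter_ge_0[OF compact_imp_bounded[OF \<Omega>]]
    by (auto simp: r_def dist_norm)
  \<comment> \<open>e2 n^2 will bound e - l, and e1 n will bound e itself, where n is the distance;
    the factors r trade a surplus power of n for the diameter.\<close>
  define e2 where "e2 = h / 2 + C1 * r"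
  define e1 where "e1 = g + e2 * r"
  define C where "C = lam * (C1 / m + e2 * (e1 + g) / (2 * m\<^sup>2) + e1 ^ 3 / (3 * m ^ 3))"
  have r0: "0 \<le> r" by (simp add: r_def diameter_ge_0 compact_imp_bounded[OF \<Omega>])
  have e0: "0 \<le> e2" "0 \<le> e1" using r0 h g C1 by (auto simp: e1_def e2_def)
  have "- lam * ln (\<Psi> y) \<le> - lam * ln (\<Psi> x) + log_grad lam \<Psi> x \<bullet> (y - x)
      + 1/2 * ((y - x) \<bullet> (log_hess lam \<Psi> x *v (y - x))) + C * norm (y - x) ^ 3"
    if xy: "x \<in> \<Omega>" "y \<in> \<Omega>" for x y
  proof -
    define d where "d = y - x"
    define n where "n = norm d"
    define a where "a = \<Psi> x"
    define e where "e = \<Psi> y - \<Psi> x"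
    define l where "l = grad \<Psi> x \<bullet> d"
    define k where "k = d \<bullet> (hess \<Psi> x *v d)"
    have n: "0 \<le> n" "n \<le> r" using r xy by (auto simp: n_def d_def)
    have a: "m \<le> a" "0 < a" using m xy by (force simp: a_def)+
    have l: "\<bar>l\<bar> \<le> g * n"
      unfolding l_def n_def
      by (rule order_trans[OF Cauchy_Schwarz_ineq2]) (intro mult_right_mono g xy norm_ge_zero)
    have "\<bar>k\<bar> \<le> n * (norm (hess \<Psi> x) * n)"
      unfolding k_def n_def
      by (rule order_trans[OF Cauchy_Schwarz_ineq2]) (intro mult_left_mono norm_matrix_vector_mult_le norm_ge_zero)
    also have "\<dots> \<le> n * (h * n)" by (intro mult_mono h xy order_refl mult_nonneg_nonneg n norm_ge_zero) (use h n in auto)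
    finally have k: "\<bar>k\<bar> \<le> h * n\<^sup>2" by (simp add: power2_eq_square ac_simps)
    have rho: "\<bar>e - l - k / 2\<bar> \<le> C1 * n ^ 3"
    proof -
      have "e - l - k / 2 = \<Psi> y - (\<Psi> x + l + 1/2 * k)" by (simp add: e_def)
      then show ?thesis using C1(2)[OF xy, folded d_def] by (simp add: l_def k_def n_def)
    qed
    have "C1 * n ^ 3 \<le> C1 * r * n\<^sup>2"
      using n C1(1) by (simp add: power3_eq_cube power2_eq_square mult_mono ac_simps mult_left_mono)
    with rho k have el: "\<bar>e - l\<bar> \<le> e2 * n\<^sup>2" by (simp add: e2_def algebra_simps abs_le_iff)
    have "e2 * n\<^sup>2 \<le> e2 * r * n"
      using mult_left_mono[OF mult_right_mono[OF n(2,1)] e0(1)] by (simp add: power2_eq_square mult.assoc)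
    with el l have e: "\<bar>e\<bar> \<le> e1 * n" by (simp add: e1_def algebra_simps abs_le_iff)
    \<comment> \<open>Replacing e^2 by l^2 costs only n^3: the difference factors into e - l, of
      order n^2, and e + l, of order n.\<close>
    have "e\<^sup>2 - l\<^sup>2 = (e - l) * (e + l)" by (simp add: power2_eq_square algebra_simps)
    also have "\<dots> \<le> \<bar>e - l\<bar> * (\<bar>e\<bar> + \<bar>l\<bar>)"
      by (rule order_trans[OF abs_ge_self]) (simp add: abs_mult mult_left_mono)
    also have "\<dots> \<le> (e2 * n\<^sup>2) * (e1 * n + g * n)"
      by (intro mult_mono el add_mono e l) (use e0 in auto)
    finally have el2: "e\<^sup>2 - l\<^sup>2 \<le> e2 * (e1 + g) * n ^ 3" by (simp add: power3_eq_cube power2_eq_square algebra_simps)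
    have e3: "\<bar>e\<bar> ^ 3 \<le> e1 ^ 3 * n ^ 3"
      using power_mono[OF e, of 3] by (simp add: power_mult_distrib)
    have V: "- lam * ln (\<Psi> y) \<le> - lam * (ln a + e / a - e\<^sup>2 / (2 * a\<^sup>2) - \<bar>e\<bar> ^ 3 / (3 * m ^ 3))"
      using ln_ge_second_order[OF m(1) a(1) m(2)[OF xy(2)]] \<open>0 < lam\<close> by (simp add: a_def e_def)
    have D1: "log_grad lam \<Psi> x \<bullet> d = - lam * (l / a)" by (simp add: log_grad_def l_def a_def)
    have D2: "d \<bullet> (log_hess lam \<Psi> x *v d) = - lam * (k / a - l\<^sup>2 / a\<^sup>2)"
      by (simp add: log_hess_def k_def l_def a_def matrix_vector_mult_add_rdistrib
          scaleR_matrix_vector_assoc[symmetric] outer_mult_vec inner_add_right inner_commute[of d] power2_eq_square algebra_simps)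
    have "\<bar>(e - l - k / 2) / a\<bar> \<le> C1 * n ^ 3 / m"
      unfolding abs_divide using rho a m n C1 by (intro frac_le) auto
    moreover have "(e\<^sup>2 - l\<^sup>2) / (2 * a\<^sup>2) \<le> e2 * (e1 + g) * n ^ 3 / (2 * m\<^sup>2)"
      using el2 a m n e0 g by (intro frac_le mult_nonneg_nonneg) (auto intro: power_mono)
    moreover have "\<bar>e\<bar> ^ 3 / (3 * m ^ 3) \<le> e1 ^ 3 * n ^ 3 / (3 * m ^ 3)"
      using e3 m by (intro divide_right_mono) auto
    ultimately have "- ((e - l - k / 2) / a) + (e\<^sup>2 - l\<^sup>2) / (2 * a\<^sup>2) + \<bar>e\<bar> ^ 3 / (3 * m ^ 3)
        \<le> C1 * n ^ 3 / m + e2 * (e1 + g) * n ^ 3 / (2 * m\<^sup>2) + e1 ^ 3 * n ^ 3 / (3 * m ^ 3)"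
      by linarith
    from mult_left_mono[OF this, of lam] \<open>0 < lam\<close>
    have "lam * (- ((e - l - k / 2) / a) + (e\<^sup>2 - l\<^sup>2) / (2 * a\<^sup>2) + \<bar>e\<bar> ^ 3 / (3 * m ^ 3)) \<le> C * n ^ 3"
      by (simp add: C_def algebra_simps)
    \<comment> \<open>The bound for ln regrouped: the terms that make up \<open>log_grad\<close> and
      \<open>log_hess\<close>, and the three errors just estimated.\<close>
    moreover have "- lam * (ln a + e / a - e\<^sup>2 / (2 * a\<^sup>2) - \<bar>e\<bar> ^ 3 / (3 * m ^ 3)) =
        - lam * ln a - lam * (l / a) + 1/2 * (- lam * (k / a - l\<^sup>2 / a\<^sup>2))
        + lam * (- ((e - l - k / 2) / a) + (e\<^sup>2 - l\<^sup>2) / (2 * a\<^sup>2) + \<bar>e\<bar> ^ 3 / (3 * m ^ 3))"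
      by (simp add: algebra_simps diff_divide_distrib add_divide_distrib)
    ultimately show ?thesis using V unfolding d_def[symmetric] D1 D2 n_def[symmetric] a_def[symmetric]
      by linarith
  qed
  moreover have "0 \<le> C" using \<open>0 < lam\<close> m e0 g C1 by (auto simp: C_def)
  ultimately show ?thesis using that by blast
qed

section \<open>Lipschitz functions on compact sets\<close>

lemma lipschitz_vecI:
  fixes v :: "'a::metric_space \<Rightarrow> ('b::real_normed_vector)^'n"
  assumes "\<And>i. \<exists>L. L-lipschitz_on X (\<lambda>x. v x $ i)"
  shows "\<exists>L. L-lipschitz_on X v"
proof -
  from assms have "\<forall>i. \<exists>L. L-lipschitz_on X (\<lambda>x. v x $ i)" by blast
  then obtain L where L: "\<forall>i. (L i)-lipschitz_on X (\<lambda>x. v x $ i)" by (rule choice[THEN exE])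
  have "(\<Sum>i\<in>UNIV. L i)-lipschitz_on X v"
  proof (rule lipschitz_onI)
    fix x y assume xy: "x \<in> X" "y \<in> X"
    have "dist (v x) (v y) \<le> (\<Sum>i\<in>UNIV. dist (v x $ i) (v y $ i))"
      unfolding dist_vec_def by (rule L2_set_le_sum) simp
    also have "\<dots> \<le> (\<Sum>i\<in>UNIV. L i * dist x y)"
      using L xy by (intro sum_mono lipschitz_onD) auto
    finally show "dist (v x) (v y) \<le> (\<Sum>i\<in>UNIV. L i) * dist x y" by (simp add: sum_distrib_right)
  qed (use L lipschitz_on_nonneg in \<open>blast intro: sum_nonneg\<close>)
  then show ?thesis ..
qed

text \<open>Compactness supplies the bounds of both factors, without which a product of Lipschitz
  functions need not be Lipschitz.\<close>

lemma lipschitz_mult: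
  fixes u v :: "'a::metric_space \<Rightarrow> real"
  assumes "compact X" "\<exists>L. L-lipschitz_on X u" "\<exists>L. L-lipschitz_on X v"
  shows "\<exists>L. L-lipschitz_on X (\<lambda>x. u x * v x)"
proof -
  obtain L K where L: "L-lipschitz_on X u" "K-lipschitz_on X v" using assms by blast
  obtain a where a: "0 < a" "\<And>x. x \<in> X \<Longrightarrow> norm (u x) \<le> a"
    by (rule compact_bound[OF assms(1) lipschitz_on_continuous_on[OF L(1)]]) blast
  obtain b where b: "0 < b" "\<And>x. x \<in> X \<Longrightarrow> norm (v x) \<le> b"
    by (rule compact_bound[OF assms(1) lipschitz_on_continuous_on[OF L(2)]]) blast
  note nn = lipschitz_on_nonneg[OF L(1)] lipschitz_on_nonneg[OF L(2)]
  have "(a * K + b * L)-lipschitz_on X (\<lambda>x. u x * v x)"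
  proof (rule lipschitz_onI)
    fix x y assume xy: "x \<in> X" "y \<in> X"
    have "dist (u x * v x) (u y * v y) = \<bar>u x * (v x - v y) + v y * (u x - u y)\<bar>"
      by (simp add: dist_real_def algebra_simps)
    also have "\<dots> \<le> \<bar>u x\<bar> * \<bar>v x - v y\<bar> + \<bar>v y\<bar> * \<bar>u x - u y\<bar>"
      by (simp add: abs_mult[symmetric])
    also have "\<dots> \<le> a * (K * dist x y) + b * (L * dist x y)"
      using a(2) b(2) lipschitz_onD[OF L(1) xy] lipschitz_onD[OF L(2) xy] xy a(1) b(1) nn
      by (intro add_mono mult_mono) (auto simp: dist_real_def)
    finally show "dist (u x * v x) (u y * v y) \<le> (a * K + b * L) * dist x y" by (simp add: algebra_simps)
  qed (use nn a b in auto)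
  then show ?thesis ..
qed

lemma lipschitz_inverse:
  fixes u :: "'a::metric_space \<Rightarrow> real"
  assumes "compact X" "\<exists>L. L-lipschitz_on X u" "\<forall>x\<in>X. 0 < u x"
  shows "\<exists>L. L-lipschitz_on X (\<lambda>x. inverse (u x))"
proof -
  obtain L where L: "L-lipschitz_on X u" using assms by blast
  obtain m where m: "0 < m" "\<And>x. x \<in> X \<Longrightarrow> m \<le> u x"
    by (rule compact_pos_lower_bound[OF assms(1) lipschitz_on_continuous_on[OF L] assms(3)]) blast
  have "(L / m\<^sup>2)-lipschitz_on X (\<lambda>x. inverse (u x))"
  proof (rule lipschitz_onI)
    fix x y assume xy: "x \<in> X" "y \<in> X"
    have p: "0 < u x" "0 < u y" using assms xy by auto
    then have "inverse (u x) - inverse (u y) = (u y - u x) / (u x * u y)"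
      by (simp add: field_simps)
    then have "dist (inverse (u x)) (inverse (u y)) = \<bar>u x - u y\<bar> / (u x * u y)"
      using p by (simp add: dist_real_def abs_divide abs_mult abs_minus_commute)
    also have "\<dots> \<le> (L * dist x y) / m\<^sup>2"
      using lipschitz_onD[OF L xy] m xy p unfolding power2_eq_square
      by (intro frac_le mult_mono mult_nonneg_nonneg lipschitz_on_nonneg[OF L]) (auto simp: dist_real_def)
    finally show "dist (inverse (u x)) (inverse (u y)) \<le> L / m\<^sup>2 * dist x y" by simp
  qed (use lipschitz_on_nonneg[OF L] in auto)
  then show ?thesis ..
qed

lemma lipschitz_add: "\<exists>L. L-lipschitz_on X (u :: 'a::metric_space \<Rightarrow> real) \<Longrightarrow> \<exists>L. L-lipschitz_on X v \<Longrightarrow>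
    \<exists>L. L-lipschitz_on X (\<lambda>x. u x + v x)"
  using lipschitz_on_add by blast

lemma lipschitz_const: "\<exists>L. L-lipschitz_on X (\<lambda>x. c)"
  by (rule exI[of _ 0]) (simp add: lipschitz_on_def)

text \<open>Within a time step both fields are evaluated at the starting point although the path
  moves on; these constants measure the error. Written out in entries, the fields are sums of
  products of polynomials with \<open>inverse (\<Psi> x)\<close>.\<close>

lemma log_grad_lipschitz:
  fixes \<Omega> :: "(real^'n) set"
  assumes \<Omega>: "compact \<Omega>" and p: "real_polynomial_function \<Psi>" and pos: "\<forall>x\<in>\<Omega>. 0 < \<Psi> x"
  shows "\<exists>L. L-lipschitz_on \<Omega> (log_grad lam \<Psi>)" "\<exists>L. L-lipschitz_on \<Omega> (log_hess lam \<Psi>)"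
proof -
  have P: "\<exists>L. L-lipschitz_on \<Omega> r" if "real_polynomial_function r" for r
    by (rule poly_lipschitz[OF that compact_imp_bounded[OF \<Omega>]]) blast
  note I = lipschitz_inverse[OF \<Omega> P[OF p] pos]
  have "\<exists>L. L-lipschitz_on \<Omega> (\<lambda>x. - lam * inverse (\<Psi> x) * grad \<Psi> x $ i)" for i
    by (rule lipschitz_mult[OF \<Omega> lipschitz_mult[OF \<Omega> lipschitz_const I] P[OF poly_grad[OF p]]])
  moreover have "(\<lambda>x. log_grad lam \<Psi> x $ i) = (\<lambda>x. - lam * inverse (\<Psi> x) * grad \<Psi> x $ i)" for i
    by (simp add: log_grad_def fun_eq_iff divide_inverse)
  ultimately show "\<exists>L. L-lipschitz_on \<Omega> (log_grad lam \<Psi>)" by (intro lipschitz_vecI) (simp only:)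
  have "\<exists>L. L-lipschitz_on \<Omega> (\<lambda>x. - lam * inverse (\<Psi> x) * hess \<Psi> x $ i $ j
      + lam * inverse (\<Psi> x) * inverse (\<Psi> x) * grad \<Psi> x $ i * grad \<Psi> x $ j)" for i j
    by (rule lipschitz_add[OF lipschitz_mult[OF \<Omega> lipschitz_mult[OF \<Omega> lipschitz_const I] P[OF poly_hess_poly[OF p]]]
        lipschitz_mult[OF \<Omega> lipschitz_mult[OF \<Omega> lipschitz_mult[OF \<Omega> lipschitz_mult[OF \<Omega> lipschitz_const I] I]
          P[OF poly_grad[OF p]]] P[OF poly_grad[OF p]]]])
  moreover have "(\<lambda>x. log_hess lam \<Psi> x $ i $ j) = (\<lambda>x. - lam * inverse (\<Psi> x) * hess \<Psi> x $ i $ j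
      + lam * inverse (\<Psi> x) * inverse (\<Psi> x) * grad \<Psi> x $ i * grad \<Psi> x $ j)" for i j
    by (simp add: log_hess_def outer_def fun_eq_iff divide_inverse power2_eq_square mult.assoc)
  ultimately show "\<exists>L. L-lipschitz_on \<Omega> (log_hess lam \<Psi>)" by (intro lipschitz_vecI) (simp only:)
qed

section \<open>The HJB inequality under the feedback control\<close>

lemma matrix_vector_mult_minus_right: "(A :: real^'m^'n) *v (- x) = - (A *v x)"
  using matrix_vector_mult_scaleR[of A "-1" x] by simp

lemma positive_definite_invertible:
  assumes "positive_definite (R :: real^'m^'m)"
  shows "R ** matrix_inv R = mat 1"
proof -
  have "R *v x = 0 \<Longrightarrow> x = 0" for x
    using assms by (force simp: positive_definite_def)
  then have "invertible R"
    using matrix_left_invertible_ker invertible_left_inverse by blast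
  then show ?thesis unfolding invertible_def matrix_inv_def by (rule someI2_ex) blast
qed

text \<open>All quadratic terms are multiples of z: the control adds -z to the generator, the outer
  product in \<open>log_hess\<close> adds z/2, and the control cost on the right is z/2, so they
  cancel. What remains is the inequality for \<Psi>, multiplied by lam / \<Psi>.\<close>

lemma generator_log_le:
  fixes G :: "real^'n \<Rightarrow> real^'m^'n" and B :: "real^'n \<Rightarrow> real^'l^'n"
  assumes R: "positive_definite R" and "0 < lam" and pos: "0 < \<Psi> x"
    and sub: "1 / lam * q x * \<Psi> x - gen_L f B S \<Psi> x \<le> 0"
    and cov: "lam *\<^sub>R (G x ** matrix_inv R ** transpose (G x)) = noise_cov B S x"
    and u: "u = - (matrix_inv R *v (transpose (G x) *v log_grad lam \<Psi> x))"
  shows "log_grad lam \<Psi> x \<bullet> (f x + G x *v u) + 1/2 * trace (log_hess lam \<Psi> x ** noise_cov B S x)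
     \<le> - (q x + 1/2 * (u \<bullet> (R *v u)))"
proof -
  define v where "v = grad \<Psi> x"
  define p where "p = log_grad lam \<Psi> x"
  define w where "w = transpose (G x) *v p"
  define z where "z = w \<bullet> (matrix_inv R *v w)"
  let ?\<Sigma> = "noise_cov B S x"
  have p: "p = - (lam / \<Psi> x) *\<^sub>R v" by (simp add: p_def v_def log_grad_def)
  have u': "u = - (matrix_inv R *v w)" by (simp add: u w_def p_def)
  have 1: "p \<bullet> (G x *v u) = - z"
    by (simp add: u' z_def w_def dot_lmul_matrix[symmetric] transpose_matrix_vector matrix_vector_mult_minus_right)
  have "R *v (matrix_inv R *v w) = w"
    by (simp add: matrix_vector_mul_assoc positive_definite_invertible[OF R])
  then have 2: "u \<bullet> (R *v u) = z"
    by (simp add: u' z_def matrix_vector_mult_minus_right inner_commute)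
  \<comment> \<open>Here noise and control meet: \<open>cov\<close> makes the noise form of p equal
    to lam times its control form.\<close>
  have 3: "p \<bullet> (?\<Sigma> *v p) = lam * z"
    unfolding cov[symmetric]
    by (simp add: z_def w_def scaleR_matrix_vector_assoc[symmetric] matrix_vector_mul_assoc[symmetric]
        dot_lmul_matrix[symmetric] transpose_matrix_vector)
  have v: "v = - (\<Psi> x / lam) *\<^sub>R p" using \<open>0 < lam\<close> pos by (simp add: p)
  have "v \<bullet> (?\<Sigma> *v v) = (\<Psi> x / lam)\<^sup>2 * (p \<bullet> (?\<Sigma> *v p))"
    by (subst (1 2) v) (simp add: matrix_vector_mult_scaleR matrix_vector_mult_minus_right power2_eq_square)
  then have 4: "v \<bullet> (?\<Sigma> *v v) = (\<Psi> x)\<^sup>2 * z / lam"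
    using \<open>0 < lam\<close> by (simp add: 3 power2_eq_square field_simps)
  have add: "trace ((A + B') ** C) = trace (A ** C) + trace (B' ** C)" for A B' C :: "real^'n^'n"
    by (simp add: trace_def matrix_matrix_mult_def distrib_right sum.distrib)
  have sc: "trace (c *\<^sub>R A ** C) = c * trace (A ** C)" for c and A C :: "real^'n^'n"
    by (simp add: trace_def matrix_matrix_mult_def sum_distrib_left mult.assoc)
  have "trace (log_hess lam \<Psi> x ** ?\<Sigma>) =
      - (lam / \<Psi> x) * trace (hess \<Psi> x ** ?\<Sigma>) + lam / (\<Psi> x)\<^sup>2 * (v \<bullet> (?\<Sigma> *v v))"
    unfolding log_hess_def add sc trace_outer_mult v_def by simp
  also have "\<dots> = - (lam / \<Psi> x) * trace (hess \<Psi> x ** ?\<Sigma>) + z"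
    using pos \<open>0 < lam\<close> by (simp add: 4)
  finally have 5: "trace (log_hess lam \<Psi> x ** ?\<Sigma>) = - (lam / \<Psi> x) * trace (hess \<Psi> x ** ?\<Sigma>) + z" .
  have 6: "p \<bullet> f x = - (lam / \<Psi> x) * (f x \<bullet> v)" by (simp add: p inner_commute)
  have "q x \<le> (lam / \<Psi> x) * gen_L f B S \<Psi> x"
    using sub pos \<open>0 < lam\<close> by (simp add: field_simps)
  then have "q x \<le> (lam / \<Psi> x) * (f x \<bullet> v) + 1/2 * ((lam / \<Psi> x) * trace (hess \<Psi> x ** ?\<Sigma>))"
    by (simp add: gen_L_def v_def algebra_simps)
  then show ?thesis
    unfolding p_def[symmetric] inner_add_right 1 2 5 6 by (simp add: algebra_simps)
qed

section \<open>Brownian increments\<close>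

text \<open>The moments 0, \<sigma>^2 and 3 \<sigma>^4 of a centred normal variable. The degenerate
  case is treated apart, because its law is the point mass at 0 and has no density.\<close>

lemma gaussian_moments:
  assumes "centred_gaussian M Z C" and nn: "0 \<le> v \<bullet> (C *v v)"
  shows "has_bochner_integral M (\<lambda>w. v \<bullet> Z w) 0"
    "has_bochner_integral M (\<lambda>w. (v \<bullet> Z w)\<^sup>2) (v \<bullet> (C *v v))"
    "has_bochner_integral M (\<lambda>w. (v \<bullet> Z w) ^ 4) (3 * (v \<bullet> (C *v v))\<^sup>2)"
proof -
  define s where "s = v \<bullet> (C *v v)"
  have meas: "(\<lambda>w. v \<bullet> Z w) \<in> borel_measurable M"
    using assms by (auto simp: centred_gaussian_def)
  have D: "distr M borel (\<lambda>w. v \<bullet> Z w) = (if s = 0 then return borel 0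
         else density lborel (\<lambda>y. ennreal (normal_density 0 (sqrt s) y)))"
    using assms by (auto simp: centred_gaussian_def s_def)
  have tr: "has_bochner_integral M (\<lambda>w. (v \<bullet> Z w) ^ k) c"
    if "has_bochner_integral (distr M borel (\<lambda>w. v \<bullet> Z w)) (\<lambda>y. y ^ k) c" for k c
    using that unfolding has_bochner_integral_iff by (simp add: integrable_distr_eq[OF meas] integral_distr[OF meas])
  have den: "has_bochner_integral (density lborel (\<lambda>y. ennreal (normal_density 0 \<sigma> y))) (\<lambda>y. y ^ k) c"
    if "has_bochner_integral lborel (\<lambda>y. normal_density 0 \<sigma> y * (y - 0) ^ k) c" "0 < \<sigma>" for k c \<sigma>
    using that by (intro has_bochner_integral_density) (auto simp: normal_density_nonneg)
  have "has_bochner_integral (distr M borel (\<lambda>w. v \<bullet> Z w)) (\<lambda>y. y ^ 1) 0 \<and>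
    has_bochner_integral (distr M borel (\<lambda>w. v \<bullet> Z w)) (\<lambda>y. y ^ 2) s \<and>
    has_bochner_integral (distr M borel (\<lambda>w. v \<bullet> Z w)) (\<lambda>y. y ^ 4) (3 * s\<^sup>2)"
  proof (cases "s = 0")
    case True
    have "has_bochner_integral (return borel (0::real)) (\<lambda>y. y ^ Suc k) 0" for k
    proof (subst has_bochner_integral_cong_AE)
      show "AE y in return borel (0::real). y ^ Suc k = 0" by (subst AE_return) auto
    qed auto
    from this[of 0] this[of 1] this[of 3] show ?thesis
      using True unfolding D by (simp add: eval_nat_numeral)
  next
    case False
    then have s: "0 < s" using nn by (simp add: s_def)
    have 1: "has_bochner_integral lborel (\<lambda>y. normal_density 0 (sqrt s) y * (y - 0) ^ 1) 0"
      using normal_moment_odd[where \<mu>=0 and \<sigma>="sqrt s" and k=0] s by simp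
    have 2: "has_bochner_integral lborel (\<lambda>y. normal_density 0 (sqrt s) y * (y - 0) ^ 2) s"
      using normal_moment_even[where \<mu>=0 and \<sigma>="sqrt s" and k=1] s by (simp add: fact_numeral)
    have 3: "has_bochner_integral lborel (\<lambda>y. normal_density 0 (sqrt s) y * (y - 0) ^ 4) (3 * s\<^sup>2)"
      using normal_moment_even[where \<mu>=0 and \<sigma>="sqrt s" and k=2] s by (simp add: fact_numeral power2_eq_square field_simps)
    from den[OF 1] den[OF 2] den[OF 3] s show ?thesis unfolding D by simp
  qed
  then show "has_bochner_integral M (\<lambda>w. v \<bullet> Z w) 0"
    "has_bochner_integral M (\<lambda>w. (v \<bullet> Z w)\<^sup>2) (v \<bullet> (C *v v))"
    "has_bochner_integral M (\<lambda>w. (v \<bullet> Z w) ^ 4) (3 * (v \<bullet> (C *v v))\<^sup>2)"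
    using tr[of 1 0] tr[of 2 s] tr[of 4 "3 * s\<^sup>2"] by (auto simp: s_def)
qed

locale brownian_basis = prob_space M for M :: "'w measure" +
  fixes F :: "real \<Rightarrow> 'w measure" and S :: "real^'l^'l" and W :: "real \<Rightarrow> 'w \<Rightarrow> real^'l"
  assumes filt: "filtration (space M) F" and subalg: "\<And>t. subalgebra M (F t)"
    and psd: "positive_semidefinite S" and bm: "brownian_motion M F S W"
begin

lemma space_F [simp]: "space (F t) = space M"
  using filt by (simp add: filtration_def)

lemma measurable_F_mono:
  assumes "f \<in> measurable (F s) N" "s \<le> t"
  shows "f \<in> measurable (F t) N"
proof (rule measurable_from_subalg[OF _ assms(1)])
  show "subalgebra (F t) (F s)"
    using filt assms(2) by (simp add: subalgebra_def filtration_def)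
qed

lemma measurable_F_M: "f \<in> measurable (F s) N \<Longrightarrow> f \<in> measurable M N"
  by (rule measurable_from_subalg[OF subalg])

lemma S_sym: "S $ i $ j = S $ j $ i"
proof -
  have "transpose S $ j $ i = S $ i $ j" by (simp add: transpose_def)
  moreover have "transpose S = S" using psd unfolding positive_semidefinite_def by (rule conjunct1)
  ultimately show ?thesis by (simp only:)
qed

lemma W_measurable: "0 \<le> s \<Longrightarrow> s \<le> t \<Longrightarrow> W s \<in> borel_measurable (F t)"
proof (rule measurable_F_mono[of "W s" s])
  show "0 \<le> s \<Longrightarrow> W s \<in> borel_measurable (F s)" using bm unfolding brownian_motion_def by blast
qed

lemma W_measurable_M [measurable]: "0 \<le> s \<Longrightarrow> W s \<in> borel_measurable M"
  using W_measurable[of s s] by (auto intro: measurable_F_M)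

lemma increment_gaussian:
  "0 \<le> s \<Longrightarrow> s \<le> t \<Longrightarrow> centred_gaussian M (\<lambda>w. W t w - W s w) ((t - s) *\<^sub>R S)"
  using bm by (simp add: brownian_motion_def)

text \<open>Independence is given for the \<sigma>-algebra F_s and the preimages under the
  increment. The preimages under Z and under \<phi> of the increment form subfamilies; being stable
  under intersection, they remain independent after passing to the generated \<sigma>-algebras,
  which are what \<open>indep_var\<close> compares.\<close>

lemma increment_indep:
  fixes Z :: "'w \<Rightarrow> real" and \<phi> :: "real^'l \<Rightarrow> real"
  assumes st: "0 \<le> s" "s \<le> t" and Z: "Z \<in> borel_measurable (F s)" "integrable M Z"
    and \<phi>: "\<phi> \<in> borel_measurable borel"
    and h: "has_bochner_integral M (\<lambda>w. \<phi> (W t w - W s w)) c"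
  shows "has_bochner_integral M (\<lambda>w. Z w * \<phi> (W t w - W s w)) (expectation Z * c)"
proof -
  let ?Y = "\<lambda>w. \<phi> (W t w - W s w)"
  let ?A = "{Z -` A \<inter> space M | A. A \<in> sets borel}" and ?B = "{?Y -` A \<inter> space M | A. A \<in> sets borel}"
  have ind: "indep_set (sets (F s)) {(\<lambda>w. W t w - W s w) -` A \<inter> space M | A. A \<in> sets borel}"
    using bm st by (simp add: brownian_motion_def)
  have "?A \<subseteq> sets (F s)"
    using measurable_sets[OF Z(1)] by auto
  moreover have "?B \<subseteq> {(\<lambda>w. W t w - W s w) -` A \<inter> space M | A. A \<in> sets borel}"
  proof
    fix X assume "X \<in> ?B"
    then obtain A where A: "A \<in> sets borel" "X = ?Y -` A \<inter> space M" by blast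
    then have "X = (\<lambda>w. W t w - W s w) -` (\<phi> -` A) \<inter> space M" by auto
    moreover have "\<phi> -` A \<in> sets borel" using measurable_sets[OF \<phi> A(1)] by simp
    ultimately show "X \<in> {(\<lambda>w. W t w - W s w) -` A \<inter> space M | A. A \<in> sets borel}"
      by (intro CollectI exI[of _ "\<phi> -` A"] conjI)
  qed
  ultimately have "indep_set ?A ?B"
    using ind unfolding indep_sets2_eq by (meson subset_iff)
  moreover have "Int_stable ?A"
  proof (rule Int_stableI)
    fix a b assume "a \<in> ?A" "b \<in> ?A"
    then obtain A A' where "A \<in> sets borel" "A' \<in> sets borel" "a = Z -` A \<inter> space M" "b = Z -` A' \<inter> space M" by blast
    then show "a \<inter> b \<in> ?A" by (intro CollectI exI[of _ "A \<inter> A'"]) auto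
  qed
  moreover have "Int_stable ?B"
  proof (rule Int_stableI)
    fix a b assume "a \<in> ?B" "b \<in> ?B"
    then obtain A A' where "A \<in> sets borel" "A' \<in> sets borel" "a = ?Y -` A \<inter> space M" "b = ?Y -` A' \<inter> space M" by blast
    then show "a \<inter> b \<in> ?B" by (intro CollectI exI[of _ "A \<inter> A'"]) auto
  qed
  ultimately have "indep_set (sigma_sets (space M) ?A) (sigma_sets (space M) ?B)"
    by (rule indep_set_sigma_sets)
  moreover have "Z \<in> borel_measurable M" using Z(1) by (rule measurable_F_M)
  moreover have "?Y \<in> borel_measurable M" using h by (auto simp: has_bochner_integral_iff)
  ultimately have iv: "indep_var borel Z borel ?Y" by (simp add: indep_var_eq)
  show ?thesis
    using indep_var_lebesgue_integral[OF iv Z(2)] indep_var_integrable[OF iv Z(2)] h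
    by (auto simp: has_bochner_integral_iff)
qed

lemma scaled_form: "v \<bullet> ((c *\<^sub>R S) *v v) = c * (v \<bullet> (S *v v))"
  by (simp add: scaleR_matrix_vector_assoc[symmetric])

lemma axis_form: "axis i 1 \<bullet> (S *v axis j 1) = S $ i $ j"
  by (simp add: matrix_vector_mul_component inner_axis inner_axis' matrix_vector_mult_basis column_def)

text \<open>\<open>centred_gaussian\<close> speaks of one linear functional at a time, so the mixed
  second moments are obtained by polarisation from the functionals \<open>axis i 1\<close>,
  \<open>axis j 1\<close> and their sum.\<close>

lemma increment_moments:
  assumes st: "0 \<le> s" "s \<le> t"
  shows "has_bochner_integral M (\<lambda>w. (W t w - W s w) $ i) 0"
    "has_bochner_integral M (\<lambda>w. (W t w - W s w) $ i * (W t w - W s w) $ j) ((t - s) * S $ i $ j)"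
    "has_bochner_integral M (\<lambda>w. ((W t w - W s w) $ i) ^ 4) (3 * ((t - s) * S $ i $ i)\<^sup>2)"
proof -
  let ?D = "\<lambda>w. W t w - W s w"
  have nn: "0 \<le> v \<bullet> (((t - s) *\<^sub>R S) *v v)" for v
    using psd st by (simp add: scaled_form positive_semidefinite_def)
  note G = gaussian_moments[OF increment_gaussian[OF st] nn, unfolded scaled_form]
  have ax: "axis k 1 \<bullet> x = x $ k" for k and x :: "real^'l" by (simp add: inner_axis')
  have sx: "(S *v axis j 1) $ i = S $ i $ j" for i j using axis_form[of i j] unfolding ax .
  show "has_bochner_integral M (\<lambda>w. ?D w $ i) 0" using G(1)[of "axis i 1"] unfolding ax .
  show "has_bochner_integral M (\<lambda>w. (?D w $ i) ^ 4) (3 * ((t - s) * S $ i $ i)\<^sup>2)"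
    using G(3)[of "axis i 1"] unfolding ax sx .
  have 1: "has_bochner_integral M (\<lambda>w. (?D w $ i)\<^sup>2) ((t - s) * S $ i $ i)" for i
    using G(2)[of "axis i 1"] unfolding ax sx .
  have 2: "has_bochner_integral M (\<lambda>w. (?D w $ i + ?D w $ j)\<^sup>2)
      ((t - s) * (S $ i $ i + S $ j $ j + 2 * S $ i $ j))"
  proof -
    have "(axis i 1 + axis j 1) \<bullet> (S *v (axis i 1 + axis j 1)) = S $ i $ i + S $ j $ j + 2 * S $ i $ j"
      by (simp add: inner_add_left matrix_vector_right_distrib ax sx S_sym[of j i])
    moreover have "(axis i 1 + axis j 1) \<bullet> ?D w = ?D w $ i + ?D w $ j" for w
      by (simp only: inner_add_left ax)
    ultimately show ?thesis using G(2)[of "axis i 1 + axis j 1"] by (simp only:)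
  qed
  have 3: "has_bochner_integral M (\<lambda>w. 1/2 * ((?D w $ i + ?D w $ j)\<^sup>2 - (?D w $ i)\<^sup>2 - (?D w $ j)\<^sup>2))
      (1/2 * ((t - s) * (S $ i $ i + S $ j $ j + 2 * S $ i $ j) - (t - s) * S $ i $ i - (t - s) * S $ j $ j))"
    by (intro has_bochner_integral_mult_right has_bochner_integral_diff 1 2)
  have "(\<lambda>w. 1/2 * ((?D w $ i + ?D w $ j)\<^sup>2 - (?D w $ i)\<^sup>2 - (?D w $ j)\<^sup>2)) = (\<lambda>w. ?D w $ i * ?D w $ j)"
    by (simp add: fun_eq_iff power2_eq_square algebra_simps)
  moreover have "1/2 * ((t - s) * (S $ i $ i + S $ j $ j + 2 * S $ i $ j) - (t - s) * S $ i $ i - (t - s) * S $ j $ j) = (t - s) * S $ i $ j"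
    by (simp add: algebra_simps)
  ultimately show "has_bochner_integral M (\<lambda>w. ?D w $ i * ?D w $ j) ((t - s) * S $ i $ j)"
    using 3 by (simp only:)
qed

lemma increment_mean_mult:
  assumes st: "0 \<le> s" "s \<le> t" and Z: "Z \<in> borel_measurable (F s)" "integrable M Z"
  shows "has_bochner_integral M (\<lambda>w. Z w * (W t w - W s w) $ i) 0"
  using increment_indep[OF st Z, where \<phi>="\<lambda>x. x $ i", OF _ increment_moments(1)[OF st, of i]]
  by simp

lemma increment_cov_mult:
  assumes st: "0 \<le> s" "s \<le> t" and Z: "Z \<in> borel_measurable (F s)" "integrable M Z"
  shows "has_bochner_integral M (\<lambda>w. Z w * ((W t w - W s w) $ i * (W t w - W s w) $ j)) (expectation Z * ((t - s) * S $ i $ j))"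
  using increment_indep[OF st Z, where \<phi>="\<lambda>x. x $ i * x $ j", OF _ increment_moments(2)[OF st, of i j]]
  by simp

lemma integrable_bounded_mult:
  assumes "x \<in> borel_measurable M" "\<And>w. w \<in> space M \<Longrightarrow> \<bar>x w :: real\<bar> \<le> C" "integrable M y"
  shows "integrable M (\<lambda>w. x w * y w)"
proof (rule Bochner_Integration.integrable_bound)
  show "integrable M (\<lambda>w. C * \<bar>y w\<bar>)" using assms(3) by simp
  show "AE w in M. norm (x w * y w) \<le> norm (C * \<bar>y w\<bar>)"
  proof (rule AE_I2)
    fix w assume "w \<in> space M"
    then have "\<bar>x w\<bar> * \<bar>y w\<bar> \<le> C * \<bar>y w\<bar>" using assms(2) by (intro mult_right_mono) auto
    then have "norm (x w * y w) \<le> C * \<bar>y w\<bar>" by (simp add: abs_mult)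
    then show "norm (x w * y w) \<le> norm (C * \<bar>y w\<bar>)" by simp
  qed
qed (use assms in auto)

text \<open>Both intervals are cut at c and at m = min b d. Increments over disjoint pieces are
  uncorrelated even with the weight z, since the earlier one and z are known when the later one
  starts. Only the common piece (c, m] contributes, by its length.\<close>

lemma increment_pair_le:
  assumes ab: "0 \<le> a" "a \<le> b" "a \<le> c" "c \<le> d"
    and z: "z \<in> borel_measurable (F c)" "\<And>w. w \<in> space M \<Longrightarrow> \<bar>z w\<bar> \<le> C"
  shows "has_bochner_integral M (\<lambda>w. z w * ((W b w - W a w) $ i * (W d w - W c w) $ j))
     (expectation z * (measure lborel ({a<..b} \<inter> {c<..d}) * S $ i $ j))"
proof -
  have zM: "z \<in> borel_measurable M" using z(1) by (rule measurable_F_M)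
  have zi: "integrable M z" using zM z(2) by (intro integrable_const_bound[where B=C]) auto
  have cross: "has_bochner_integral M (\<lambda>w. z w * ((W b' w - W a' w) $ i' * (W d' w - W c' w) $ j')) 0"
    if "0 \<le> a'" "a' \<le> b'" "b' \<le> c'" "c' \<le> d'" "c \<le> c'" for a' b' c' d' i' j'
  proof -
    have "has_bochner_integral M (\<lambda>w. (z w * (W b' w - W a' w) $ i') * (W d' w - W c' w) $ j') 0"
    proof (rule increment_mean_mult)
      show "(\<lambda>w. z w * (W b' w - W a' w) $ i') \<in> borel_measurable (F c')"
        using measurable_F_mono[OF z(1) that(5)] W_measurable[of b' c'] W_measurable[of a' c'] that
        by (intro borel_measurable_times measurable_compose[OF _ borel_measurable_nth] borel_measurable_diff) auto
      show "integrable M (\<lambda>w. z w * (W b' w - W a' w) $ i')"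
        using increment_moments(1)[OF that(1,2), of i'] by (intro integrable_bounded_mult[where C=C] zM z(2)) (auto simp: has_bochner_integral_iff)
    qed (use that ab in auto)
    then show ?thesis by (simp add: mult.assoc)
  qed
  show ?thesis
  proof (cases "b \<le> c")
    case True
    then have e: "{a<..b} \<inter> {c<..d} = {}" by auto
    show ?thesis unfolding e using cross[of a b c d i j] ab True by simp
  next
    case False
    define m where "m = min b d"
    have m: "c \<le> m" "m \<le> b" "m \<le> d" "0 \<le> c" "0 \<le> m" using False ab by (auto simp: m_def)
    have "{a<..b} \<inter> {c<..d} = {c<..m}" using ab by (auto simp: m_def)
    then have meas: "measure lborel ({a<..b} \<inter> {c<..d}) = m - c" using m by simp
    have main: "has_bochner_integral M (\<lambda>w. z w * ((W m w - W c w) $ i * (W m w - W c w) $ j)) (expectation z * ((m - c) * S $ i $ j))"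
      by (rule increment_cov_mult[OF m(4,1) z(1) zi])
    have c1: "has_bochner_integral M (\<lambda>w. z w * ((W c w - W a w) $ i * (W d w - W c w) $ j)) 0"
      using ab by (intro cross) auto
    have c2: "has_bochner_integral M (\<lambda>w. z w * ((W m w - W c w) $ i * (W d w - W m w) $ j)) 0"
      using ab m by (intro cross) auto
    have c3: "has_bochner_integral M (\<lambda>w. z w * ((W m w - W c w) $ j * (W b w - W m w) $ i)) 0"
      using ab m by (intro cross) auto
    \<comment> \<open>Since m is b or d, at least one of the two increments beyond m is
      trivial.\<close>
    have c4: "(W b w - W m w) $ i * (W d w - W m w) $ j = 0" for w
      by (cases "b \<le> d") (auto simp: m_def min_def)
    have "has_bochner_integral M (\<lambda>w. z w * ((W m w - W c w) $ i * (W m w - W c w) $ j)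
        + z w * ((W c w - W a w) $ i * (W d w - W c w) $ j) + z w * ((W m w - W c w) $ i * (W d w - W m w) $ j)
        + z w * ((W m w - W c w) $ j * (W b w - W m w) $ i)) (expectation z * ((m - c) * S $ i $ j) + 0 + 0 + 0)"
      by (intro has_bochner_integral_add main c1 c2 c3)
    moreover have "z w * ((W m w - W c w) $ i * (W m w - W c w) $ j)
        + z w * ((W c w - W a w) $ i * (W d w - W c w) $ j) + z w * ((W m w - W c w) $ i * (W d w - W m w) $ j)
        + z w * ((W m w - W c w) $ j * (W b w - W m w) $ i)
        = z w * ((W b w - W a w) $ i * (W d w - W c w) $ j)" for w
    proof -
      have "z w * ((W b w - W a w) $ i * (W d w - W c w) $ j) =
         z w * ((W m w - W c w) $ i * (W m w - W c w) $ j)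
        + z w * ((W c w - W a w) $ i * (W d w - W c w) $ j) + z w * ((W m w - W c w) $ i * (W d w - W m w) $ j)
        + z w * ((W m w - W c w) $ j * (W b w - W m w) $ i)
        + z w * ((W b w - W m w) $ i * (W d w - W m w) $ j)"
        unfolding vector_minus_component by algebra
      then show ?thesis unfolding c4 by simp
    qed
    ultimately show ?thesis
      unfolding meas add_0_right by (elim has_bochner_integral_cong[THEN iffD1, OF refl _ refl, rotated]) (simp only:)
  qed
qed

text \<open>Each coefficient is known at the start of its own interval, so their product is known at
  the later of the two starts. Symmetry of S allows the two increments to be exchanged.\<close>

lemma increment_pair:
  assumes "0 \<le> a" "a \<le> b" "0 \<le> c" "c \<le> d"
    and x: "x \<in> borel_measurable (F a)" "\<And>w. w \<in> space M \<Longrightarrow> \<bar>x w\<bar> \<le> C"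
    and y: "y \<in> borel_measurable (F c)" "\<And>w. w \<in> space M \<Longrightarrow> \<bar>y w\<bar> \<le> C'"
  shows "has_bochner_integral M (\<lambda>w. (x w * (W b w - W a w) $ i) * (y w * (W d w - W c w) $ j))
     (expectation (\<lambda>w. x w * y w) * (measure lborel ({a<..b} \<inter> {c<..d}) * S $ i $ j))"
proof -
  have bnd: "\<bar>x w * y w\<bar> \<le> C * C'" if "w \<in> space M" for w
    unfolding abs_mult using x(2) y(2) that by (intro mult_mono) (auto intro: order_trans[OF abs_ge_zero])
  show ?thesis
  proof (cases "a \<le> c")
    case True
    have "(\<lambda>w. x w * y w) \<in> borel_measurable (F c)"
      using measurable_F_mono[OF x(1) True] y(1) by simp
    from increment_pair_le[OF assms(1,2) True assms(4) this bnd, of i j]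
    show ?thesis by (simp only: mult.assoc mult.left_commute)
  next
    case False
    have xy: "(\<lambda>w. x w * y w) \<in> borel_measurable (F a)"
      using measurable_F_mono[OF y(1), of a] x(1) False by simp
    have "a \<ge> c" using False by simp
    from increment_pair_le[OF assms(3,4) this assms(2) xy bnd, of j i]
    have "has_bochner_integral M (\<lambda>w. (x w * y w) * ((W d w - W c w) $ j * (W b w - W a w) $ i))
     (expectation (\<lambda>w. x w * y w) * (measure lborel ({a<..b} \<inter> {c<..d}) * S $ i $ j))"
      unfolding S_sym[of j i] Int_commute[of "{c<..d}"] .
    moreover have "(x w * y w) * ((W d w - W c w) $ j * (W b w - W a w) $ i)
        = (x w * (W b w - W a w) $ i) * (y w * (W d w - W c w) $ j)" for w by simp
    ultimately show ?thesis by (elim has_bochner_integral_cong[THEN iffD1, OF refl _ refl, rotated]) (simp only:)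
  qed
qed

end

section \<open>Elementary stochastic integrals\<close>

text \<open>This is trace (X S Y^T), the covariance per unit of time of two stochastic integrals
  with integrands X and Y. The coordinate form turns bilinearity into linearity of sums and matches
  the expansion of an inner product of two elementary integrals.\<close>

definition cov_form :: "real^'l^'l \<Rightarrow> real^'l^'n \<Rightarrow> real^'l^'n \<Rightarrow> real" where
  "cov_form S X Y = (\<Sum>i\<in>UNIV. \<Sum>p\<in>UNIV. \<Sum>r\<in>UNIV. X $ i $ p * Y $ i $ r * S $ p $ r)"

lemma cov_form_trace: "cov_form S X Y = trace (X ** S ** transpose Y)"
proof -
  have "trace (X ** S ** transpose Y) = (\<Sum>i\<in>UNIV. \<Sum>r\<in>UNIV. \<Sum>p\<in>UNIV. X $ i $ p * S $ p $ r * Y $ i $ r)"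
    by (simp add: trace_def matrix_matrix_mult_def transpose_def sum_distrib_right)
  also have "\<dots> = (\<Sum>i\<in>UNIV. \<Sum>p\<in>UNIV. \<Sum>r\<in>UNIV. X $ i $ p * S $ p $ r * Y $ i $ r)"
    by (intro sum.cong refl sum.swap)
  finally show ?thesis by (simp add: cov_form_def mult.assoc mult.commute[of "S $ _ $ _"])
qed

lemma cov_form_add_left: "cov_form S (X + X') Y = cov_form S X Y + cov_form S X' Y"
  by (simp add: cov_form_def distrib_right sum.distrib)

lemma cov_form_add_right: "cov_form S X (Y + Y') = cov_form S X Y + cov_form S X Y'"
  by (simp add: cov_form_def distrib_left distrib_right sum.distrib)

lemma cov_form_bound:
  obtains c where "0 \<le> c" "\<And>X Y :: real^'l^'n. \<bar>cov_form S X Y\<bar> \<le> c * (norm X * norm Y)"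
proof
  let ?c = "\<Sum>i\<in>(UNIV :: 'n set). \<Sum>p\<in>UNIV. \<Sum>r\<in>UNIV. \<bar>S $ p $ r\<bar>"
  show "0 \<le> ?c" by (intro sum_nonneg) simp
  fix X Y :: "real^'l^'n"
  have c: "\<bar>Z $ i $ p\<bar> \<le> norm Z" for Z :: "real^'l^'n" and i p
    by (rule order_trans[OF component_le_norm_cart Finite_Cartesian_Product.norm_nth_le])
  have "\<bar>cov_form S X Y\<bar> \<le> (\<Sum>i\<in>(UNIV :: 'n set). \<Sum>p\<in>UNIV. \<Sum>r\<in>UNIV. \<bar>X $ i $ p * Y $ i $ r * S $ p $ r\<bar>)"
    unfolding cov_form_def by (intro order_trans[OF sum_abs] sum_mono sum_abs)
  also have "\<dots> \<le> (\<Sum>i\<in>(UNIV :: 'n set). \<Sum>p\<in>UNIV. \<Sum>r\<in>UNIV. norm X * norm Y * \<bar>S $ p $ r\<bar>)"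
    unfolding abs_mult by (intro sum_mono mult_right_mono mult_mono c) auto
  also have "\<dots> = ?c * (norm X * norm Y)"
    unfolding sum_distrib_right by (intro sum.cong refl mult.commute)
  finally show "\<bar>cov_form S X Y\<bar> \<le> ?c * (norm X * norm Y)" .
qed

lemma inner_matrix_vector_mult:
  fixes X Y :: "real^'l^'n"
  shows "(X *v d) \<bullet> (Y *v e) = (\<Sum>i\<in>UNIV. \<Sum>p\<in>UNIV. \<Sum>r\<in>UNIV. (X $ i $ p * d $ p) * (Y $ i $ r * e $ r))"
  by (simp add: inner_vec_def matrix_vector_mult_def sum_product)

lemma matrix_vector_mult_minus_left: "(- A :: real^'m^'n) *v x = - (A *v x)"
  using scaleR_matrix_vector_assoc[of "-1" A x] by simp

lemma ennreal_square_tendsto_0: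
  fixes x :: "nat \<Rightarrow> ennreal"
  assumes "(\<lambda>j. (x j)\<^sup>2) \<longlonglongrightarrow> 0"
  shows "x \<longlonglongrightarrow> 0"
proof (rule order_tendstoI)
  fix a :: ennreal assume "0 < a"
  then have "0 < a\<^sup>2" by (simp add: power2_eq_square ennreal_zero_less_mult_iff)
  then have "eventually (\<lambda>j. (x j)\<^sup>2 < a\<^sup>2) sequentially" by (rule order_tendstoD(2)[OF assms])
  then show "eventually (\<lambda>j. x j < a) sequentially"
  proof (rule eventually_mono)
    fix j assume "(x j)\<^sup>2 < a\<^sup>2"
    show "x j < a"
    proof (rule ccontr)
      assume "\<not> x j < a"
      then have "a\<^sup>2 \<le> (x j)\<^sup>2" unfolding power2_eq_square by (intro mult_mono) auto
      with \<open>(x j)\<^sup>2 < a\<^sup>2\<close> show False by simp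
    qed
  qed
qed simp

lemma ennreal_tendsto_0_le:
  fixes x y :: "nat \<Rightarrow> ennreal"
  assumes "\<And>j. x j \<le> y j" "y \<longlonglongrightarrow> 0"
  shows "x \<longlonglongrightarrow> 0"
  by (rule tendsto_sandwich[of "\<lambda>_. 0" x sequentially y]) (use assms in auto)

text \<open>Quadratic expressions in an approximant differ from their limits by a term linear in the
  error g, with a square-integrable weight, and possibly a term in g^2. Cauchy-Schwarz handles the
  former, and the latter tends to 0 by assumption.\<close>

lemma L2_limit_integral:
  fixes f g :: "nat \<Rightarrow> 'a \<Rightarrow> real"
  assumes g: "\<And>j. g j \<in> borel_measurable N" and \<phi>: "\<phi> \<in> borel_measurable N" "(\<integral>\<^sup>+z. ennreal ((\<phi> z)\<^sup>2) \<partial>N) < \<infinity>"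
    and lim: "(\<lambda>j. \<integral>\<^sup>+z. ennreal ((g j z)\<^sup>2) \<partial>N) \<longlonglongrightarrow> 0" and "0 \<le> c"
    and f: "\<And>j. AE z in N. \<bar>f j z\<bar> \<le> \<bar>\<phi> z\<bar> * \<bar>g j z\<bar> + c * (g j z)\<^sup>2"
  shows "(\<lambda>j. \<integral>z. f j z \<partial>N) \<longlonglongrightarrow> 0"
proof -
  note [measurable] = g \<phi>(1)
  let ?A = "\<lambda>j. \<integral>\<^sup>+z. ennreal \<bar>\<phi> z\<bar> * ennreal \<bar>g j z\<bar> \<partial>N" and ?B = "\<lambda>j. \<integral>\<^sup>+z. ennreal ((g j z)\<^sup>2) \<partial>N"
  have sq: "ennreal \<bar>x\<bar> ^ 2 = ennreal (x\<^sup>2)" for x :: real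
    by (simp add: ennreal_power)
  have "(?A j)\<^sup>2 \<le> (\<integral>\<^sup>+z. ennreal ((\<phi> z)\<^sup>2) \<partial>N) * ?B j" for j
    using Cauchy_Schwarz_nn_integral[of "\<lambda>z. ennreal \<bar>\<phi> z\<bar>" N "\<lambda>z. ennreal \<bar>g j z\<bar>"]
    unfolding sq by auto
  moreover have "(\<lambda>j. (\<integral>\<^sup>+z. ennreal ((\<phi> z)\<^sup>2) \<partial>N) * ?B j) \<longlonglongrightarrow> 0"
    using ennreal_tendsto_cmult[OF _ lim, of "\<integral>\<^sup>+z. ennreal ((\<phi> z)\<^sup>2) \<partial>N"] \<phi>(2) by simp
  ultimately have "(\<lambda>j. (?A j)\<^sup>2) \<longlonglongrightarrow> 0"
    by (rule ennreal_tendsto_0_le)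
  then have A: "?A \<longlonglongrightarrow> 0" by (rule ennreal_square_tendsto_0)
  have "(\<lambda>j. ?A j + ennreal c * ?B j) \<longlonglongrightarrow> 0 + ennreal c * 0"
    by (intro tendsto_add A ennreal_tendsto_cmult lim) simp
  then have AB: "(\<lambda>j. ?A j + ennreal c * ?B j) \<longlonglongrightarrow> 0" by simp
  have le: "ennreal (norm (\<integral>z. f j z \<partial>N)) \<le> ?A j + ennreal c * ?B j" for j
  proof (cases "integrable N (f j)")
    case True
    have "ennreal (norm (\<integral>z. f j z \<partial>N)) \<le> (\<integral>\<^sup>+z. ennreal (norm (f j z)) \<partial>N)"
      using True by (rule integral_norm_bound_ennreal)
    also have "\<dots> \<le> (\<integral>\<^sup>+z. ennreal \<bar>\<phi> z\<bar> * ennreal \<bar>g j z\<bar> + ennreal c * ennreal ((g j z)\<^sup>2) \<partial>N)"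
    proof (rule nn_integral_mono_AE)
      show "AE z in N. ennreal (norm (f j z)) \<le> ennreal \<bar>\<phi> z\<bar> * ennreal \<bar>g j z\<bar> + ennreal c * ennreal ((g j z)\<^sup>2)"
        using f[of j]
      proof eventually_elim
        case (elim z)
        have "ennreal \<bar>\<phi> z\<bar> * ennreal \<bar>g j z\<bar> + ennreal c * ennreal ((g j z)\<^sup>2) = ennreal (\<bar>\<phi> z\<bar> * \<bar>g j z\<bar> + c * (g j z)\<^sup>2)"
          using \<open>0 \<le> c\<close> by (simp add: ennreal_mult ennreal_plus)
        then show ?case using elim by (simp add: ennreal_leI)
      qed
    qed
    also have "\<dots> = ?A j + ennreal c * ?B j"
      by (subst nn_integral_add) (auto simp: nn_integral_cmult)
    finally show ?thesis .
  next
    \<comment> \<open>The integral of a non-integrable function is 0 by convention, so the estimate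
      is trivial.\<close>
    case False
    then show ?thesis by (simp add: not_integrable_integral_eq)
  qed
  have "(\<lambda>j. ennreal (norm (\<integral>z. f j z \<partial>N))) \<longlonglongrightarrow> 0"
    by (rule ennreal_tendsto_0_le[OF le AB])
  then have "(\<lambda>j. ennreal (norm (\<integral>z. f j z \<partial>N))) \<longlonglongrightarrow> ennreal 0" by simp
  then have "(\<lambda>j. norm (\<integral>z. f j z \<partial>N)) \<longlonglongrightarrow> 0"
    by (subst (asm) tendsto_ennreal_iff) auto
  then show ?thesis by (rule tendsto_norm_zero_cancel)
qed

section \<open>The polarised Ito isometry\<close>

context brownian_basis
begin

abbreviation PP :: "('w \<times> real) measure" where "PP \<equiv> M \<Otimes>\<^sub>M lborel"

sublocale PP: pair_sigma_finite M lborel ..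

lemma has_bochner_integral_prod:
  fixes x :: "'w \<Rightarrow> real" and k :: "real \<Rightarrow> real"
  assumes x: "integrable M x" and k: "integrable lborel k"
  shows "has_bochner_integral PP (\<lambda>z. x (fst z) * k (snd z)) (expectation x * (\<integral>s. k s \<partial>lborel))"
proof -
  have [measurable]: "x \<in> borel_measurable M" "k \<in> borel_measurable borel" using x k by auto
  have "integrable PP (\<lambda>z. x (fst z) * k (snd z))"
  proof (rule integrableI_bounded)
    have "(\<integral>\<^sup>+z. ennreal (norm (x (fst z) * k (snd z))) \<partial>PP) =
        (\<integral>\<^sup>+w. \<integral>\<^sup>+s. ennreal (norm (x w)) * ennreal (norm (k s)) \<partial>lborel \<partial>M)"
      by (subst lborel.nn_integral_fst[symmetric]) (simp_all add: abs_mult ennreal_mult)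
    also have "\<dots> = (\<integral>\<^sup>+w. ennreal (norm (x w)) \<partial>M) * (\<integral>\<^sup>+s. ennreal (norm (k s)) \<partial>lborel)"
      by (simp add: nn_integral_cmult nn_integral_multc)
    also have "\<dots> < \<infinity>" using x k by (simp add: integrable_iff_bounded ennreal_mult_less_top)
    finally show "(\<integral>\<^sup>+z. ennreal (norm (x (fst z) * k (snd z))) \<partial>PP) < \<infinity>" .
  qed measurable
  moreover from PP.integral_fst'[OF this] have "integral\<^sup>L PP (\<lambda>z. x (fst z) * k (snd z)) = expectation x * (\<integral>s. k s \<partial>lborel)"
    by simp
  ultimately show ?thesis by (simp add: has_bochner_integral_iff)
qed

text \<open>An elementary integrand and its integral, generated block by block. Blocks may overlap
  and come in any order, so sums and differences over different grids stay in the class and no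
  common refinement is formed.\<close>

inductive simple_pair :: "(real \<Rightarrow> 'w \<Rightarrow> real^'l^'n) \<Rightarrow> ('w \<Rightarrow> real^'n) \<Rightarrow> bool" where
  zero: "simple_pair (\<lambda>s w. 0) (\<lambda>w. 0)"
| step: "simple_pair p J \<Longrightarrow> 0 \<le> a \<Longrightarrow> a \<le> b \<Longrightarrow> \<xi> \<in> borel_measurable (F a) \<Longrightarrow>
    (\<And>w. w \<in> space M \<Longrightarrow> norm (\<xi> w) \<le> C) \<Longrightarrow>
    simple_pair (\<lambda>s w. p s w + indicator {a<..b} s *\<^sub>R \<xi> w) (\<lambda>w. J w + \<xi> w *v (W b w - W a w))"

lemma simple_pair_add:
  assumes "simple_pair p J" "simple_pair q K"
  shows "simple_pair (\<lambda>s w. p s w + q s w) (\<lambda>w. J w + K w)"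
  using assms(2)
proof induction
  case zero
  show ?case using assms(1) by simp
next
  case (step q K a b \<xi> C)
  from simple_pair.step[OF step.IH step.hyps(2-5)] show ?case by (simp add: add.assoc)
qed

lemma simple_pair_uminus:
  assumes "simple_pair p J"
  shows "simple_pair (\<lambda>s w. - p s w) (\<lambda>w. - J w)"
  using assms
proof induction
  case zero
  show ?case using simple_pair.zero by simp
next
  case (step q K a b \<xi> C)
  have "simple_pair (\<lambda>s w. - q s w + indicator {a<..b} s *\<^sub>R (- \<xi> w)) (\<lambda>w. - K w + (- \<xi> w) *v (W b w - W a w))"
    by (rule simple_pair.step[where C=C, OF step.IH]) (use step.hyps in auto)
  moreover have "(\<lambda>w. - K w + (- \<xi> w) *v (W b w - W a w)) = (\<lambda>w. - (K w + \<xi> w *v (W b w - W a w)))"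
    by (simp only: minus_add_distrib matrix_vector_mult_minus_left)
  moreover have "(\<lambda>s w. - q s w + indicator {a<..b} s *\<^sub>R (- \<xi> w)) = (\<lambda>s w. - (q s w + indicator {a<..b} s *\<^sub>R \<xi> w))"
    by (simp only: minus_add_distrib scaleR_minus_right)
  ultimately show ?case by (simp only:)
qed

lemma simple_pair_measurable:
  assumes "simple_pair p J"
  shows "(\<lambda>z. p (snd z) (fst z)) \<in> borel_measurable PP"
  using assms
proof induction
  case (step q K a b \<xi> C)
  note [measurable] = step.IH measurable_F_M[OF step.hyps(4)]
  show ?case by measurable
qed simp

text \<open>The isometry for a pair of integrands. Integrability of both sides is built into the
  relation, which makes it additive in each argument without side conditions.\<close>

definition isometric where
  "isometric p J q K \<longleftrightarrow> (\<exists>c. has_bochner_integral M (\<lambda>w. J w \<bullet> K w) c \<and>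
     has_bochner_integral PP (\<lambda>z. cov_form S (p (snd z) (fst z)) (q (snd z) (fst z))) c)"

lemma isometric_add_left:
  assumes "isometric p J q K" "isometric p' J' q K"
  shows "isometric (\<lambda>s w. p s w + p' s w) (\<lambda>w. J w + J' w) q K"
proof -
  from assms obtain c c' where "has_bochner_integral M (\<lambda>w. J w \<bullet> K w) c" "has_bochner_integral M (\<lambda>w. J' w \<bullet> K w) c'"
     "has_bochner_integral PP (\<lambda>z. cov_form S (p (snd z) (fst z)) (q (snd z) (fst z))) c"
     "has_bochner_integral PP (\<lambda>z. cov_form S (p' (snd z) (fst z)) (q (snd z) (fst z))) c'"
    unfolding isometric_def by (elim exE conjE)
  then show ?thesis unfolding isometric_def inner_add_left cov_form_add_left
    by (intro exI[of _ "c + c'"] conjI has_bochner_integral_add)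
qed

lemma isometric_add_right:
  assumes "isometric q K p J" "isometric q K p' J'"
  shows "isometric q K (\<lambda>s w. p s w + p' s w) (\<lambda>w. J w + J' w)"
proof -
  from assms obtain c c' where "has_bochner_integral M (\<lambda>w. K w \<bullet> J w) c" "has_bochner_integral M (\<lambda>w. K w \<bullet> J' w) c'"
     "has_bochner_integral PP (\<lambda>z. cov_form S (q (snd z) (fst z)) (p (snd z) (fst z))) c"
     "has_bochner_integral PP (\<lambda>z. cov_form S (q (snd z) (fst z)) (p' (snd z) (fst z))) c'"
    unfolding isometric_def by (elim exE conjE)
  then show ?thesis unfolding isometric_def inner_add_right cov_form_add_right
    by (intro exI[of _ "c + c'"] conjI has_bochner_integral_add)
qed

lemma isometric_single:
  fixes x y :: "'w \<Rightarrow> real^'l^'n"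
  assumes ab: "0 \<le> a" "a \<le> b" "0 \<le> c" "c \<le> d"
    and x: "x \<in> borel_measurable (F a)" "\<And>w. w \<in> space M \<Longrightarrow> norm (x w) \<le> C"
    and y: "y \<in> borel_measurable (F c)" "\<And>w. w \<in> space M \<Longrightarrow> norm (y w) \<le> C'"
  shows "isometric (\<lambda>s w. indicator {a<..b} s *\<^sub>R x w) (\<lambda>w. x w *v (W b w - W a w))
    (\<lambda>s w. indicator {c<..d} s *\<^sub>R y w) (\<lambda>w. y w *v (W d w - W c w))"
proof -
  let ?m = "measure lborel ({a<..b} \<inter> {c<..d})"
  let ?k = "\<lambda>s. indicat_real {a<..b} s * indicat_real {c<..d} s"
  have cm: "(\<lambda>w. u w $ i $ p) \<in> borel_measurable N" if "u \<in> borel_measurable N" for u :: "'w \<Rightarrow> real^'l^'n" and N i p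
    using that by (intro borel_measurable_continuous_on[OF _ that] continuous_intros)
  have cb: "\<bar>Z $ i $ p\<bar> \<le> norm Z" for Z :: "real^'l^'n" and i p
    by (rule order_trans[OF component_le_norm_cart Finite_Cartesian_Product.norm_nth_le])
  have xb: "\<bar>x w $ i $ p\<bar> \<le> C" "\<bar>y w $ i $ p\<bar> \<le> C'" if "w \<in> space M" for w i p
    using x(2)[OF that] y(2)[OF that] cb order_trans by blast+
  let ?c = "\<Sum>i\<in>UNIV. \<Sum>p\<in>UNIV. \<Sum>r\<in>UNIV. expectation (\<lambda>w. x w $ i $ p * y w $ i $ r) * (?m * S $ p $ r)"
  have 1: "has_bochner_integral M (\<lambda>w. (x w *v (W b w - W a w)) \<bullet> (y w *v (W d w - W c w))) ?c"
    unfolding inner_matrix_vector_mult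
    by (intro has_bochner_integral_sum increment_pair ab cm x(1) y(1)) (rule xb, assumption)+
  \<comment> \<open>The product of the two indicators integrates to the length of the overlap, the
    same factor as in \<open>increment_pair\<close>.\<close>
  have k: "?k s = indicator ({a<..b} \<inter> {c<..d}) s" for s by (auto simp: indicator_def)
  have ki: "integrable lborel ?k" "(\<integral>s. ?k s \<partial>lborel) = ?m"
    unfolding k by (auto intro!: emeasure_bounded_finite bounded_Int)
  have xy: "integrable M (\<lambda>w. x w $ i $ p * y w $ i $ r)" for i p r
  proof (rule integrable_const_bound[where B="C * C'"])
    show "AE w in M. norm (x w $ i $ p * y w $ i $ r) \<le> C * C'"
      unfolding real_norm_def abs_mult
      by (intro AE_I2 mult_mono xb abs_ge_zero) (auto intro: order_trans[OF abs_ge_zero xb(1)])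
    show "(\<lambda>w. x w $ i $ p * y w $ i $ r) \<in> borel_measurable M"
      by (intro borel_measurable_times cm measurable_F_M[OF x(1)] measurable_F_M[OF y(1)])
  qed
  have 2: "has_bochner_integral PP (\<lambda>z. \<Sum>i\<in>UNIV. \<Sum>p\<in>UNIV. \<Sum>r\<in>UNIV.
      (x (fst z) $ i $ p * y (fst z) $ i $ r) * (?k (snd z) * S $ p $ r)) ?c"
  proof (intro has_bochner_integral_sum)
    fix i p r
    have "has_bochner_integral PP (\<lambda>z. (x (fst z) $ i $ p * y (fst z) $ i $ r) * (?k (snd z) * S $ p $ r))
       (expectation (\<lambda>w. x w $ i $ p * y w $ i $ r) * (\<integral>s. ?k s * S $ p $ r \<partial>lborel))"
      by (rule has_bochner_integral_prod[OF xy]) (use ki in simp)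
    then show "has_bochner_integral PP (\<lambda>z. (x (fst z) $ i $ p * y (fst z) $ i $ r) * (?k (snd z) * S $ p $ r))
       (expectation (\<lambda>w. x w $ i $ p * y w $ i $ r) * (?m * S $ p $ r))"
      using ki(2) by simp
  qed
  have "cov_form S (indicator {a<..b} (snd z) *\<^sub>R x (fst z)) (indicator {c<..d} (snd z) *\<^sub>R y (fst z)) =
      (\<Sum>i\<in>UNIV. \<Sum>p\<in>UNIV. \<Sum>r\<in>UNIV. (x (fst z) $ i $ p * y (fst z) $ i $ r) * (?k (snd z) * S $ p $ r))" for z
    unfolding cov_form_def by (intro sum.cong refl) simp
  with 1 2 show ?thesis unfolding isometric_def by auto
qed

lemma isometric_zero: "isometric (\<lambda>s w. 0) (\<lambda>w. 0) q K" "isometric q K (\<lambda>s w. 0) (\<lambda>w. 0)"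
  unfolding isometric_def cov_form_def by auto

lemma simple_pair_isometric:
  assumes "simple_pair p J" "simple_pair q K"
  shows "isometric p J q K"
  using assms(1)
proof induction
  case zero
  show ?case by (rule isometric_zero)
next
  case (step p J a b \<xi> C)
  have "isometric (\<lambda>s w. indicator {a<..b} s *\<^sub>R \<xi> w) (\<lambda>w. \<xi> w *v (W b w - W a w)) q K"
    using assms(2)
  proof induction
    case zero
    show ?case by (rule isometric_zero)
  next
    case (step q K a' b' \<xi>' C')
    show ?case
      by (rule isometric_add_right[OF step.IH isometric_single[where C=C and C'=C']])
         (use step.hyps \<open>0 \<le> a\<close> \<open>a \<le> b\<close> \<open>\<xi> \<in> borel_measurable (F a)\<close> \<open>\<And>w. w \<in> space M \<Longrightarrow> norm (\<xi> w) \<le> C\<close> in auto)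
  qed
  from isometric_add_left[OF step.IH this] show ?case .
qed

text \<open>The isometry read as an estimate. The constant is the same for all pairs, so convergence
  of integrands in L2 forces convergence of their integrals.\<close>

lemma simple_pair_L2_bound:
  obtains c where "0 \<le> c" "\<And>p J. simple_pair p (J :: 'w \<Rightarrow> real^'n) \<Longrightarrow>
    (\<integral>\<^sup>+w. ennreal ((norm (J w))\<^sup>2) \<partial>M) \<le> ennreal c * (\<integral>\<^sup>+z. ennreal ((norm (p (snd z) (fst z)))\<^sup>2) \<partial>PP)"
proof -
  obtain c where c: "0 \<le> c" "\<And>X Y :: real^'l^'n. \<bar>cov_form S X Y\<bar> \<le> c * (norm X * norm Y)"
    by (rule cov_form_bound[of S]) blast
  have "(\<integral>\<^sup>+w. ennreal ((norm (J w))\<^sup>2) \<partial>M) \<le> ennreal c * (\<integral>\<^sup>+z. ennreal ((norm (p (snd z) (fst z)))\<^sup>2) \<partial>PP)"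
    if sp: "simple_pair p (J :: 'w \<Rightarrow> real^'n)" for p J
  proof -
    obtain e where e: "has_bochner_integral M (\<lambda>w. J w \<bullet> J w) e"
      "has_bochner_integral PP (\<lambda>z. cov_form S (p (snd z) (fst z)) (p (snd z) (fst z))) e"
      using simple_pair_isometric[OF sp sp] unfolding isometric_def by blast
    have [measurable]: "(\<lambda>z. p (snd z) (fst z)) \<in> borel_measurable PP" by (rule simple_pair_measurable[OF sp])
    have "(\<integral>\<^sup>+w. ennreal ((norm (J w))\<^sup>2) \<partial>M) = (\<integral>\<^sup>+w. ennreal (J w \<bullet> J w) \<partial>M)"
      by (simp add: power2_norm_eq_inner)
    also have "\<dots> = ennreal e"
      using nn_integral_eq_integral[of M "\<lambda>w. J w \<bullet> J w"] e(1) by (simp add: has_bochner_integral_iff)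
    also have "\<dots> \<le> ennreal (norm e)" by (simp add: ennreal_leI)
    also have "\<dots> \<le> (\<integral>\<^sup>+z. ennreal (norm (cov_form S (p (snd z) (fst z)) (p (snd z) (fst z)))) \<partial>PP)"
      using integral_norm_bound_ennreal[of PP "\<lambda>z. cov_form S (p (snd z) (fst z)) (p (snd z) (fst z))"] e(2)
      by (simp add: has_bochner_integral_iff)
    also have "\<dots> \<le> (\<integral>\<^sup>+z. ennreal c * ennreal ((norm (p (snd z) (fst z)))\<^sup>2) \<partial>PP)"
    proof (rule nn_integral_mono)
      fix z
      show "ennreal (norm (cov_form S (p (snd z) (fst z)) (p (snd z) (fst z)))) \<le> ennreal c * ennreal ((norm (p (snd z) (fst z)))\<^sup>2)"
        using c(2)[of "p (snd z) (fst z)" "p (snd z) (fst z)"] c(1)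
        by (simp add: ennreal_mult[symmetric] power2_eq_square ennreal_leI)
    qed
    also have "\<dots> = ennreal c * (\<integral>\<^sup>+z. ennreal ((norm (p (snd z) (fst z)))\<^sup>2) \<partial>PP)"
      by (rule nn_integral_cmult) measurable
    finally show ?thesis .
  qed
  then show ?thesis using that c(1) by blast
qed

end

section \<open>Second and fourth moments of elementary integrals\<close>

lemma norm_power4_le: "norm (x :: real^'n) ^ 4 \<le> real CARD('n) * (\<Sum>i\<in>UNIV. (x $ i) ^ 4)"
proof -
  have "norm x ^ 4 = (\<Sum>i\<in>UNIV. (x $ i)\<^sup>2)\<^sup>2"
  proof -
    have "(norm x)\<^sup>2 = (\<Sum>i\<in>UNIV. (x $ i)\<^sup>2)"
      unfolding power2_norm_eq_inner inner_vec_def by (simp add: power2_eq_square)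
    moreover have "norm x ^ 4 = ((norm x)\<^sup>2)\<^sup>2" by (simp add: power_mult[symmetric])
    ultimately show ?thesis by (simp only:)
  qed
  also have "\<dots> \<le> real CARD('n) * (\<Sum>i\<in>UNIV. ((x $ i)\<^sup>2)\<^sup>2)"
    using sum_squared_le_sum_of_squares[of "\<lambda>i. (x $ i)\<^sup>2" "UNIV :: 'n set"] by (simp add: mult.commute)
  finally show ?thesis by (simp add: power_mult[symmetric])
qed

text \<open>The term linear in d is kept, since it will have mean zero. With a = |x| and b = |d|,
  the term 4 (x . d)^2 is at most 4 a^2 b^2, and the term cubic in d is at most 4 a b^3 \<le> 2 a^2
  b^2 + 2 b^4; hence 8 = 2 + 4 + 2 and 3 = 1 + 2.\<close>

lemma norm_add_power4_expand:
  fixes x d :: "'a::real_inner"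
  shows "norm (x + d) ^ 4 \<le> norm x ^ 4 + 4 * ((norm x)\<^sup>2 * (x \<bullet> d)) + 8 * ((norm x)\<^sup>2 * (norm d)\<^sup>2) + 3 * norm d ^ 4"
proof -
  define a b c where "a = norm x" and "b = norm d" and "c = x \<bullet> d"
  have c: "\<bar>c\<bar> \<le> a * b" by (simp add: a_def b_def c_def Cauchy_Schwarz_ineq2)
  have ab: "0 \<le> a" "0 \<le> b" by (auto simp: a_def b_def)
  have "(norm (x + d))\<^sup>2 = a\<^sup>2 + 2 * c + b\<^sup>2"
    by (simp add: a_def b_def c_def power2_norm_eq_inner inner_add_left inner_add_right inner_commute)
  then have "norm (x + d) ^ 4 = (a\<^sup>2 + 2 * c + b\<^sup>2)\<^sup>2"
    by (metis mult_2 numeral_Bit0 power2_eq_square power_add)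
  also have "\<dots> = a ^ 4 + 4 * (a\<^sup>2 * c) + 2 * (a\<^sup>2 * b\<^sup>2) + b ^ 4 + 4 * c\<^sup>2 + 4 * c * b\<^sup>2"
    by algebra
  also have "4 * c\<^sup>2 \<le> 4 * (a\<^sup>2 * b\<^sup>2)"
    using power_mono[OF c, of 2] by (simp add: power_mult_distrib)
  also have "4 * c * b\<^sup>2 \<le> 4 * (a * b) * b\<^sup>2"
    using c by (intro mult_right_mono) auto
  also have "4 * (a * b) * b\<^sup>2 \<le> 2 * (a\<^sup>2 * b\<^sup>2) + 2 * b ^ 4"
  proof -
    have "2 * (a\<^sup>2 * b\<^sup>2) + 2 * b ^ 4 - 4 * (a * b) * b\<^sup>2 = 2 * (b * (a - b))\<^sup>2" by algebra
    then show ?thesis by (metis diff_ge_0_iff_ge mult_nonneg_nonneg zero_le_numeral zero_le_power2)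
  qed
  finally show ?thesis by (simp add: a_def b_def c_def mult_ac)
qed

lemma real_norm_mono: "0 \<le> (a::real) \<Longrightarrow> a \<le> b \<Longrightarrow> norm a \<le> norm b"
  by simp

context brownian_basis
begin

lemma elem_process_Suc: "elem_process (Suc k) \<tau> \<xi> s w = elem_process k \<tau> \<xi> s w + indicator {\<tau> k<..\<tau> (Suc k)} s *\<^sub>R \<xi> k w"
  by (simp add: elem_process_def)

lemma elem_integral_Suc: "elem_integral W (Suc k) \<tau> \<xi> w = elem_integral W k \<tau> \<xi> w + \<xi> k w *v (W (\<tau> (Suc k)) w - W (\<tau> k) w)"
  by (simp add: elem_integral_def)

lemma elementary_mono:
  assumes "elementary F t k \<tau> \<xi>" "i \<le> k"
  shows "0 \<le> \<tau> i" "\<tau> 0 \<le> \<tau> i" "\<tau> i \<le> \<tau> k"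
proof -
  have step: "\<And>i. i < k \<Longrightarrow> \<tau> i \<le> \<tau> (Suc i)" and 0: "0 \<le> \<tau> 0" using assms by (auto simp: elementary_def)
  have "\<tau> i \<le> \<tau> j" if "i \<le> j" "j \<le> k" for i j
    using that
  proof (induction j rule: dec_induct)
    case (step n)
    then show ?case using \<open>\<And>i. i < k \<Longrightarrow> \<tau> i \<le> \<tau> (Suc i)\<close>[of n] by simp
  qed simp
  from this[of 0 i] this[of i k] 0 assms(2) show "0 \<le> \<tau> i" "\<tau> 0 \<le> \<tau> i" "\<tau> i \<le> \<tau> k" by auto
qed

lemma elementary_simple_pair:
  assumes "elementary F t k \<tau> \<xi>"
  shows "simple_pair (elem_process k \<tau> \<xi>) (elem_integral W k \<tau> \<xi>)"
proof -
  have "simple_pair (elem_process j \<tau> \<xi>) (elem_integral W j \<tau> \<xi>)" if "j \<le> k" for j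
    using that
  proof (induction j)
    case 0
    have "elem_process 0 \<tau> \<xi> = (\<lambda>s w. 0)" "elem_integral W 0 \<tau> \<xi> = (\<lambda>w. 0)"
      by (simp_all add: elem_process_def elem_integral_def fun_eq_iff)
    then show ?case by (simp only: simple_pair.zero)
  next
    case (Suc j)
    obtain C where C: "\<And>w. w \<in> space M \<Longrightarrow> norm (\<xi> j w) \<le> C" and m: "\<xi> j \<in> borel_measurable (F (\<tau> j))"
      and le: "\<tau> j \<le> \<tau> (Suc j)"
      using assms Suc.prems unfolding elementary_def by (metis Suc_le_lessD space_F)
    have "simple_pair (\<lambda>s w. elem_process j \<tau> \<xi> s w + indicator {\<tau> j<..\<tau> (Suc j)} s *\<^sub>R \<xi> j w)
       (\<lambda>w. elem_integral W j \<tau> \<xi> w + \<xi> j w *v (W (\<tau> (Suc j)) w - W (\<tau> j) w))"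
      using Suc elementary_mono(1)[OF assms, of j] by (intro simple_pair.step[where C=C] C m le) auto
    then show ?case unfolding elem_process_Suc[symmetric] elem_integral_Suc[symmetric] .
  qed
  then show ?thesis by simp
qed

lemma increment_mean_inner:
  assumes st: "0 \<le> s" "s \<le> t" and V: "V \<in> borel_measurable (F s)" "integrable M (\<lambda>w. norm (V w))"
  shows "has_bochner_integral M (\<lambda>w. V w \<bullet> (W t w - W s w)) 0"
proof -
  have "has_bochner_integral M (\<lambda>w. \<Sum>i\<in>UNIV. V w $ i * (W t w - W s w) $ i) (\<Sum>i\<in>(UNIV::'l set). 0)"
  proof (intro has_bochner_integral_sum increment_mean_mult st)
    fix i
    show m: "(\<lambda>w. V w $ i) \<in> borel_measurable (F s)"
      by (rule measurable_compose[OF V(1) borel_measurable_nth])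
    show "integrable M (\<lambda>w. V w $ i)"
      by (rule Bochner_Integration.integrable_bound[OF V(2)])
         (use measurable_F_M[OF m] component_le_norm_cart in auto)
  qed
  then show ?thesis by (simp add: inner_vec_def)
qed

lemma inner_mat_adjoint: "v \<bullet> (A *v d) = (transpose A *v v) \<bullet> (d :: real^'l)"
  by (simp add: dot_lmul_matrix[symmetric] transpose_matrix_vector)

lemma norm_transpose: "norm (transpose (A :: real^'l^'n)) = norm A"
  by (simp add: norm_eq_sqrt_inner inner_vec_def transpose_def sum.swap[of _ "UNIV :: 'l set"])

lemma mat_measurable:
  assumes "A \<in> borel_measurable N" "v \<in> borel_measurable N"
  shows "(\<lambda>w. (A w :: real^'a^'b) *v v w) \<in> borel_measurable N"
    and "(\<lambda>w. transpose (A w)) \<in> borel_measurable N"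
proof -
  have "continuous_on UNIV (\<lambda>x :: (real^'a^'b) \<times> (real^'a). fst x *v snd x)"
    unfolding matrix_vector_mult_def by (intro continuous_intros)
  from borel_measurable_continuous_on[OF this borel_measurable_Pair[OF assms]]
  show "(\<lambda>w. (A w :: real^'a^'b) *v v w) \<in> borel_measurable N" by simp
  have "continuous_on UNIV (\<lambda>x :: real^'a^'b. transpose x)"
    unfolding transpose_def by (intro continuous_intros)
  from borel_measurable_continuous_on[OF this assms(1)]
  show "(\<lambda>w. transpose (A w)) \<in> borel_measurable N" .
qed

lemma elem_integral_measurable:
  assumes el: "elementary F t k \<tau> (\<xi> :: nat \<Rightarrow> 'w \<Rightarrow> real^'l^'n)"
  shows "elem_integral W k \<tau> \<xi> \<in> borel_measurable M"
  unfolding elem_integral_def[abs_def]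
proof (intro borel_measurable_sum mat_measurable(1) borel_measurable_diff W_measurable_M)
  fix i assume "i \<in> {..<k}"
  then show "0 \<le> \<tau> (Suc i)" "0 \<le> \<tau> i"
    using elementary_mono(1)[OF el, of i] elementary_mono(1)[OF el, of "Suc i"] by auto
  show "\<xi> i \<in> borel_measurable M"
    using el \<open>i \<in> {..<k}\<close> by (intro measurable_F_M[of _ "\<tau> i"]) (simp add: elementary_def)
qed

lemma increment_mean_mat:
  assumes st: "0 \<le> s" "s \<le> t" and V: "V \<in> borel_measurable (F s)" "integrable M (\<lambda>w. norm (V w))"
    and A: "A \<in> borel_measurable (F s)" "\<And>w. w \<in> space M \<Longrightarrow> norm (A w :: real^'l^'n) \<le> K"
  shows "has_bochner_integral M (\<lambda>w. V w \<bullet> (A w *v (W t w - W s w))) 0"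
  unfolding inner_mat_adjoint
proof (rule increment_mean_inner[OF st])
  show m: "(\<lambda>w. transpose (A w) *v V w) \<in> borel_measurable (F s)"
    by (intro mat_measurable(1) mat_measurable(2)[OF A(1) measurable_const[of 0]] V) simp
  show "integrable M (\<lambda>w. norm (transpose (A w) *v V w))"
  proof (rule Bochner_Integration.integrable_bound)
    show "integrable M (\<lambda>w. K * norm (V w))" using V(2) by simp
    show "AE w in M. norm (norm (transpose (A w) *v V w)) \<le> norm (K * norm (V w))"
    proof (rule AE_I2)
      fix w assume w: "w \<in> space M"
      have "norm (transpose (A w) *v V w) \<le> norm (A w) * norm (V w)"
        using norm_matrix_vector_mult_le[of "transpose (A w)"] by (simp add: norm_transpose)
      also have "\<dots> \<le> K * norm (V w)" using A(2)[OF w] by (intro mult_right_mono) auto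
      finally show "norm (norm (transpose (A w) *v V w)) \<le> norm (K * norm (V w))"
        by (intro real_norm_mono norm_ge_zero)
    qed
  qed (use measurable_F_M[OF m] in simp)
qed

definition noise_trace :: real where "noise_trace = (\<Sum>i\<in>UNIV. S $ i $ i)"
text \<open>The 3 is the fourth moment of a standard normal variable; the dimension comes from
  passing to coordinates in \<open>norm_power4_le\<close>.\<close>

definition noise_fourth :: real where "noise_fourth = 3 * real CARD('l) * (\<Sum>i\<in>UNIV. (S $ i $ i)\<^sup>2)"
text \<open>Chosen so that the induction over the grid closes: when (b - \<tau> 0)^2 is split at a,
  4 \<open>noise_trace\<close>^2 pays for the mixed term with its factor 8, and 3
  \<open>noise_fourth\<close> for the new (b - a)^2.\<close>

definition fourth_const :: real where "fourth_const = 4 * noise_trace\<^sup>2 + 3 * noise_fourth"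

lemma noise_trace_nonneg: "0 \<le> noise_trace"
  unfolding noise_trace_def
  using psd axis_form by (intro sum_nonneg) (metis positive_semidefinite_def)

lemma noise_fourth_nonneg: "0 \<le> noise_fourth"
  unfolding noise_fourth_def by (intro mult_nonneg_nonneg sum_nonneg) auto

lemma increment_norm_moments:
  assumes st: "0 \<le> s" "s \<le> t"
  shows "has_bochner_integral M (\<lambda>w. (norm (W t w - W s w))\<^sup>2) ((t - s) * noise_trace)"
    "integrable M (\<lambda>w. norm (W t w - W s w) ^ 4)"
    "expectation (\<lambda>w. norm (W t w - W s w) ^ 4) \<le> (t - s)\<^sup>2 * noise_fourth"
proof -
  let ?D = "\<lambda>w. W t w - W s w"
  have Dm: "?D \<in> borel_measurable M" using st by simp
  have "has_bochner_integral M (\<lambda>w. \<Sum>i\<in>UNIV. ?D w $ i * ?D w $ i) (\<Sum>i\<in>UNIV. (t - s) * S $ i $ i)"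
    by (intro has_bochner_integral_sum increment_moments(2) st)
  then show "has_bochner_integral M (\<lambda>w. (norm (?D w))\<^sup>2) ((t - s) * noise_trace)"
    by (simp add: power2_norm_eq_inner inner_vec_def noise_trace_def sum_distrib_left)
  have h: "has_bochner_integral M (\<lambda>w. real CARD('l) * (\<Sum>i\<in>UNIV. (?D w $ i) ^ 4))
      (real CARD('l) * (\<Sum>i\<in>UNIV. 3 * ((t - s) * S $ i $ i)\<^sup>2))"
    by (intro has_bochner_integral_mult_right has_bochner_integral_sum increment_moments(3) st)
  have hi: "integrable M (\<lambda>w. real CARD('l) * (\<Sum>i\<in>UNIV. (?D w $ i) ^ 4))"
    and he: "expectation (\<lambda>w. real CARD('l) * (\<Sum>i\<in>UNIV. (?D w $ i) ^ 4)) = (t - s)\<^sup>2 * noise_fourth"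
    using h by (auto simp: has_bochner_integral_iff noise_fourth_def power_mult_distrib sum_distrib_left mult_ac)
  show i: "integrable M (\<lambda>w. norm (?D w) ^ 4)"
  proof (rule Bochner_Integration.integrable_bound[OF hi])
    show "AE w in M. norm (norm (?D w) ^ 4) \<le> norm (real CARD('l) * (\<Sum>i\<in>UNIV. (?D w $ i) ^ 4))"
      by (intro AE_I2 real_norm_mono norm_power4_le) simp
  qed (use Dm in simp)
  show "expectation (\<lambda>w. norm (?D w) ^ 4) \<le> (t - s)\<^sup>2 * noise_fourth"
    unfolding he[symmetric] by (intro integral_mono i hi norm_power4_le)
qed

text \<open>
  Martingale orthogonality removes the terms that are odd in the new increment, except the cubic
  one, which is absorbed by Young's inequality; this gives the \<open>(t - s)\<^sup>2\<close> growth
  by induction over the grid.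
\<close>

lemma elem_integral_moments:
  fixes \<xi> :: "nat \<Rightarrow> 'w \<Rightarrow> real^'l^'n"
  assumes el: "elementary F t k \<tau> \<xi>" and K: "0 \<le> K" "\<And>i w. i < k \<Longrightarrow> w \<in> space M \<Longrightarrow> norm (\<xi> i w) \<le> K"
    and "j \<le> k"
  shows "elem_integral W j \<tau> \<xi> \<in> borel_measurable (F (\<tau> j)) \<and>
    integrable M (\<lambda>w. norm (elem_integral W j \<tau> \<xi> w) ^ 4) \<and>
    expectation (\<lambda>w. (norm (elem_integral W j \<tau> \<xi> w))\<^sup>2) \<le> K\<^sup>2 * noise_trace * (\<tau> j - \<tau> 0) \<and>
    expectation (\<lambda>w. norm (elem_integral W j \<tau> \<xi> w) ^ 4) \<le> fourth_const * K ^ 4 * (\<tau> j - \<tau> 0)\<^sup>2"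
  using \<open>j \<le> k\<close>
proof (induction j)
  case 0
  have "elem_integral W 0 \<tau> \<xi> = (\<lambda>w. 0)" by (simp add: elem_integral_def fun_eq_iff)
  then show ?case by simp
next
  case (Suc j)
  define a b where "a = \<tau> j" and "b = \<tau> (Suc j)"
  define X where "X = elem_integral W j \<tau> \<xi>"
  define N where "N w = W b w - W a w" for w
  define d where "d w = \<xi> j w *v N w" for w
  have ab: "0 \<le> a" "a \<le> b" "\<tau> 0 \<le> a"
    using el Suc.prems elementary_mono[OF el, of j] by (auto simp: a_def b_def elementary_def)
  have xi: "\<xi> j \<in> borel_measurable (F a)" and xiK: "\<And>w. w \<in> space M \<Longrightarrow> norm (\<xi> j w) \<le> K"
    using el Suc.prems K by (auto simp: a_def elementary_def)
  have IH: "X \<in> borel_measurable (F a)" "integrable M (\<lambda>w. norm (X w) ^ 4)"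
    "expectation (\<lambda>w. (norm (X w))\<^sup>2) \<le> K\<^sup>2 * noise_trace * (a - \<tau> 0)"
    "expectation (\<lambda>w. norm (X w) ^ 4) \<le> fourth_const * K ^ 4 * (a - \<tau> 0)\<^sup>2"
    using Suc by (auto simp: a_def X_def)
  have XM [measurable]: "X \<in> borel_measurable M" using IH(1) by (rule measurable_F_M)
  \<comment> \<open>On a probability space the fourth moment controls the lower ones, because r^n
    \<le> 1 + r^4 for n \<le> 4.\<close>
  have low: "integrable M (\<lambda>w. norm (X w) ^ n)" if "n \<le> 4" for n
  proof (rule Bochner_Integration.integrable_bound)
    show "integrable M (\<lambda>w. 1 + norm (X w) ^ 4)" using IH(2) by simp
    show "AE w in M. norm (norm (X w) ^ n) \<le> norm (1 + norm (X w) ^ 4)"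
    proof (rule AE_I2)
      fix w
      have "norm (X w) ^ n \<le> 1 + norm (X w) ^ 4"
      proof (cases "norm (X w) \<le> 1")
        case True
        then have "norm (X w) ^ n \<le> 1" by (intro power_le_one) auto
        then show ?thesis by (smt (verit) zero_le_power norm_ge_zero)
      next
        case False
        then have "norm (X w) ^ n \<le> norm (X w) ^ 4" using that by (intro power_increasing) auto
        then show ?thesis by simp
      qed
      then show "norm (norm (X w) ^ n) \<le> norm (1 + norm (X w) ^ 4)" by simp
    qed
  qed simp
  have NM: "N \<in> borel_measurable M" using ab by (simp add: N_def[abs_def])
  have dM [measurable]: "d \<in> borel_measurable M"
    unfolding d_def[abs_def] by (intro mat_measurable(1) measurable_F_M[OF xi] NM)
  note N = increment_norm_moments[OF ab(1,2), folded N_def]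
  have dK: "norm (d w) \<le> K * norm (N w)" if "w \<in> space M" for w
    unfolding d_def
    by (rule order_trans[OF norm_matrix_vector_mult_le]) (intro mult_right_mono xiK that norm_ge_zero)
  have d2: "(norm (d w))\<^sup>2 \<le> K\<^sup>2 * (norm (N w))\<^sup>2" if "w \<in> space M" for w
    using power_mono[OF dK[OF that], of 2] by (simp add: power_mult_distrib)
  have d4: "norm (d w) ^ 4 \<le> K ^ 4 * norm (N w) ^ 4" if "w \<in> space M" for w
    using power_mono[OF dK[OF that], of 4] by (simp add: power_mult_distrib)
  have m1: "has_bochner_integral M (\<lambda>w. X w \<bullet> d w) 0"
    unfolding d_def N_def
    by (rule increment_mean_mat[OF ab(1,2) IH(1) _ xi xiK]) (use low[of 1] in simp_all)
  have m3: "has_bochner_integral M (\<lambda>w. ((norm (X w))\<^sup>2 *\<^sub>R X w) \<bullet> d w) 0"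
    unfolding d_def N_def
  proof (rule increment_mean_mat[OF ab(1,2) _ _ xi xiK])
    show "(\<lambda>w. (norm (X w))\<^sup>2 *\<^sub>R X w) \<in> borel_measurable (F a)" using IH(1) by simp
    have "norm ((norm (X w))\<^sup>2 *\<^sub>R X w) = norm (X w) ^ 3" for w by (simp add: power3_eq_cube power2_eq_square)
    then show "integrable M (\<lambda>w. norm ((norm (X w))\<^sup>2 *\<^sub>R X w))" using low[of 3] by simp
  qed
  \<comment> \<open>The increment N is independent of X, so the expectation factors. The product d
    is not, since \<xi> may depend on the same past as X; this is why d was estimated by K
    |N|.\<close>
  have m22: "has_bochner_integral M (\<lambda>w. (norm (X w))\<^sup>2 * (norm (N w))\<^sup>2) (expectation (\<lambda>w. (norm (X w))\<^sup>2) * ((b - a) * noise_trace))"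
    unfolding N_def
    by (rule increment_indep[OF ab(1,2), where \<phi>="\<lambda>x. (norm x)\<^sup>2"])
       (use IH(1) low[of 2] N(1) in \<open>simp_all add: N_def\<close>)
  have int2: "integrable M (\<lambda>w. (norm (X w))\<^sup>2 + 2 * (X w \<bullet> d w) + K\<^sup>2 * (norm (N w))\<^sup>2)"
    using low[of 2] m1 N(1) by (simp add: has_bochner_integral_iff)
  have le2: "(norm (X w + d w))\<^sup>2 \<le> (norm (X w))\<^sup>2 + 2 * (X w \<bullet> d w) + K\<^sup>2 * (norm (N w))\<^sup>2" if "w \<in> space M" for w
    using d2[OF that] by (simp add: power2_norm_eq_inner inner_add_left inner_add_right inner_commute)
  have e2: "expectation (\<lambda>w. (norm (X w + d w))\<^sup>2) \<le> expectation (\<lambda>w. (norm (X w))\<^sup>2 + 2 * (X w \<bullet> d w) + K\<^sup>2 * (norm (N w))\<^sup>2)"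
    by (intro integral_mono_AE' int2 AE_I2 le2 order_trans[OF zero_le_power2 le2])
  also have "\<dots> = expectation (\<lambda>w. (norm (X w))\<^sup>2) + K\<^sup>2 * ((b - a) * noise_trace)"
    using low[of 2] m1 N(1) by (simp add: has_bochner_integral_iff)
  finally have r2: "expectation (\<lambda>w. (norm (X w + d w))\<^sup>2) \<le> K\<^sup>2 * noise_trace * (b - \<tau> 0)"
    using IH(3) by (simp add: algebra_simps)
  let ?R = "\<lambda>w. norm (X w) ^ 4 + 4 * (((norm (X w))\<^sup>2 *\<^sub>R X w) \<bullet> d w) + 8 * (K\<^sup>2 * ((norm (X w))\<^sup>2 * (norm (N w))\<^sup>2)) + 3 * (K ^ 4 * norm (N w) ^ 4)"
  have int4: "integrable M ?R"
    using IH(2) m3 m22 N(2) by (auto simp: has_bochner_integral_iff intro!: Bochner_Integration.integrable_add integrable_mult_right)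
  have le4: "norm (X w + d w) ^ 4 \<le> ?R w" if "w \<in> space M" for w
  proof -
    have "(norm (X w))\<^sup>2 * (norm (d w))\<^sup>2 \<le> K\<^sup>2 * ((norm (X w))\<^sup>2 * (norm (N w))\<^sup>2)"
      using mult_left_mono[OF d2[OF that], of "(norm (X w))\<^sup>2"] by (simp add: mult.left_commute)
    then show ?thesis
      using norm_add_power4_expand[of "X w" "d w"] d4[OF that] by simp
  qed
  have int4': "integrable M (\<lambda>w. norm (X w + d w) ^ 4)"
    by (rule Bochner_Integration.integrable_bound[OF int4])
       (use le4 in \<open>auto intro!: AE_I2 order_trans[OF _ abs_ge_self]\<close>)
  have "expectation (\<lambda>w. norm (X w + d w) ^ 4) \<le> expectation ?R"
    by (intro integral_mono_AE int4 int4' AE_I2 le4)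
  also have "\<dots> = expectation (\<lambda>w. norm (X w) ^ 4) + 8 * (K\<^sup>2 * (expectation (\<lambda>w. (norm (X w))\<^sup>2) * ((b - a) * noise_trace)))
      + 3 * (K ^ 4 * expectation (\<lambda>w. norm (N w) ^ 4))"
    using IH(2) m3 m22 N(2) by (simp add: has_bochner_integral_iff)
  also have "\<dots> \<le> fourth_const * K ^ 4 * (a - \<tau> 0)\<^sup>2 + 8 * (K\<^sup>2 * ((K\<^sup>2 * noise_trace * (a - \<tau> 0)) * ((b - a) * noise_trace)))
      + 3 * (K ^ 4 * ((b - a)\<^sup>2 * noise_fourth))"
    using ab K(1) noise_trace_nonneg by (intro add_mono mult_left_mono mult_right_mono IH N) auto
  also have "\<dots> \<le> fourth_const * K ^ 4 * (b - \<tau> 0)\<^sup>2"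
  proof -
    have "fourth_const * K ^ 4 * (b - \<tau> 0)\<^sup>2 - (fourth_const * K ^ 4 * (a - \<tau> 0)\<^sup>2 + 8 * (K\<^sup>2 * ((K\<^sup>2 * noise_trace * (a - \<tau> 0)) * ((b - a) * noise_trace)))
      + 3 * (K ^ 4 * ((b - a)\<^sup>2 * noise_fourth)))
      = K ^ 4 * (4 * noise_trace\<^sup>2 * (b - a)\<^sup>2 + 6 * noise_fourth * ((a - \<tau> 0) * (b - a)))"
      unfolding fourth_const_def by algebra
    moreover have "0 \<le> \<dots>"
      using ab noise_fourth_nonneg by (intro mult_nonneg_nonneg add_nonneg_nonneg) auto
    ultimately show ?thesis by linarith
  qed
  finally have r4: "expectation (\<lambda>w. norm (X w + d w) ^ 4) \<le> fourth_const * K ^ 4 * (b - \<tau> 0)\<^sup>2" .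
  have meas: "(\<lambda>w. X w + d w) \<in> borel_measurable (F b)"
    unfolding d_def N_def
    by (intro borel_measurable_add mat_measurable(1) borel_measurable_diff W_measurable
        measurable_F_mono[OF IH(1) ab(2)] measurable_F_mono[OF xi ab(2)]) (use ab in auto)
  have "elem_integral W (Suc j) \<tau> \<xi> = (\<lambda>w. X w + d w)"
    by (simp add: fun_eq_iff elem_integral_Suc X_def d_def N_def a_def b_def)
  then show ?case using meas int4' r2 r4 by (simp add: b_def)
qed

text \<open>All grid points lie at or after s, so z is a known coefficient in every summand, and
  each summand is centred.\<close>

lemma elem_integral_mean:
  fixes \<xi> :: "nat \<Rightarrow> 'w \<Rightarrow> real^'l^'n"
  assumes el: "elementary F t k \<tau> \<xi>" and s: "s \<le> \<tau> 0"
    and z: "z \<in> borel_measurable (F s)" "\<And>w. w \<in> space M \<Longrightarrow> norm (z w) \<le> c"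
  shows "has_bochner_integral M (\<lambda>w. z w \<bullet> elem_integral W k \<tau> \<xi> w) 0"
proof -
  have zi: "integrable M (\<lambda>w. norm (z w))"
    using z measurable_F_M[OF z(1)] by (intro integrable_const_bound[where B=c]) auto
  have "has_bochner_integral M (\<lambda>w. \<Sum>i<k. z w \<bullet> (\<xi> i w *v (W (\<tau> (Suc i)) w - W (\<tau> i) w))) (\<Sum>i<k. 0)"
  proof (intro has_bochner_integral_sum)
    fix i assume i: "i \<in> {..<k}"
    obtain C where C: "\<And>w. w \<in> space M \<Longrightarrow> norm (\<xi> i w) \<le> C" and m: "\<xi> i \<in> borel_measurable (F (\<tau> i))"
      and le: "\<tau> i \<le> \<tau> (Suc i)"
      using el i unfolding elementary_def by (metis lessThan_iff space_F)
    have "s \<le> \<tau> i" using elementary_mono(2)[OF el, of i] s i by simp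
    then show "has_bochner_integral M (\<lambda>w. z w \<bullet> (\<xi> i w *v (W (\<tau> (Suc i)) w - W (\<tau> i) w))) 0"
      using elementary_mono(1)[OF el, of i] i
      by (intro increment_mean_mat[where K=C] le m C zi measurable_F_mono[OF z(1)]) auto
  qed
  then show ?thesis by (simp add: elem_integral_def inner_sum_right)
qed

end

section \<open>Increments of stochastic integrals\<close>

text \<open>The nearest-point projection onto a ball. It is nonexpansive and fixes the ball, so
  truncating an approximant at a bound of the integrand does not increase the distance to the
  integrand.\<close>

definition trunc :: "real \<Rightarrow> 'a::euclidean_space \<Rightarrow> 'a" where
  "trunc K x = closest_point (cball 0 K) x"

lemma trunc_props:
  fixes x y :: "'a::euclidean_space"
  assumes "0 \<le> K"
  shows "norm (trunc K x) \<le> K" "norm (trunc K x - trunc K y) \<le> norm (x - y)"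
    "norm x \<le> K \<Longrightarrow> trunc K x = x" "trunc K 0 = (0 :: 'a::euclidean_space)"
proof -
  have ne: "cball (0::'a) K \<noteq> {}" using assms by simp
  show "norm (trunc K x) \<le> K"
    using closest_point_in_set[OF closed_cball ne, of x] by (simp add: trunc_def)
  show "norm (trunc K x - trunc K y) \<le> norm (x - y)"
    using closest_point_lipschitz[OF convex_cball closed_cball ne, of x y] by (simp add: trunc_def dist_norm)
  show "norm x \<le> K \<Longrightarrow> trunc K x = x"
    unfolding trunc_def by (rule closest_point_self) simp
  show "trunc K 0 = (0 :: 'a::euclidean_space)"
    unfolding trunc_def by (rule closest_point_self) (use assms in simp)
qed

lemma trunc_measurable: "0 \<le> K \<Longrightarrow> trunc K \<in> borel_measurable borel"
  unfolding trunc_def[abs_def]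
  by (intro borel_measurable_continuous_onI continuous_on_closest_point) auto

lemma bilinear_matrix_mult: "bilinear (\<lambda>(A :: real^'m^'n) (X :: real^'k^'m). A ** X)"
  unfolding bilinear_def
  by (auto intro!: linearI simp: matrix_matrix_mult_def vec_eq_iff sum.distrib algebra_simps sum_distrib_left)

lemma matrix_mult_bound:
  obtains c where "0 \<le> c" "\<And>(A :: real^'m^'n) (X :: real^'k^'m). norm (A ** X) \<le> c * norm A * norm X"
proof -
  obtain c where c: "\<And>(A :: real^'m^'n) (X :: real^'k^'m). norm (A ** X) \<le> c * norm A * norm X"
    using bilinear_bounded[OF bilinear_matrix_mult[where 'm='m and 'n='n and 'k='k]] by blast
  have "norm (A ** X) \<le> \<bar>c\<bar> * norm A * norm X" for A :: "real^'m^'n" and X :: "real^'k^'m"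
    by (rule order_trans[OF c]) (intro mult_right_mono abs_ge_self norm_ge_zero)
  then show ?thesis by (intro that[of "\<bar>c\<bar>"]) auto
qed

lemma norm_diff_square_le:
  fixes a b h :: "'a::real_normed_vector"
  shows "(norm (a - b))\<^sup>2 \<le> 2 * (norm (a - h))\<^sup>2 + 2 * (norm (b - h))\<^sup>2"
proof -
  have "norm (a - b) \<le> norm (a - h) + norm (b - h)"
    by (metis norm_triangle_ineq4 add_diff_cancel_right diff_add_cancel)
  then have "(norm (a - b))\<^sup>2 \<le> (norm (a - h) + norm (b - h))\<^sup>2" by (intro power_mono) auto
  also have "\<dots> \<le> 2 * (norm (a - h))\<^sup>2 + 2 * (norm (b - h))\<^sup>2"
  proof -
    have "2 * x\<^sup>2 + 2 * y\<^sup>2 - (x + y)\<^sup>2 = (x - y)\<^sup>2" for x y :: real by algebra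
    then show ?thesis by (metis diff_ge_0_iff_ge zero_le_power2)
  qed
  finally show ?thesis .
qed

context brownian_basis
begin

text \<open>The approximation part of \<open>ito_integral\<close>. It survives a change of the
  integrand on a null set of paths, which progressive measurability over an incomplete filtration
  does not, and such a change is made when the coefficients are cut off.\<close>

definition ito_limit :: "real \<Rightarrow> (real \<Rightarrow> 'w \<Rightarrow> real^'l^'n) \<Rightarrow> ('w \<Rightarrow> real^'n) \<Rightarrow> bool" where
  "ito_limit t H I \<longleftrightarrow> I \<in> borel_measurable M \<and>
     (\<exists>k \<tau> \<xi>. (\<forall>j. elementary F t (k j) (\<tau> j) (\<xi> j)) \<and>
        (\<lambda>j. \<integral>\<^sup>+w. (\<integral>\<^sup>+s\<in>{0..t}. ennreal ((norm (elem_process (k j) (\<tau> j) (\<xi> j) s w - H s w))\<^sup>2) \<partial>lborel) \<partial>M)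
           \<longlonglongrightarrow> 0 \<and>
        (\<lambda>j. \<integral>\<^sup>+w. ennreal ((norm (elem_integral W (k j) (\<tau> j) (\<xi> j) w - I w))\<^sup>2) \<partial>M) \<longlonglongrightarrow> 0)"

lemma elem_process_eq_0:
  assumes "elementary F t k \<tau> \<xi>" "j \<le> k" "\<tau> j < r \<or> r \<le> \<tau> 0"
  shows "elem_process j \<tau> \<xi> r w = 0"
  unfolding elem_process_def
proof (rule sum.neutral, rule ballI)
  fix i assume i: "i \<in> {..<j}"
  have step: "\<And>i. i < k \<Longrightarrow> \<tau> i \<le> \<tau> (Suc i)" using assms(1) by (simp add: elementary_def)
  have "\<tau> m \<le> \<tau> n" if "m \<le> n" "n \<le> k" for m n
    using that
  proof (induction n rule: dec_induct)
    case (step n)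
    then show ?case using \<open>\<And>i. i < k \<Longrightarrow> \<tau> i \<le> \<tau> (Suc i)\<close>[of n] by simp
  qed simp
  from this[of "Suc i" j] this[of 0 i] i assms(2,3) have "r \<notin> {\<tau> i<..\<tau> (Suc i)}" by auto
  then show "indicator {\<tau> i<..\<tau> (Suc i)} r *\<^sub>R \<xi> i w = 0" by simp
qed

text \<open>At any time at most one block is active, so truncating every coefficient is the same as
  truncating the process. Replacing \<tau> by its maximum with s erases what lies before s.\<close>

lemma elem_process_trunc:
  fixes \<xi> :: "nat \<Rightarrow> 'w \<Rightarrow> real^'l^'n"
  assumes el: "elementary F t k \<tau> \<xi>" and K: "0 \<le> K"
  shows "elem_process k (\<lambda>i. max s (\<tau> i)) (\<lambda>i w. trunc K (\<xi> i w)) r w =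
     indicator {s<..} r *\<^sub>R trunc K (elem_process k \<tau> \<xi> r w)"
proof -
  have "elem_process j (\<lambda>i. max s (\<tau> i)) (\<lambda>i w. trunc K (\<xi> i w)) r w =
     indicator {s<..} r *\<^sub>R trunc K (elem_process j \<tau> \<xi> r w)" if "j \<le> k" for j
    using that
  proof (induction j)
    case 0
    show ?case by (simp add: elem_process_def trunc_props(4)[OF K])
  next
    case (Suc j)
    show ?case
    proof (cases "r \<le> \<tau> j")
      case True
      then show ?thesis using Suc by (simp add: elem_process_Suc)
    next
      case False
      then have 0: "elem_process j \<tau> \<xi> r w = 0"
        using Suc.prems by (intro elem_process_eq_0[OF el]) auto
      have "indicator {max s (\<tau> j)<..max s (\<tau> (Suc j))} r = indicat_real {s<..} r * indicator {\<tau> j<..\<tau> (Suc j)} r"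
        using False by (auto simp: indicator_def)
      moreover have "trunc K (indicator {\<tau> j<..\<tau> (Suc j)} r *\<^sub>R \<xi> j w) = indicator {\<tau> j<..\<tau> (Suc j)} r *\<^sub>R trunc K (\<xi> j w)"
        by (auto simp: indicator_def trunc_props(4)[OF K])
      ultimately show ?thesis
        using Suc 0 by (simp add: elem_process_Suc trunc_props(4)[OF K])
    qed
  qed
  then show ?thesis by simp
qed

lemma nn_integral_PP:
  assumes "(\<lambda>z. f (snd z) (fst z)) \<in> borel_measurable PP"
  shows "(\<integral>\<^sup>+w. \<integral>\<^sup>+s. f s w \<partial>lborel \<partial>M) = (\<integral>\<^sup>+z. f (snd z) (fst z) \<partial>PP)"
  using lborel.nn_integral_fst[OF assms] by simp

text \<open>The bound K and the support in (s, t] are recorded along with convergence, because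
  moments and quadratic forms are estimated uniformly in j before the limit is taken.\<close>

definition ito_approximants :: "real \<Rightarrow> real \<Rightarrow> real \<Rightarrow> (real \<Rightarrow> 'w \<Rightarrow> real^'l^'n) \<Rightarrow> ('w \<Rightarrow> real^'n) \<Rightarrow>
    (nat \<Rightarrow> nat) \<Rightarrow> (nat \<Rightarrow> nat \<Rightarrow> real) \<Rightarrow> (nat \<Rightarrow> nat \<Rightarrow> 'w \<Rightarrow> real^'l^'n) \<Rightarrow> bool" where
  "ito_approximants s t K H D k \<tau> \<xi> \<longleftrightarrow>
     (\<forall>j. elementary F t (k j) (\<tau> j) (\<xi> j)) \<and> (\<forall>j. s \<le> \<tau> j 0) \<and> (\<forall>j i w. norm (\<xi> j i w) \<le> K) \<and>
     (\<forall>j r w. norm (elem_process (k j) (\<tau> j) (\<xi> j) r w) \<le> K * indicator {s<..t} r) \<and>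
     (\<lambda>j. \<integral>\<^sup>+z. ennreal ((norm (elem_process (k j) (\<tau> j) (\<xi> j) (snd z) (fst z)
        - indicator {s<..t} (snd z) *\<^sub>R H (snd z) (fst z)))\<^sup>2) \<partial>PP) \<longlonglongrightarrow> 0 \<and>
     (\<lambda>j. \<integral>\<^sup>+w. ennreal ((norm (elem_integral W (k j) (\<tau> j) (\<xi> j) w - D w))\<^sup>2) \<partial>M) \<longlonglongrightarrow> 0"

text \<open>The approximants P1 of the integral up to t, restarted at s and truncated at K, become
  P3. With P2 approximating up to s, the combination P1 - P2 - P3 is again a simple integrand and
  tends to 0 in L2. By \<open>simple_pair_L2_bound\<close> the integral J3 then has the limit of J1
  - J2, which is I' - I.\<close>

lemma ito_increment_approx:
  fixes H :: "real \<Rightarrow> 'w \<Rightarrow> real^'l^'n"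
  assumes st: "0 \<le> s" "s \<le> t" and Hm: "(\<lambda>z. H (snd z) (fst z)) \<in> borel_measurable PP"
    and K: "0 \<le> K" and HK: "\<And>r w. w \<in> space M \<Longrightarrow> norm (H r w) \<le> K"
    and Is: "ito_limit s H I" and It: "ito_limit t H I'"
  shows "\<exists>k \<tau> \<xi>. ito_approximants s t K H (\<lambda>w. I' w - I w) k \<tau> \<xi>"
proof -
  obtain k1 \<tau>1 \<xi>1 where el1: "\<And>j. elementary F t (k1 j) (\<tau>1 j) (\<xi>1 j)" and
    a1: "(\<lambda>j. \<integral>\<^sup>+w. (\<integral>\<^sup>+s\<in>{0..t}. ennreal ((norm (elem_process (k1 j) (\<tau>1 j) (\<xi>1 j) s w - H s w))\<^sup>2) \<partial>lborel) \<partial>M) \<longlonglongrightarrow> 0" and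
    b1: "(\<lambda>j. \<integral>\<^sup>+w. ennreal ((norm (elem_integral W (k1 j) (\<tau>1 j) (\<xi>1 j) w - I' w))\<^sup>2) \<partial>M) \<longlonglongrightarrow> 0" and
    I'm: "I' \<in> borel_measurable M"
    using It unfolding ito_limit_def by (elim exE conjE) (rule that, auto)
  obtain k2 \<tau>2 \<xi>2 where el2: "\<And>j. elementary F s (k2 j) (\<tau>2 j) (\<xi>2 j)" and
    a2: "(\<lambda>j. \<integral>\<^sup>+w. (\<integral>\<^sup>+s\<in>{0..s}. ennreal ((norm (elem_process (k2 j) (\<tau>2 j) (\<xi>2 j) s w - H s w))\<^sup>2) \<partial>lborel) \<partial>M) \<longlonglongrightarrow> 0" and
    b2: "(\<lambda>j. \<integral>\<^sup>+w. ennreal ((norm (elem_integral W (k2 j) (\<tau>2 j) (\<xi>2 j) w - I w))\<^sup>2) \<partial>M) \<longlonglongrightarrow> 0" and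
    Im: "I \<in> borel_measurable M"
    using Is unfolding ito_limit_def by (elim exE conjE) (rule that, auto)
  define P1 where "P1 j = elem_process (k1 j) (\<tau>1 j) (\<xi>1 j)" for j
  define P2 where "P2 j = elem_process (k2 j) (\<tau>2 j) (\<xi>2 j)" for j
  define J1 where "J1 j = elem_integral W (k1 j) (\<tau>1 j) (\<xi>1 j)" for j
  define J2 where "J2 j = elem_integral W (k2 j) (\<tau>2 j) (\<xi>2 j)" for j
  define \<tau> where "\<tau> j i = max s (\<tau>1 j i)" for j i
  define \<xi> where "\<xi> j i w = trunc K (\<xi>1 j i w)" for j i w
  define P3 where "P3 j = elem_process (k1 j) (\<tau> j) (\<xi> j)" for j
  define J3 where "J3 j = elem_integral W (k1 j) (\<tau> j) (\<xi> j)" for j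
  have P3: "P3 j r w = indicator {s<..} r *\<^sub>R trunc K (P1 j r w)" for j r w
    unfolding P3_def P1_def \<tau>_def[abs_def] \<xi>_def[abs_def] by (rule elem_process_trunc[OF el1 K])
  have el3: "elementary F t (k1 j) (\<tau> j) (\<xi> j)" for j
    unfolding elementary_def
  proof (intro conjI allI impI)
    show "0 \<le> \<tau> j 0" using st by (simp add: \<tau>_def)
    show "\<tau> j (k1 j) \<le> t" using el1[of j] st by (simp add: \<tau>_def elementary_def)
    fix i assume i: "i < k1 j"
    show "\<tau> j i \<le> \<tau> j (Suc i)" using el1[of j] i by (auto simp: \<tau>_def elementary_def)
    have "\<xi>1 j i \<in> borel_measurable (F (\<tau>1 j i))" using el1[of j] i by (simp add: elementary_def)
    then have "\<xi>1 j i \<in> borel_measurable (F (\<tau> j i))" by (rule measurable_F_mono) (simp add: \<tau>_def)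
    from measurable_compose[OF this trunc_measurable[OF K]] show "\<xi> j i \<in> borel_measurable (F (\<tau> j i))"
      by (simp add: \<xi>_def[abs_def])
    show "\<exists>C. \<forall>w\<in>space (F (\<tau> j i)). norm (\<xi> j i w) \<le> C"
      using trunc_props(1)[OF K] unfolding \<xi>_def by blast
  qed
  have P1_0: "P1 j r w = 0" if "r \<le> 0 \<or> t < r" for j r w
    unfolding P1_def
    using that el1[of j] by (intro elem_process_eq_0[OF el1]) (auto simp: elementary_def)
  have P2_0: "P2 j r w = 0" if "r \<le> 0 \<or> s < r" for j r w
    unfolding P2_def
    using that el2[of j] by (intro elem_process_eq_0[OF el2]) (auto simp: elementary_def)
  have spm: "simple_pair (P1 j) (J1 j)" "simple_pair (P2 j) (J2 j)" "simple_pair (P3 j) (J3 j)" for j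
    unfolding P1_def P2_def P3_def J1_def J2_def J3_def
    by (rule elementary_simple_pair[OF el1] elementary_simple_pair[OF el2] elementary_simple_pair[OF el3])+
  have [measurable]: "(\<lambda>z. P1 j (snd z) (fst z)) \<in> borel_measurable PP" "(\<lambda>z. P2 j (snd z) (fst z)) \<in> borel_measurable PP"
    "(\<lambda>z. P3 j (snd z) (fst z)) \<in> borel_measurable PP" "(\<lambda>z. H (snd z) (fst z)) \<in> borel_measurable PP" for j
    by (rule simple_pair_measurable[OF spm(1)] simple_pair_measurable[OF spm(2)] simple_pair_measurable[OF spm(3)] Hm)+
  define A1 where "A1 j = (\<integral>\<^sup>+z. ennreal ((norm (P1 j (snd z) (fst z) - H (snd z) (fst z)))\<^sup>2) * indicator {0..t} (snd z) \<partial>PP)" for j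
  define A2 where "A2 j = (\<integral>\<^sup>+z. ennreal ((norm (P2 j (snd z) (fst z) - H (snd z) (fst z)))\<^sup>2) * indicator {0..s} (snd z) \<partial>PP)" for j
  have A1: "A1 \<longlonglongrightarrow> 0"
    using a1 unfolding A1_def[abs_def] P1_def[symmetric] by (subst (asm) nn_integral_PP) measurable
  have A2: "A2 \<longlonglongrightarrow> 0"
    using a2 unfolding A2_def[abs_def] P2_def[symmetric] by (subst (asm) nn_integral_PP) measurable
  \<comment> \<open>H is its own truncation, so truncating P1 cannot take it further away from
    H.\<close>
  have E1: "(norm (P3 j r w - indicator {s<..t} r *\<^sub>R H r w))\<^sup>2 \<le> (norm (P1 j r w - H r w))\<^sup>2 * indicator {0..t} r"
    if "w \<in> space M" for j r w
  proof (cases "r \<in> {s<..t}")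
    case True
    have "norm (P3 j r w - indicator {s<..t} r *\<^sub>R H r w) \<le> norm (P1 j r w - H r w)"
      using True trunc_props(2)[OF K, of "P1 j r w" "H r w"] trunc_props(3)[OF K HK[OF that, of r]] by (simp add: P3)
    then have "(norm (P3 j r w - indicator {s<..t} r *\<^sub>R H r w))\<^sup>2 \<le> (norm (P1 j r w - H r w))\<^sup>2"
      by (intro power_mono) auto
    then show ?thesis using True st by simp
  next
    case False
    then have "P3 j r w = 0" using P1_0[of r j w] by (auto simp: P3 trunc_props(4)[OF K])
    then show ?thesis using False by (auto simp: indicator_def)
  qed
  \<comment> \<open>Up to time s only P1 and P2 are active, and both approximate H. After s only P1
    and its truncation are, and these differ by at most 2 |P1 - H|, whose square gives the factor
    4.\<close>
  have E2: "(norm (P1 j r w - P2 j r w - P3 j r w))\<^sup>2 \<le>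
      4 * ((norm (P1 j r w - H r w))\<^sup>2 * indicator {0..t} r) + 2 * ((norm (P2 j r w - H r w))\<^sup>2 * indicator {0..s} r)"
    if "w \<in> space M" for j r w
  proof -
    consider "r \<le> 0 \<or> t < r" | "0 < r" "r \<le> s" | "s < r" "r \<le> t" by linarith
    then show ?thesis
    proof cases
      case 1
      then have "P1 j r w = 0" "P2 j r w = 0" using P1_0 P2_0 st by auto
      then have "norm (P1 j r w - P2 j r w - P3 j r w) = 0" by (simp add: P3 trunc_props(4)[OF K])
      then show ?thesis by simp
    next
      case 2
      have "(norm (P1 j r w - P2 j r w))\<^sup>2 \<le> 2 * (norm (P1 j r w - H r w))\<^sup>2 + 2 * (norm (P2 j r w - H r w))\<^sup>2"
        by (rule norm_diff_square_le)
      also have "\<dots> \<le> 4 * (norm (P1 j r w - H r w))\<^sup>2 + 2 * (norm (P2 j r w - H r w))\<^sup>2"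
        by simp
      finally show ?thesis using 2 st by (simp add: P3)
    next
      case 3
      have "norm (P1 j r w - trunc K (P1 j r w)) \<le> norm (P1 j r w - H r w) + norm (trunc K (H r w) - trunc K (P1 j r w))"
        unfolding trunc_props(3)[OF K HK[OF that, of r]]
        by (metis diff_add_cancel diff_diff_eq2 norm_triangle_ineq add_diff_eq)
      also have "\<dots> \<le> 2 * norm (P1 j r w - H r w)"
        using trunc_props(2)[OF K, of "H r w" "P1 j r w"] by (simp add: norm_minus_commute)
      finally have "(norm (P1 j r w - trunc K (P1 j r w)))\<^sup>2 \<le> (2 * norm (P1 j r w - H r w))\<^sup>2"
        by (intro power_mono) auto
      then show ?thesis using 3 st P2_0[of r j w] by (simp add: P3 power_mult_distrib)
    qed
  qed
  have lim1: "(\<lambda>j. \<integral>\<^sup>+z. ennreal ((norm (P3 j (snd z) (fst z) - indicator {s<..t} (snd z) *\<^sub>R H (snd z) (fst z)))\<^sup>2) \<partial>PP) \<longlonglongrightarrow> 0"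
  proof (rule ennreal_tendsto_0_le[OF _ A1])
    fix j
    show "(\<integral>\<^sup>+z. ennreal ((norm (P3 j (snd z) (fst z) - indicator {s<..t} (snd z) *\<^sub>R H (snd z) (fst z)))\<^sup>2) \<partial>PP) \<le> A1 j"
      unfolding A1_def
    proof (rule nn_integral_mono)
      fix z assume "z \<in> space PP"
      then have "fst z \<in> space M" by (auto simp: space_pair_measure)
      from ennreal_leI[OF E1[OF this, of j "snd z"]]
      show "ennreal ((norm (P3 j (snd z) (fst z) - indicator {s<..t} (snd z) *\<^sub>R H (snd z) (fst z)))\<^sup>2)
        \<le> ennreal ((norm (P1 j (snd z) (fst z) - H (snd z) (fst z)))\<^sup>2) * indicator {0..t} (snd z)"
        by (simp add: ennreal_mult ennreal_indicator)
    qed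
  qed
  obtain c where c: "0 \<le> c" "\<And>p J. simple_pair p (J :: 'w \<Rightarrow> real^'n) \<Longrightarrow>
    (\<integral>\<^sup>+w. ennreal ((norm (J w))\<^sup>2) \<partial>M) \<le> ennreal c * (\<integral>\<^sup>+z. ennreal ((norm (p (snd z) (fst z)))\<^sup>2) \<partial>PP)"
    by (rule simple_pair_L2_bound) blast
  define B1 where "B1 j = (\<integral>\<^sup>+w. ennreal ((norm (J1 j w - I' w))\<^sup>2) \<partial>M)" for j
  define B2 where "B2 j = (\<integral>\<^sup>+w. ennreal ((norm (J2 j w - I w))\<^sup>2) \<partial>M)" for j
  define Q where "Q j = (\<integral>\<^sup>+w. ennreal ((norm (J1 j w - J2 j w - J3 j w))\<^sup>2) \<partial>M)" for j
  have Q: "Q j \<le> ennreal c * (4 * A1 j + 2 * A2 j)" for j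
  proof -
    have "simple_pair (\<lambda>r w. P1 j r w + (- P2 j r w) + (- P3 j r w)) (\<lambda>w. J1 j w + (- J2 j w) + (- J3 j w))"
      by (intro simple_pair_add simple_pair_uminus spm)
    from c(2)[OF this]
    have "Q j \<le> ennreal c * (\<integral>\<^sup>+z. ennreal ((norm (P1 j (snd z) (fst z) - P2 j (snd z) (fst z) - P3 j (snd z) (fst z)))\<^sup>2) \<partial>PP)"
      by (simp add: Q_def)
    also have "\<dots> \<le> ennreal c * (\<integral>\<^sup>+z. 4 * (ennreal ((norm (P1 j (snd z) (fst z) - H (snd z) (fst z)))\<^sup>2) * indicator {0..t} (snd z))
         + 2 * (ennreal ((norm (P2 j (snd z) (fst z) - H (snd z) (fst z)))\<^sup>2) * indicator {0..s} (snd z)) \<partial>PP)"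
    proof (intro mult_left_mono nn_integral_mono)
      fix z assume "z \<in> space PP"
      then have "fst z \<in> space M" by (auto simp: space_pair_measure)
      from ennreal_leI[OF E2[OF this, of j "snd z"]]
      show "ennreal ((norm (P1 j (snd z) (fst z) - P2 j (snd z) (fst z) - P3 j (snd z) (fst z)))\<^sup>2)
        \<le> 4 * (ennreal ((norm (P1 j (snd z) (fst z) - H (snd z) (fst z)))\<^sup>2) * indicator {0..t} (snd z))
         + 2 * (ennreal ((norm (P2 j (snd z) (fst z) - H (snd z) (fst z)))\<^sup>2) * indicator {0..s} (snd z))"
        by (simp add: ennreal_mult ennreal_plus ennreal_indicator)
    qed simp
    also have "\<dots> = ennreal c * (4 * A1 j + 2 * A2 j)"
      unfolding A1_def A2_def by (subst nn_integral_add) (simp_all add: nn_integral_cmult)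
    finally show ?thesis .
  qed
  have J3m: "J3 j \<in> borel_measurable M" "J1 j \<in> borel_measurable M" "J2 j \<in> borel_measurable M" for j
    unfolding J1_def J2_def J3_def
    by (rule elem_integral_measurable[OF el1] elem_integral_measurable[OF el2] elem_integral_measurable[OF el3])+
  note [measurable] = J3m I'm Im
  have lim2: "(\<lambda>j. \<integral>\<^sup>+w. ennreal ((norm (J3 j w - (I' w - I w)))\<^sup>2) \<partial>M) \<longlonglongrightarrow> 0"
  proof (rule ennreal_tendsto_0_le)
    have "(\<lambda>j. 2 * (ennreal c * (4 * A1 j + 2 * A2 j)) + (4 * B1 j + 4 * B2 j)) \<longlonglongrightarrow> 2 * (ennreal c * (4 * 0 + 2 * 0)) + (4 * 0 + 4 * 0)"
      using b1 b2 unfolding B1_def[abs_def, symmetric] B2_def[abs_def, symmetric] J1_def[symmetric] J2_def[symmetric]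
      by (intro tendsto_add ennreal_tendsto_cmult A1 A2) (auto simp: B1_def[abs_def] B2_def[abs_def])
    then show "(\<lambda>j. 2 * (ennreal c * (4 * A1 j + 2 * A2 j)) + (4 * B1 j + 4 * B2 j)) \<longlonglongrightarrow> 0" by simp
    fix j
    have "(\<integral>\<^sup>+w. ennreal ((norm (J3 j w - (I' w - I w)))\<^sup>2) \<partial>M) \<le>
       (\<integral>\<^sup>+w. 2 * ennreal ((norm (J1 j w - J2 j w - J3 j w))\<^sup>2) + (4 * ennreal ((norm (J1 j w - I' w))\<^sup>2) + 4 * ennreal ((norm (J2 j w - I w))\<^sup>2)) \<partial>M)"
    proof (rule nn_integral_mono)
      fix w
      have 1: "(norm (J3 j w - (I' w - I w)))\<^sup>2 \<le> 2 * (norm (J3 j w - (J1 j w - J2 j w)))\<^sup>2 + 2 * (norm ((I' w - I w) - (J1 j w - J2 j w)))\<^sup>2"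
        by (rule norm_diff_square_le)
      have 2: "(norm ((I' w - J1 j w) - (I w - J2 j w)))\<^sup>2 \<le> 2 * (norm ((I' w - J1 j w) - 0))\<^sup>2 + 2 * (norm ((I w - J2 j w) - 0))\<^sup>2"
        by (rule norm_diff_square_le)
      have eq: "(I' w - I w) - (J1 j w - J2 j w) = (I' w - J1 j w) - (I w - J2 j w)" by simp
      have "(norm (J3 j w - (I' w - I w)))\<^sup>2 \<le>
         2 * (norm (J1 j w - J2 j w - J3 j w))\<^sup>2 + (4 * (norm (J1 j w - I' w))\<^sup>2 + 4 * (norm (J2 j w - I w))\<^sup>2)"
        using 1 2 unfolding eq
        by (simp add: norm_minus_commute[of "J3 j w"] norm_minus_commute[of "I' w"] norm_minus_commute[of "I w"])
      from ennreal_leI[OF this]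
      show "ennreal ((norm (J3 j w - (I' w - I w)))\<^sup>2) \<le> 2 * ennreal ((norm (J1 j w - J2 j w - J3 j w))\<^sup>2) +
          (4 * ennreal ((norm (J1 j w - I' w))\<^sup>2) + 4 * ennreal ((norm (J2 j w - I w))\<^sup>2))"
        by (simp add: ennreal_mult ennreal_plus)
    qed
    also have "\<dots> = 2 * Q j + (4 * B1 j + 4 * B2 j)"
      unfolding Q_def B1_def B2_def by (simp add: nn_integral_add nn_integral_cmult)
    also have "\<dots> \<le> 2 * (ennreal c * (4 * A1 j + 2 * A2 j)) + (4 * B1 j + 4 * B2 j)"
      by (intro add_right_mono mult_left_mono Q) simp
    finally show "(\<integral>\<^sup>+w. ennreal ((norm (J3 j w - (I' w - I w)))\<^sup>2) \<partial>M) \<le> 2 * (ennreal c * (4 * A1 j + 2 * A2 j)) + (4 * B1 j + 4 * B2 j)" .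
  qed
  have "ito_approximants s t K H (\<lambda>w. I' w - I w) k1 \<tau> \<xi>"
    unfolding ito_approximants_def
  proof (intro conjI allI)
    show "elementary F t (k1 j) (\<tau> j) (\<xi> j)" for j by (rule el3)
    show "s \<le> \<tau> j 0" for j by (simp add: \<tau>_def)
    show "norm (\<xi> j i w) \<le> K" for j i w by (simp add: \<xi>_def trunc_props(1)[OF K])
    show "norm (elem_process (k1 j) (\<tau> j) (\<xi> j) r w) \<le> K * indicator {s<..t} r" for j r w
      unfolding P3_def[symmetric] P3
      using trunc_props(1)[OF K] P1_0[of r j w] K by (auto simp: indicator_def trunc_props(4)[OF K])
    show "(\<lambda>j. \<integral>\<^sup>+z. ennreal ((norm (elem_process (k1 j) (\<tau> j) (\<xi> j) (snd z) (fst z)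
        - indicator {s<..t} (snd z) *\<^sub>R H (snd z) (fst z)))\<^sup>2) \<partial>PP) \<longlonglongrightarrow> 0"
      using lim1 unfolding P3_def .
    show "(\<lambda>j. \<integral>\<^sup>+w. ennreal ((norm (elem_integral W (k1 j) (\<tau> j) (\<xi> j) w - (I' w - I w)))\<^sup>2) \<partial>M) \<longlonglongrightarrow> 0"
      using lim2 unfolding J3_def .
  qed
  then show ?thesis by blast
qed

end

section \<open>Mean, fourth moment and quadratic forms of an increment\<close>

lemma young_cubic: "0 \<le> (a::real) \<Longrightarrow> 0 \<le> b \<Longrightarrow> a ^ 3 * b \<le> 3/4 * a ^ 4 + 1/4 * b ^ 4"
proof -
  assume "0 \<le> a" "0 \<le> b"
  have 1: "a ^ 4 + a\<^sup>2 * b\<^sup>2 - 2 * (a ^ 3 * b) = (a * (a - b))\<^sup>2" by algebra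
  have 2: "a ^ 4 + b ^ 4 - 2 * (a\<^sup>2 * b\<^sup>2) = (a\<^sup>2 - b\<^sup>2)\<^sup>2" by algebra
  from 1 2 show ?thesis
    using zero_le_power2[of "a * (a - b)"] zero_le_power2[of "a\<^sup>2 - b\<^sup>2"] by linarith
qed

lemma norm_ge_power: "norm (x :: 'a::real_normed_vector) \<le> 1 + norm x ^ 4"
proof (cases "norm x \<le> 1")
  case True
  then show ?thesis using zero_le_power[OF norm_ge_zero, of x 4] by linarith
next
  case False
  then have "norm x ^ 1 \<le> norm x ^ 4" by (intro power_increasing) auto
  then show ?thesis by simp
qed

lemma cov_form_scale: "cov_form S (c *\<^sub>R X) (d *\<^sub>R Y) = c * d * cov_form S X Y"
  by (simp add: cov_form_def sum_distrib_left mult_ac)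

lemma matrix_mult_scaleR_right: "(A :: real^'m^'n) ** (c *\<^sub>R X) = c *\<^sub>R (A ** (X :: real^'k^'m))"
  by (simp add: matrix_matrix_mult_def vec_eq_iff sum_distrib_left mult_ac)

lemma matrix_mult_add_right: "(A :: real^'m^'n) ** (X + Y) = A ** (X :: real^'k^'m) + A ** Y"
  by (simp add: matrix_matrix_mult_def vec_eq_iff sum.distrib distrib_left)

lemma mat_mult_measurable:
  assumes "A \<in> borel_measurable N" "X \<in> borel_measurable N"
  shows "(\<lambda>w. (A w :: real^'m^'n) ** (X w :: real^'k^'m)) \<in> borel_measurable N"
proof -
  have "continuous_on UNIV (\<lambda>x :: (real^'m^'n) \<times> (real^'k^'m). fst x ** snd x)"
    unfolding matrix_matrix_mult_def by (intro continuous_intros)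
  from borel_measurable_continuous_on[OF this borel_measurable_Pair[OF assms]]
  show ?thesis by simp
qed

lemma cov_form_measurable:
  assumes "X \<in> borel_measurable N" "Y \<in> borel_measurable N"
  shows "(\<lambda>w. cov_form S (X w :: real^'l^'n) (Y w)) \<in> borel_measurable N"
proof -
  have "continuous_on UNIV (\<lambda>x :: (real^'l^'n) \<times> (real^'l^'n). cov_form S (fst x) (snd x))"
    unfolding cov_form_def by (intro continuous_intros)
  from borel_measurable_continuous_on[OF this borel_measurable_Pair[OF assms]]
  show ?thesis by simp
qed

context brownian_basis
begin

context
  fixes H :: "real \<Rightarrow> 'w \<Rightarrow> real^'l^'n" and s t K R :: real and I I' D :: "'w \<Rightarrow> real^'n"
  assumes st: "0 \<le> s" "s \<le> t" and Hm: "(\<lambda>z. H (snd z) (fst z)) \<in> borel_measurable PP"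
    and K: "0 \<le> K" and HK: "\<And>r w. w \<in> space M \<Longrightarrow> norm (H r w) \<le> K"
    and Is: "ito_limit s H I" and It: "ito_limit t H I'"
    and D: "D = (\<lambda>w. I' w - I w)"
    and R: "0 \<le> R" "AE w in M. norm (D w) \<le> R"
begin

lemma D_measurable: "D \<in> borel_measurable M"
  using Is It unfolding D ito_limit_def by auto

text \<open>The approximants of the increment start after s and are centred against any weight known
  at s. Against a bounded weight, L2 convergence carries this to the limit; the bound R makes the
  limit integrable.\<close>

lemma ito_increment_mean:
  assumes z: "z \<in> borel_measurable (F s)" "\<And>w. w \<in> space M \<Longrightarrow> norm (z w) \<le> c"
  shows "expectation (\<lambda>w. z w \<bullet> D w) = 0"
proof -
  obtain k \<tau> \<xi> where ap: "ito_approximants s t K H D k \<tau> \<xi>"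
    using ito_increment_approx[OF st Hm K HK Is It] unfolding D by blast
  have el: "\<And>j. elementary F t (k j) (\<tau> j) (\<xi> j)" and s\<tau>: "\<And>j. s \<le> \<tau> j 0"
    and xi: "\<And>j i w. norm (\<xi> j i w) \<le> K"
    and pK: "\<And>j r w. norm (elem_process (k j) (\<tau> j) (\<xi> j) r w) \<le> K * indicator {s<..t} r"
    and limp: "(\<lambda>j. \<integral>\<^sup>+z. ennreal ((norm (elem_process (k j) (\<tau> j) (\<xi> j) (snd z) (fst z)
        - indicator {s<..t} (snd z) *\<^sub>R H (snd z) (fst z)))\<^sup>2) \<partial>PP) \<longlonglongrightarrow> 0"
    and lim: "(\<lambda>j. \<integral>\<^sup>+w. ennreal ((norm (elem_integral W (k j) (\<tau> j) (\<xi> j) w - D w))\<^sup>2) \<partial>M) \<longlonglongrightarrow> 0"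
    using ap unfolding ito_approximants_def by blast+
  define J where "J j = elem_integral W (k j) (\<tau> j) (\<xi> j)" for j
  have Jm: "J j \<in> borel_measurable M" for j unfolding J_def by (rule elem_integral_measurable[OF el])
  note [measurable] = Jm D_measurable measurable_F_M[OF z(1)]
  have "(\<lambda>j. \<integral>w. z w \<bullet> (J j w - D w) \<partial>M) \<longlonglongrightarrow> 0"
  proof (rule L2_limit_integral[where \<phi>="\<lambda>_. c" and g="\<lambda>j w. norm (J j w - D w)" and c=0])
    show "(\<integral>\<^sup>+w. ennreal (c\<^sup>2) \<partial>M) < \<infinity>" by (simp add: emeasure_space_1)
    show "(\<lambda>j. \<integral>\<^sup>+w. ennreal ((norm (J j w - D w))\<^sup>2) \<partial>M) \<longlonglongrightarrow> 0" using lim unfolding J_def .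
    fix j
    show "AE w in M. \<bar>z w \<bullet> (J j w - D w)\<bar> \<le> \<bar>c\<bar> * \<bar>norm (J j w - D w)\<bar> + 0 * (norm (J j w - D w))\<^sup>2"
    proof (rule AE_I2)
      fix w assume "w \<in> space M"
      then have "norm (z w) * norm (J j w - D w) \<le> \<bar>c\<bar> * norm (J j w - D w)"
        using z(2)[of w] by (intro mult_right_mono) auto
      then show "\<bar>z w \<bullet> (J j w - D w)\<bar> \<le> \<bar>c\<bar> * \<bar>norm (J j w - D w)\<bar> + 0 * (norm (J j w - D w))\<^sup>2"
        using Cauchy_Schwarz_ineq2[of "z w" "J j w - D w"] by simp
    qed
  qed simp_all
  moreover have "(\<integral>w. z w \<bullet> (J j w - D w) \<partial>M) = - expectation (\<lambda>w. z w \<bullet> D w)" for j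
  proof -
    have 1: "has_bochner_integral M (\<lambda>w. z w \<bullet> J j w) 0"
      unfolding J_def by (rule elem_integral_mean[OF el s\<tau> z])
    have 2: "integrable M (\<lambda>w. z w \<bullet> D w)"
    proof (rule integrable_const_bound[where B="\<bar>c\<bar> * R"])
      show "AE w in M. norm (z w \<bullet> D w) \<le> \<bar>c\<bar> * R"
        using R(2) AE_space
      proof eventually_elim
        case (elim w)
        have "norm (z w) * norm (D w) \<le> \<bar>c\<bar> * R" using z(2)[OF elim(2)] elim(1) by (intro mult_mono) auto
        then show ?case using Cauchy_Schwarz_ineq2[of "z w" "D w"] by simp
      qed
    qed simp
    show ?thesis using 1 2 by (simp add: inner_diff_right has_bochner_integral_iff)
  qed
  ultimately have "(\<lambda>j::nat. - expectation (\<lambda>w. z w \<bullet> D w)) \<longlonglongrightarrow> 0" by simp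
  then show ?thesis by (simp add: LIMSEQ_const_iff)
qed

text \<open>L2 convergence does not carry fourth moments to the limit. But |D|^4 is the limit in
  mean of |D|^2 (D . J), which is linear in J and has bounded weight, and Young's inequality bounds
  the latter by 3/4 |D|^4 + 1/4 |J|^4. As D is bounded, E |D|^4 is finite and three quarters of it
  can be absorbed.\<close>

lemma ito_increment_fourth: "expectation (\<lambda>w. norm (D w) ^ 4) \<le> fourth_const * K ^ 4 * (t - s)\<^sup>2"
proof -
  obtain k \<tau> \<xi> where ap: "ito_approximants s t K H D k \<tau> \<xi>"
    using ito_increment_approx[OF st Hm K HK Is It] unfolding D by blast
  have el: "\<And>j. elementary F t (k j) (\<tau> j) (\<xi> j)" and s\<tau>: "\<And>j. s \<le> \<tau> j 0"
    and xi: "\<And>j i w. norm (\<xi> j i w) \<le> K"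
    and pK: "\<And>j r w. norm (elem_process (k j) (\<tau> j) (\<xi> j) r w) \<le> K * indicator {s<..t} r"
    and limp: "(\<lambda>j. \<integral>\<^sup>+z. ennreal ((norm (elem_process (k j) (\<tau> j) (\<xi> j) (snd z) (fst z)
        - indicator {s<..t} (snd z) *\<^sub>R H (snd z) (fst z)))\<^sup>2) \<partial>PP) \<longlonglongrightarrow> 0"
    and lim: "(\<lambda>j. \<integral>\<^sup>+w. ennreal ((norm (elem_integral W (k j) (\<tau> j) (\<xi> j) w - D w))\<^sup>2) \<partial>M) \<longlonglongrightarrow> 0"
    using ap unfolding ito_approximants_def by blast+
  define J where "J j = elem_integral W (k j) (\<tau> j) (\<xi> j)" for j
  have Jm: "J j \<in> borel_measurable M" for j unfolding J_def by (rule elem_integral_measurable[OF el])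
  note [measurable] = Jm D_measurable
  let ?c = "fourth_const * K ^ 4 * (t - s)\<^sup>2"
  have fc: "0 \<le> fourth_const" unfolding fourth_const_def using noise_fourth_nonneg by simp
  have J4: "integrable M (\<lambda>w. norm (J j w) ^ 4)" "expectation (\<lambda>w. norm (J j w) ^ 4) \<le> ?c" for j
  proof -
    have m: "integrable M (\<lambda>w. norm (J j w) ^ 4) \<and>
      expectation (\<lambda>w. norm (J j w) ^ 4) \<le> fourth_const * K ^ 4 * (\<tau> j (k j) - \<tau> j 0)\<^sup>2"
      using elem_integral_moments[OF el K xi order_refl, of j] unfolding J_def by blast
    \<comment> \<open>Every grid lies in [s, t], which makes the bound uniform in j.\<close>
    have "\<tau> j (k j) - \<tau> j 0 \<le> t - s" "0 \<le> \<tau> j (k j) - \<tau> j 0"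
      using el[of j] s\<tau>[of j] elementary_mono(2)[OF el order_refl, of j] by (auto simp: elementary_def)
    then have "(\<tau> j (k j) - \<tau> j 0)\<^sup>2 \<le> (t - s)\<^sup>2" by (intro power_mono)
    then have "fourth_const * K ^ 4 * (\<tau> j (k j) - \<tau> j 0)\<^sup>2 \<le> ?c"
      using fc K by (intro mult_left_mono mult_nonneg_nonneg) auto
    with m show "integrable M (\<lambda>w. norm (J j w) ^ 4)" "expectation (\<lambda>w. norm (J j w) ^ 4) \<le> ?c" by auto
  qed
  have J1: "integrable M (\<lambda>w. norm (J j w))" for j
    by (rule Bochner_Integration.integrable_bound[of M "\<lambda>w. 1 + norm (J j w) ^ 4"])
       (use J4 norm_ge_power in \<open>auto intro!: AE_I2 order_trans[OF norm_ge_power abs_ge_self]\<close>)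
  have D4: "integrable M (\<lambda>w. norm (D w) ^ 4)"
  proof (rule integrable_const_bound[where B="R ^ 4"])
    show "AE w in M. norm (norm (D w) ^ 4) \<le> R ^ 4"
      using R(2) by eventually_elim (simp add: power_mono)
  qed simp
  let ?f = "\<lambda>j w. (norm (D w))\<^sup>2 * (D w \<bullet> J j w) - norm (D w) ^ 4"
  have "(\<lambda>j. \<integral>w. ?f j w \<partial>M) \<longlonglongrightarrow> 0"
  proof (rule L2_limit_integral[where \<phi>="\<lambda>_. R ^ 3" and g="\<lambda>j w. norm (J j w - D w)" and c=0])
    show "(\<integral>\<^sup>+w. ennreal ((R ^ 3)\<^sup>2) \<partial>M) < \<infinity>" by (simp add: emeasure_space_1)
    show "(\<lambda>j. \<integral>\<^sup>+w. ennreal ((norm (J j w - D w))\<^sup>2) \<partial>M) \<longlonglongrightarrow> 0" using lim unfolding J_def .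
    fix j
    show "AE w in M. \<bar>?f j w\<bar> \<le> \<bar>R ^ 3\<bar> * \<bar>norm (J j w - D w)\<bar> + 0 * (norm (J j w - D w))\<^sup>2"
      using R(2)
    proof eventually_elim
      case (elim w)
      have "norm (D w) ^ 4 = (norm (D w))\<^sup>2 * (D w \<bullet> D w)"
        by (simp add: power2_norm_eq_inner[symmetric] power_add[symmetric])
      then have "?f j w = (norm (D w))\<^sup>2 * (D w \<bullet> (J j w - D w))"
        by (simp add: inner_diff_right right_diff_distrib)
      then have "\<bar>?f j w\<bar> = (norm (D w))\<^sup>2 * \<bar>D w \<bullet> (J j w - D w)\<bar>" by (simp add: abs_mult)
      also have "\<dots> \<le> (norm (D w))\<^sup>2 * (norm (D w) * norm (J j w - D w))"
        by (intro mult_left_mono Cauchy_Schwarz_ineq2) simp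
      also have "\<dots> = norm (D w) ^ 3 * norm (J j w - D w)" by (simp add: power3_eq_cube power2_eq_square)
      also have "\<dots> \<le> R ^ 3 * norm (J j w - D w)" using elim by (intro mult_right_mono power_mono) auto
      finally show ?case using R(1) by simp
    qed
  qed simp_all
  moreover have "(\<integral>w. ?f j w \<partial>M) = (\<integral>w. (norm (D w))\<^sup>2 * (D w \<bullet> J j w) \<partial>M) - expectation (\<lambda>w. norm (D w) ^ 4)"
    and upper: "(\<integral>w. (norm (D w))\<^sup>2 * (D w \<bullet> J j w) \<partial>M) \<le> 3/4 * expectation (\<lambda>w. norm (D w) ^ 4) + 1/4 * ?c" for j
  proof -
    have le: "(norm (D w))\<^sup>2 * (D w \<bullet> J j w) \<le> norm (D w) ^ 3 * norm (J j w)"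
      "\<bar>(norm (D w))\<^sup>2 * (D w \<bullet> J j w)\<bar> \<le> norm (D w) ^ 3 * norm (J j w)" for w
    proof -
      have "(norm (D w))\<^sup>2 * \<bar>D w \<bullet> J j w\<bar> \<le> (norm (D w))\<^sup>2 * (norm (D w) * norm (J j w))"
        by (intro mult_left_mono Cauchy_Schwarz_ineq2) simp
      then show "\<bar>(norm (D w))\<^sup>2 * (D w \<bullet> J j w)\<bar> \<le> norm (D w) ^ 3 * norm (J j w)"
        by (simp add: abs_mult power3_eq_cube power2_eq_square mult.assoc)
      then show "(norm (D w))\<^sup>2 * (D w \<bullet> J j w) \<le> norm (D w) ^ 3 * norm (J j w)" by linarith
    qed
    have i: "integrable M (\<lambda>w. (norm (D w))\<^sup>2 * (D w \<bullet> J j w))"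
    proof (rule Bochner_Integration.integrable_bound[of M "\<lambda>w. R ^ 3 * norm (J j w)"])
      show "AE w in M. norm ((norm (D w))\<^sup>2 * (D w \<bullet> J j w)) \<le> norm (R ^ 3 * norm (J j w))"
        using R(2)
      proof eventually_elim
        case (elim w)
        have "norm (D w) ^ 3 * norm (J j w) \<le> R ^ 3 * norm (J j w)"
          using elim by (intro mult_right_mono power_mono) auto
        then show ?case using le(2)[of w] R(1) by simp
      qed
    qed (use J1 in simp_all)
    show "(\<integral>w. ?f j w \<partial>M) = (\<integral>w. (norm (D w))\<^sup>2 * (D w \<bullet> J j w) \<partial>M) - expectation (\<lambda>w. norm (D w) ^ 4)"
      by (rule Bochner_Integration.integral_diff[OF i D4])
    have "(\<integral>w. (norm (D w))\<^sup>2 * (D w \<bullet> J j w) \<partial>M) \<le> (\<integral>w. 3/4 * norm (D w) ^ 4 + 1/4 * norm (J j w) ^ 4 \<partial>M)"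
    proof (rule integral_mono[OF i])
      show "integrable M (\<lambda>w. 3/4 * norm (D w) ^ 4 + 1/4 * norm (J j w) ^ 4)"
        by (intro Bochner_Integration.integrable_add integrable_mult_right D4 J4)
      fix w
      show "(norm (D w))\<^sup>2 * (D w \<bullet> J j w) \<le> 3/4 * norm (D w) ^ 4 + 1/4 * norm (J j w) ^ 4"
        by (rule order_trans[OF le(1) young_cubic]) auto
    qed
    also have "\<dots> = 3/4 * expectation (\<lambda>w. norm (D w) ^ 4) + 1/4 * expectation (\<lambda>w. norm (J j w) ^ 4)"
      using D4 J4(1)[of j] by simp
    also have "\<dots> \<le> 3/4 * expectation (\<lambda>w. norm (D w) ^ 4) + 1/4 * ?c"
      by (intro add_left_mono mult_left_mono J4) simp
    finally show "(\<integral>w. (norm (D w))\<^sup>2 * (D w \<bullet> J j w) \<partial>M) \<le> 3/4 * expectation (\<lambda>w. norm (D w) ^ 4) + 1/4 * ?c" .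
  qed
  ultimately have l: "(\<lambda>j. (\<integral>w. (norm (D w))\<^sup>2 * (D w \<bullet> J j w) \<partial>M) - expectation (\<lambda>w. norm (D w) ^ 4)) \<longlonglongrightarrow> 0"
    by simp
  have "0 \<le> (3/4 * expectation (\<lambda>w. norm (D w) ^ 4) + 1/4 * ?c) - expectation (\<lambda>w. norm (D w) ^ 4)"
  proof (rule LIMSEQ_le_const2[OF l], intro exI allI impI)
    fix n
    show "(\<integral>w. (norm (D w))\<^sup>2 * (D w \<bullet> J n w) \<partial>M) - expectation (\<lambda>w. norm (D w) ^ 4)
       \<le> 3/4 * expectation (\<lambda>w. norm (D w) ^ 4) + 1/4 * ?c - expectation (\<lambda>w. norm (D w) ^ 4)"
      using upper[of n] by linarith
  qed
  then show ?thesis by simp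
qed

text \<open>The polarised isometry for the pair A J and J gives the identity for each approximant,
  and both sides converge.\<close>

lemma ito_increment_quadratic:
  assumes A: "A \<in> borel_measurable (F s)" "\<And>w. w \<in> space M \<Longrightarrow> norm (A w :: real^'n^'n) \<le> a"
  shows "expectation (\<lambda>w. (A w *v D w) \<bullet> D w) =
    (\<integral>z. indicator {s<..t} (snd z) * cov_form S (A (fst z) ** H (snd z) (fst z)) (H (snd z) (fst z)) \<partial>PP)"
proof -
  obtain k \<tau> \<xi> where ap: "ito_approximants s t K H D k \<tau> \<xi>"
    using ito_increment_approx[OF st Hm K HK Is It] unfolding D by blast
  have el: "\<And>j. elementary F t (k j) (\<tau> j) (\<xi> j)" and s\<tau>: "\<And>j. s \<le> \<tau> j 0"
    and xi: "\<And>j i w. norm (\<xi> j i w) \<le> K"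
    and pK: "\<And>j r w. norm (elem_process (k j) (\<tau> j) (\<xi> j) r w) \<le> K * indicator {s<..t} r"
    and limp: "(\<lambda>j. \<integral>\<^sup>+z. ennreal ((norm (elem_process (k j) (\<tau> j) (\<xi> j) (snd z) (fst z)
        - indicator {s<..t} (snd z) *\<^sub>R H (snd z) (fst z)))\<^sup>2) \<partial>PP) \<longlonglongrightarrow> 0"
    and lim: "(\<lambda>j. \<integral>\<^sup>+w. ennreal ((norm (elem_integral W (k j) (\<tau> j) (\<xi> j) w - D w))\<^sup>2) \<partial>M) \<longlonglongrightarrow> 0"
    using ap unfolding ito_approximants_def by blast+
  define J where "J j = elem_integral W (k j) (\<tau> j) (\<xi> j)" for j
  define P where "P j z = elem_process (k j) (\<tau> j) (\<xi> j) (snd z) (fst z)" for j and z :: "'w \<times> real"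
  define G where "G z = indicator {s<..t} (snd z) *\<^sub>R H (snd z) (fst z)" for z :: "'w \<times> real"
  have Jm: "J j \<in> borel_measurable M" for j unfolding J_def by (rule elem_integral_measurable[OF el])
  have sp: "simple_pair (elem_process (k j) (\<tau> j) (\<xi> j)) (J j)" for j
    unfolding J_def by (rule elementary_simple_pair[OF el])
  have Pm: "P j \<in> borel_measurable PP" for j
    unfolding P_def[abs_def] by (rule simple_pair_measurable[OF sp])
  have Gm: "G \<in> borel_measurable PP" unfolding G_def[abs_def] using Hm by measurable
  have AM: "A \<in> borel_measurable M" using A(1) by (rule measurable_F_M)
  note [measurable] = Jm D_measurable Pm Gm AM
  have APm: "(\<lambda>z. A (fst z)) \<in> borel_measurable PP" by measurable
  obtain c1 where c1: "0 \<le> c1" "\<And>(X :: real^'n^'n) (Y :: real^'l^'n). norm (X ** Y) \<le> c1 * norm X * norm Y"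
    by (rule matrix_mult_bound) blast
  obtain c2 where c2: "0 \<le> c2" "\<And>X Y :: real^'l^'n. \<bar>cov_form S X Y\<bar> \<le> c2 * (norm X * norm Y)"
    by (rule cov_form_bound[of S]) blast
  define a' where "a' = \<bar>a\<bar>"
  have a': "norm (A w) \<le> a'" if "w \<in> space M" for w using A(2)[OF that] by (simp add: a'_def)
  have a0: "0 \<le> a'" by (simp add: a'_def)
  have cA: "\<bar>cov_form S (A w ** X) Y\<bar> \<le> c2 * c1 * a' * (norm X * norm Y)" if "w \<in> space M" for w and X Y :: "real^'l^'n"
  proof -
    have "norm (A w ** X) \<le> c1 * a' * norm X"
      by (rule order_trans[OF c1(2)]) (intro mult_mono c1(1) a' that order_refl norm_ge_zero mult_nonneg_nonneg a0)
    then have "c2 * (norm (A w ** X) * norm Y) \<le> c2 * ((c1 * a' * norm X) * norm Y)"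
      by (intro mult_left_mono mult_right_mono c2 norm_ge_zero)
    then show ?thesis using c2(2)[of "A w ** X" Y] by (simp add: mult_ac)
  qed
  have mA: "norm (A w *v v) \<le> a' * norm v" if "w \<in> space M" for w v
    by (rule order_trans[OF norm_matrix_vector_mult_le]) (intro mult_right_mono a' that norm_ge_zero)
  have key: "expectation (\<lambda>w. (A w *v J j w) \<bullet> J j w) = (\<integral>z. cov_form S (A (fst z) ** P j z) (P j z) \<partial>PP) \<and>
      integrable M (\<lambda>w. (A w *v J j w) \<bullet> J j w) \<and> integrable PP (\<lambda>z. cov_form S (A (fst z) ** P j z) (P j z))" for j
  proof -
    \<comment> \<open>The grid starts at or after s, when A is known, so multiplying the
      coefficients by A from the left yields an elementary integrand again; by linearity its
      integral is A J.\<close>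
    have "elementary F t (k j) (\<tau> j) (\<lambda>i w. A w ** \<xi> j i w)"
      unfolding elementary_def
    proof (intro conjI allI impI)
      show "0 \<le> \<tau> j 0" "\<tau> j (k j) \<le> t" using el[of j] by (auto simp: elementary_def)
      fix i assume i: "i < k j"
      show "\<tau> j i \<le> \<tau> j (Suc i)" using el[of j] i by (auto simp: elementary_def)
      have "s \<le> \<tau> j i" using s\<tau>[of j] elementary_mono(2)[OF el, of i j] i by simp
      then show "(\<lambda>w. A w ** \<xi> j i w) \<in> borel_measurable (F (\<tau> j i))"
        using el[of j] i by (intro mat_mult_measurable measurable_F_mono[OF A(1)]) (auto simp: elementary_def)
      show "\<exists>C. \<forall>w\<in>space (F (\<tau> j i)). norm (A w ** \<xi> j i w) \<le> C"
      proof (intro exI ballI)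
        fix w assume "w \<in> space (F (\<tau> j i))"
        then show "norm (A w ** \<xi> j i w) \<le> c1 * a' * K"
          by (intro order_trans[OF c1(2)] mult_mono xi a' c1(1) order_refl norm_ge_zero mult_nonneg_nonneg a0) auto
      qed
    qed
    from elementary_simple_pair[OF this]
    have sp': "simple_pair (elem_process (k j) (\<tau> j) (\<lambda>i w. A w ** \<xi> j i w)) (elem_integral W (k j) (\<tau> j) (\<lambda>i w. A w ** \<xi> j i w))" .
    have e1: "elem_integral W (k j) (\<tau> j) (\<lambda>i w. A w ** \<xi> j i w) w = A w *v J j w" for w
      unfolding J_def elem_integral_def matrix_vector_mul_assoc[symmetric]
      by (rule linear_sum[OF matrix_vector_mul_linear, symmetric])
    have e2: "elem_process (k j) (\<tau> j) (\<lambda>i w. A w ** \<xi> j i w) (snd z) (fst z) = A (fst z) ** P j z" for z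
    proof -
      have "A (fst z) ** (\<Sum>i\<in>I. X i) = (\<Sum>i\<in>I. A (fst z) ** X i)" if "finite I" for I :: "nat set" and X :: "nat \<Rightarrow> real^'l^'n"
        using that
      proof induction
        case empty
        show ?case by (simp add: matrix_matrix_mult_def vec_eq_iff)
      next
        case (insert x I)
        then show ?case by (simp add: matrix_mult_add_right)
      qed
      then show ?thesis unfolding P_def elem_process_def by (simp add: matrix_mult_scaleR_right)
    qed
    show ?thesis
      using simple_pair_isometric[OF sp' sp] unfolding isometric_def e1 e2 P_def[symmetric]
      by (auto simp: has_bochner_integral_iff)
  qed
  have DD: "integrable M (\<lambda>w. (A w *v D w) \<bullet> D w)"
  proof (rule integrable_const_bound[where B="a' * R * R"])
    show "AE w in M. norm ((A w *v D w) \<bullet> D w) \<le> a' * R * R"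
      using R(2) AE_space
    proof eventually_elim
      case (elim w)
      have "norm (A w *v D w) * norm (D w) \<le> (a' * norm (D w)) * norm (D w)"
        by (intro mult_right_mono mA elim norm_ge_zero)
      also have "\<dots> \<le> (a' * R) * R" using elim a0 R by (intro mult_mono mult_left_mono) auto
      finally show ?case using Cauchy_Schwarz_ineq2[of "A w *v D w" "D w"] by simp
    qed
    show "(\<lambda>w. (A w *v D w) \<bullet> D w) \<in> borel_measurable M"
      by (intro borel_measurable_inner mat_measurable(1) AM D_measurable)
  qed
  have PPsp: "fst z \<in> space M" if "z \<in> space PP" for z using that by (auto simp: space_pair_measure)
  have ind2: "(\<integral>\<^sup>+z. ennreal ((b * indicator {s<..t} (snd z))\<^sup>2) \<partial>PP) < \<infinity>" for b
  proof -
    have "(\<integral>\<^sup>+z. ennreal ((b * indicator {s<..t} (snd z))\<^sup>2) \<partial>PP) = (\<integral>\<^sup>+z. ennreal (b\<^sup>2) * indicator (space M \<times> {s<..t}) z \<partial>PP)"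
      by (intro nn_integral_cong) (auto simp: indicator_def space_pair_measure)
    also have "\<dots> = ennreal (b\<^sup>2) * emeasure PP (space M \<times> {s<..t})"
      by (rule nn_integral_cmult_indicator) auto
    also have "\<dots> = ennreal (b\<^sup>2) * ennreal (t - s)"
      using st by (simp add: PP.M2.emeasure_pair_measure_Times emeasure_space_1)
    also have "\<dots> < \<infinity>" by (simp add: ennreal_mult_less_top)
    finally show ?thesis .
  qed
  have GG: "integrable PP (\<lambda>z. cov_form S (A (fst z) ** G z) (G z))"
  proof (rule Bochner_Integration.integrable_bound)
    show "integrable PP (\<lambda>z. 1 * (c2 * c1 * a' * (K * K) * indicator {s<..t} (snd z)))"
      using has_bochner_integral_prod[of "\<lambda>_. 1" "\<lambda>r. c2 * c1 * a' * (K * K) * indicator {s<..t} r"] st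
      by (auto simp: has_bochner_integral_iff)
    show "AE z in PP. norm (cov_form S (A (fst z) ** G z) (G z)) \<le> norm (1 * (c2 * c1 * a' * (K * K) * indicator {s<..t} (snd z)))"
    proof (rule AE_I2)
      fix z assume z: "z \<in> space PP"
      have "norm (G z) \<le> K * indicator {s<..t} (snd z)"
        using HK[OF PPsp[OF z]] by (auto simp: G_def indicator_def)
      then have "norm (G z) * norm (G z) \<le> (K * indicator {s<..t} (snd z)) * (K * indicator {s<..t} (snd z))"
        using K by (intro mult_mono) auto
      then have "c2 * c1 * a' * (norm (G z) * norm (G z)) \<le> c2 * c1 * a' * (K * K * indicator {s<..t} (snd z))"
        using c1 c2 a0 by (intro mult_left_mono mult_nonneg_nonneg) (auto simp: indicator_def)
      then have "norm (cov_form S (A (fst z) ** G z) (G z)) \<le> 1 * (c2 * c1 * a' * (K * K) * indicator {s<..t} (snd z))"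
        using cA[OF PPsp[OF z], of "G z" "G z"] by (simp add: mult.assoc)
      then show "norm (cov_form S (A (fst z) ** G z) (G z)) \<le> norm (1 * (c2 * c1 * a' * (K * K) * indicator {s<..t} (snd z)))"
        by (rule order_trans) (simp only: real_norm_def abs_ge_self)
    qed
    show "(\<lambda>z. cov_form S (A (fst z) ** G z) (G z)) \<in> borel_measurable PP"
      by (intro cov_form_measurable mat_mult_measurable APm Gm)
  qed
  \<comment> \<open>With J = D + r the difference consists of two terms linear in r, together
    weighted by 2 a' R, and one quadratic in r, weighted by a'.\<close>
  have l1: "(\<lambda>j. \<integral>w. (A w *v J j w) \<bullet> J j w - (A w *v D w) \<bullet> D w \<partial>M) \<longlonglongrightarrow> 0"
  proof (rule L2_limit_integral[where \<phi>="\<lambda>_. 2 * a' * R" and g="\<lambda>j w. norm (J j w - D w)" and c=a'])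
    show "(\<integral>\<^sup>+w. ennreal ((2 * a' * R)\<^sup>2) \<partial>M) < \<infinity>" by (simp add: emeasure_space_1)
    show "(\<lambda>j. \<integral>\<^sup>+w. ennreal ((norm (J j w - D w))\<^sup>2) \<partial>M) \<longlonglongrightarrow> 0" using lim unfolding J_def .
    fix j
    show "AE w in M. \<bar>(A w *v J j w) \<bullet> J j w - (A w *v D w) \<bullet> D w\<bar>
       \<le> \<bar>2 * a' * R\<bar> * \<bar>norm (J j w - D w)\<bar> + a' * (norm (J j w - D w))\<^sup>2"
      using R(2) AE_space
    proof eventually_elim
      case (elim w)
      define r where "r = J j w - D w"
      have Jr: "J j w = D w + r" by (simp add: r_def)
      have "(A w *v J j w) \<bullet> J j w - (A w *v D w) \<bullet> D w = (A w *v r) \<bullet> D w + (A w *v D w) \<bullet> r + (A w *v r) \<bullet> r"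
        unfolding Jr by (simp add: matrix_vector_right_distrib inner_add_left inner_add_right)
      then have "\<bar>(A w *v J j w) \<bullet> J j w - (A w *v D w) \<bullet> D w\<bar> \<le> \<bar>(A w *v r) \<bullet> D w\<bar> + \<bar>(A w *v D w) \<bullet> r\<bar> + \<bar>(A w *v r) \<bullet> r\<bar>"
        by linarith
      also have "\<dots> \<le> a' * norm r * R + a' * R * norm r + a' * norm r * norm r"
      proof (intro add_mono)
        show "\<bar>(A w *v r) \<bullet> D w\<bar> \<le> a' * norm r * R"
          by (rule order_trans[OF Cauchy_Schwarz_ineq2]) (intro mult_mono mA elim a0 mult_nonneg_nonneg norm_ge_zero)
        have "norm (A w *v D w) \<le> a' * R" by (rule order_trans[OF mA[OF elim(2)]]) (intro mult_left_mono elim a0)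
        then show "\<bar>(A w *v D w) \<bullet> r\<bar> \<le> a' * R * norm r"
          by (intro order_trans[OF Cauchy_Schwarz_ineq2] mult_right_mono norm_ge_zero)
        show "\<bar>(A w *v r) \<bullet> r\<bar> \<le> a' * norm r * norm r"
          by (intro order_trans[OF Cauchy_Schwarz_ineq2] mult_right_mono mA elim norm_ge_zero)
      qed
      also have "\<dots> = \<bar>2 * a' * R\<bar> * \<bar>norm r\<bar> + a' * (norm r)\<^sup>2"
        using a0 R(1) by (simp add: power2_eq_square algebra_simps abs_mult)
      finally show ?case unfolding r_def .
    qed
  qed (use a0 in simp_all)
  \<comment> \<open>Both P and G are bounded by K and vanish outside (s, t]. Hence the difference is
    linear in the error, with a weight that is square-integrable although the time axis is
    unbounded.\<close>
  have l2: "(\<lambda>j. \<integral>z. cov_form S (A (fst z) ** P j z) (P j z) - cov_form S (A (fst z) ** G z) (G z) \<partial>PP) \<longlonglongrightarrow> 0"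
  proof (rule L2_limit_integral[where \<phi>="\<lambda>z. (2 * (c2 * c1 * a' * K)) * indicator {s<..t} (snd z)" and g="\<lambda>j z. norm (P j z - G z)" and c=0])
    show "(\<integral>\<^sup>+z. ennreal (((2 * (c2 * c1 * a' * K)) * indicator {s<..t} (snd z))\<^sup>2) \<partial>PP) < \<infinity>" by (rule ind2)
    show "(\<lambda>j. \<integral>\<^sup>+z. ennreal ((norm (P j z - G z))\<^sup>2) \<partial>PP) \<longlonglongrightarrow> 0" using limp unfolding P_def G_def .
    fix j
    show "AE z in PP. \<bar>cov_form S (A (fst z) ** P j z) (P j z) - cov_form S (A (fst z) ** G z) (G z)\<bar>
       \<le> \<bar>(2 * (c2 * c1 * a' * K)) * indicator {s<..t} (snd z)\<bar> * \<bar>norm (P j z - G z)\<bar> + 0 * (norm (P j z - G z))\<^sup>2"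
    proof (rule AE_I2)
      fix z assume z: "z \<in> space PP"
      let ?i = "indicat_real {s<..t} (snd z)"
      define r where "r = P j z - G z"
      have Pr: "P j z = G z + r" by (simp add: r_def)
      have Gb: "norm (G z) \<le> K * ?i"
        using HK[OF PPsp[OF z]] by (auto simp: G_def indicator_def)
      have Pb: "norm (P j z) \<le> K * ?i" unfolding P_def by (rule pK)
      have "cov_form S (A (fst z) ** P j z) (P j z) - cov_form S (A (fst z) ** G z) (G z)
        = cov_form S (A (fst z) ** r) (P j z) + cov_form S (A (fst z) ** G z) r"
        unfolding Pr matrix_mult_add_right cov_form_add_left cov_form_add_right by simp
      then have "\<bar>cov_form S (A (fst z) ** P j z) (P j z) - cov_form S (A (fst z) ** G z) (G z)\<bar>
        \<le> \<bar>cov_form S (A (fst z) ** r) (P j z)\<bar> + \<bar>cov_form S (A (fst z) ** G z) r\<bar>" by linarith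
      also have "\<dots> \<le> c2 * c1 * a' * (norm r * (K * ?i)) + c2 * c1 * a' * ((K * ?i) * norm r)"
        using c1 c2 a0
        by (intro add_mono order_trans[OF cA[OF PPsp[OF z]]] mult_left_mono mult_right_mono Gb Pb norm_ge_zero mult_nonneg_nonneg)
      also have "\<dots> = \<bar>(2 * (c2 * c1 * a' * K)) * ?i\<bar> * \<bar>norm r\<bar> + 0 * (norm r)\<^sup>2"
        using c1 c2 a0 K by (simp add: abs_mult mult_ac)
      finally show "\<bar>cov_form S (A (fst z) ** P j z) (P j z) - cov_form S (A (fst z) ** G z) (G z)\<bar>
       \<le> \<bar>(2 * (c2 * c1 * a' * K)) * ?i\<bar> * \<bar>norm (P j z - G z)\<bar> + 0 * (norm (P j z - G z))\<^sup>2"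
        unfolding r_def .
    qed
  qed simp_all
  have "(\<lambda>j. (\<integral>w. (A w *v J j w) \<bullet> J j w - (A w *v D w) \<bullet> D w \<partial>M)
     - (\<integral>z. cov_form S (A (fst z) ** P j z) (P j z) - cov_form S (A (fst z) ** G z) (G z) \<partial>PP)) \<longlonglongrightarrow> 0 - 0"
    by (rule tendsto_diff[OF l1 l2])
  moreover have "(\<integral>w. (A w *v J j w) \<bullet> J j w - (A w *v D w) \<bullet> D w \<partial>M)
     - (\<integral>z. cov_form S (A (fst z) ** P j z) (P j z) - cov_form S (A (fst z) ** G z) (G z) \<partial>PP)
     = (\<integral>z. cov_form S (A (fst z) ** G z) (G z) \<partial>PP) - expectation (\<lambda>w. (A w *v D w) \<bullet> D w)" for j
    using key[of j] DD GG by simp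
  ultimately have "(\<lambda>j::nat. (\<integral>z. cov_form S (A (fst z) ** G z) (G z) \<partial>PP) - expectation (\<lambda>w. (A w *v D w) \<bullet> D w)) \<longlonglongrightarrow> 0"
    by simp
  then have "expectation (\<lambda>w. (A w *v D w) \<bullet> D w) = (\<integral>z. cov_form S (A (fst z) ** G z) (G z) \<partial>PP)"
    by (simp add: LIMSEQ_const_iff)
  moreover have "cov_form S (A (fst z) ** G z) (G z) =
      indicator {s<..t} (snd z) * cov_form S (A (fst z) ** H (snd z) (fst z)) (H (snd z) (fst z))" for z
    unfolding G_def matrix_mult_scaleR_right cov_form_scale by (simp add: indicator_def)
  ultimately show ?thesis by simp
qed

end

end

section \<open>Stopped paths\<close>

lemma closed_bdry: "closed (bdry \<Omega>)"
  by (simp add: bdry_def)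

lemma bdry_subset: "closed \<Omega> \<Longrightarrow> 0 \<in> \<Omega> \<Longrightarrow> bdry \<Omega> \<subseteq> \<Omega>"
  using frontier_subset_closed by (auto simp: bdry_def)

locale stopped_path = brownian_basis M F S W
  for M :: "'w measure" and F and S :: "real^'l^'l" and W +
  fixes \<Omega> :: "(real^'n) set" and X :: "real \<Rightarrow> 'w \<Rightarrow> real^'n" and x0 :: "real^'n"
  assumes \<Omega>: "compact \<Omega>" "0 \<in> \<Omega>" "x0 \<in> \<Omega>"
    and X_adapted: "\<And>t. 0 \<le> t \<Longrightarrow> X t \<in> borel_measurable (F t)"
    and X_cont: "\<And>w. w \<in> space M \<Longrightarrow> continuous_on {0..} (\<lambda>t. X t w)"
    and X_0: "AE w in M. X 0 w = x0"
begin

definition T :: "'w \<Rightarrow> ereal" where "T w = hit_time (bdry \<Omega>) X w"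
definition alive :: "real \<Rightarrow> 'w \<Rightarrow> real" where "alive r w = indicator (before_hit (bdry \<Omega>) X w) r"
definition Y :: "real \<Rightarrow> 'w \<Rightarrow> real^'n" where "Y t w = X (real_of_ereal (min (ereal t) (T w))) w"

lemma alive_eq: "alive r w = (if 0 \<le> r \<and> ereal r < T w then 1 else 0)"
  by (simp add: alive_def before_hit_def T_def)

lemma T_nonneg: "0 \<le> T w"
  unfolding T_def hit_time_def by (rule INF_greatest) simp

lemma T_le: "0 \<le> r \<Longrightarrow> X r w \<in> bdry \<Omega> \<Longrightarrow> T w \<le> ereal r"
  unfolding T_def hit_time_def by (rule INF_lower) simp

text \<open>The set of hitting times is closed by continuity of the path. Finiteness of T excludes
  the empty set, whose infimum is infinite, so the infimum is attained.\<close>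

lemma hit_attained:
  assumes w: "w \<in> space M" and fin: "T w < \<infinity>"
  obtains z where "0 \<le> z" "T w = ereal z" "X z w \<in> bdry \<Omega>"
proof -
  define Z where "Z = {t. 0 \<le> t \<and> X t w \<in> bdry \<Omega>}"
  have "Z \<noteq> {}"
  proof
    assume "Z = {}"
    moreover have "T w = (INF t\<in>Z. ereal t)" by (simp add: T_def hit_time_def Z_def)
    ultimately have "T w = \<infinity>" by (simp add: top_ereal_def)
    with fin show False by simp
  qed
  moreover have "closed Z"
  proof -
    have "closed ({0..} \<inter> (\<lambda>t. X t w) -` bdry \<Omega>)"
      by (intro continuous_closed_preimage X_cont w closed_bdry) simp
    moreover have "Z = {0..} \<inter> (\<lambda>t. X t w) -` bdry \<Omega>" by (auto simp: Z_def)
    ultimately show ?thesis by simp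
  qed
  moreover have bb: "bdd_below Z" by (rule bdd_belowI[of _ 0]) (simp add: Z_def)
  ultimately have in_Z: "Inf Z \<in> Z" by (intro closed_contains_Inf)
  have "T w = ereal (Inf Z)"
  proof (rule antisym)
    show "T w \<le> ereal (Inf Z)" using in_Z by (intro T_le) (auto simp: Z_def)
    show "ereal (Inf Z) \<le> T w"
      unfolding T_def hit_time_def Z_def[symmetric] by (rule INF_greatest) (simp add: cInf_lower bb)
  qed
  with in_Z show ?thesis using that by (auto simp: Z_def)
qed

lemma closed_\<Omega>: "closed \<Omega>"
  using \<Omega>(1) by (rule compact_imp_closed)

text \<open>A piece of path from x0 in \<Omega> to a point outside is connected and must meet the
  frontier, which would be an earlier hit. The equation itself does not confine X to
  \<Omega>.\<close>

lemma alive_in_\<Omega>: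
  assumes w: "w \<in> space M" "X 0 w = x0" and s: "0 \<le> s" "ereal s < T w"
  shows "X s w \<in> \<Omega>"
proof (rule ccontr)
  assume out: "X s w \<notin> \<Omega>"
  let ?P = "(\<lambda>t. X t w) ` {0..s}"
  have "connected ?P"
    by (intro connected_continuous_image continuous_on_subset[OF X_cont[OF w(1)]]) auto
  moreover have "?P \<inter> \<Omega> \<noteq> {}" using w(2) \<Omega>(3) s(1) by force
  moreover have "?P - \<Omega> \<noteq> {}" using out s(1) by force
  ultimately have "?P \<inter> frontier \<Omega> \<noteq> {}" by (rule connected_Int_frontier)
  then obtain r where "r \<in> {0..s}" "X r w \<in> frontier \<Omega>" by blast
  then have r: "0 \<le> r" "r \<le> s" "X r w \<in> bdry \<Omega>" by (auto simp: bdry_def)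
  from T_le[OF r(1,3)] s(2) have "ereal s < ereal r" by (rule less_le_trans[rotated])
  with r(2) show False by simp
qed

lemma Y_alive: "alive s w = 1 \<Longrightarrow> Y s w = X s w"
  by (auto simp: alive_eq Y_def min_def split: if_splits)

lemma alive_01: "alive s w = 0 \<or> alive s w = 1"
  by (simp add: alive_eq)

lemma alive_mono: "alive r w = 1 \<Longrightarrow> 0 \<le> s \<Longrightarrow> s \<le> r \<Longrightarrow> alive s w = 1"
  by (auto simp: alive_eq split: if_splits intro: le_less_trans[of "ereal s" "ereal r"])

lemma Y_dead: "alive s w = 0 \<Longrightarrow> 0 \<le> s \<Longrightarrow> s \<le> t \<Longrightarrow> Y t w = Y s w"
proof -
  assume "alive s w = 0" "0 \<le> s" "s \<le> t"
  then have "T w \<le> ereal s" by (auto simp: alive_eq not_less split: if_splits)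
  moreover from this \<open>s \<le> t\<close> have "T w \<le> ereal t" by (simp add: order_trans[of "T w" "ereal s"])
  ultimately have "min (ereal t) (T w) = T w" "min (ereal s) (T w) = T w"
    by (simp_all add: min_absorb2)
  then show ?thesis by (simp add: Y_def)
qed

lemma Y_in_\<Omega>:
  assumes w: "w \<in> space M" "X 0 w = x0" and t: "0 \<le> t"
  shows "Y t w \<in> \<Omega>"
proof (cases "ereal t < T w")
  case True
  then have "Y t w = X t w" by (simp add: Y_def min_def less_imp_le)
  then show ?thesis using alive_in_\<Omega>[OF w t True] by simp
next
  case False
  then have "T w \<le> ereal t" by simp
  then have "T w < \<infinity>" by (rule le_less_trans) simp
  from hit_attained[OF w(1) this] obtain z where z: "0 \<le> z" "T w = ereal z" "X z w \<in> bdry \<Omega>" by blast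
  have "min (ereal t) (T w) = ereal z" using \<open>T w \<le> ereal t\<close> z(2) by (simp add: min_def)
  then have "Y t w = X z w" by (simp add: Y_def)
  then show ?thesis using z(3) bdry_subset[OF closed_\<Omega> \<Omega>(2)] by auto
qed

lemma Y_0: "Y 0 w = X 0 w"
  using T_nonneg[of w] by (simp add: Y_def min_def zero_ereal_def)

lemma AE_start: "AE w in M. w \<in> space M \<and> X 0 w = x0"
  using X_0 AE_space by eventually_elim simp

section \<open>Measurability of hitting times and stopped paths\<close>

lemma X_measurable_M: "0 \<le> t \<Longrightarrow> X t \<in> borel_measurable M"
  by (rule measurable_F_M[OF X_adapted])

text \<open>
  By continuity the path meets the closed set within \<open>[0, t]\<close> iff its distance to it is arbitrarily
  small at rational times, so hitting times are stopping times without completing the filtration.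
\<close>

lemma hit_before_measurable:
  assumes t: "0 \<le> t"
  shows "{w \<in> space M. T w \<le> ereal t} \<in> sets (F t)"
proof -
  let ?Q = "\<rat> \<inter> {0..t}"
  let ?d = "\<lambda>r w. infdist (X r w) (bdry \<Omega>)"
  have ne: "bdry \<Omega> \<noteq> {}" by (simp add: bdry_def)
  have iff: "T w \<le> ereal t \<longleftrightarrow> (\<forall>n::nat. \<exists>r\<in>?Q. ?d r w < 1 / real (Suc n))" if w: "w \<in> space M" for w
  proof
    assume le: "T w \<le> ereal t"
    then have "T w < \<infinity>" by (rule le_less_trans) simp
    from hit_attained[OF w this] obtain z where z: "0 \<le> z" "T w = ereal z" "X z w \<in> bdry \<Omega>" by blast
    have zt: "z \<le> t" using le z(2) by simp
    show "\<forall>n::nat. \<exists>r\<in>?Q. ?d r w < 1 / real (Suc n)"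
    proof
      fix n :: nat
      have "continuous_on {0..} (\<lambda>r. ?d r w)" by (intro continuous_on_infdist X_cont w)
      then obtain e where e: "0 < e" "\<And>r. r \<in> {0..} \<Longrightarrow> dist r z < e \<Longrightarrow> dist (?d r w) (?d z w) < 1 / real (Suc n)"
        using z(1) unfolding continuous_on_iff by (metis atLeast_iff of_nat_0_less_iff zero_less_Suc zero_less_divide_1_iff)
      \<comment> \<open>For t = 0 no rational lies strictly inside the interval, but then z is 0 and
        is itself rational.\<close>
      have "\<exists>r\<in>?Q. dist r z < e"
      proof (cases "t = 0")
        case True
        then show ?thesis using z(1) zt e(1) by (intro bexI[of _ 0]) auto
      next
        case False
        then have "max 0 (z - e) < min t (z + e)" using t zt z(1) e(1) by auto
        from Rats_dense_in_real[OF this] obtain r where "r \<in> \<rat>" "max 0 (z - e) < r" "r < min t (z + e)" by blast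
        then show ?thesis by (intro bexI[of _ r]) (auto simp: dist_real_def)
      qed
      then obtain r where r: "r \<in> ?Q" "dist r z < e" by blast
      have "?d z w = 0" using z(3) by simp
      with e(2)[of r] r have "?d r w < 1 / real (Suc n)" by (simp add: dist_real_def)
      with r(1) show "\<exists>r\<in>?Q. ?d r w < 1 / real (Suc n)" by blast
    qed
  next
    assume small: "\<forall>n::nat. \<exists>r\<in>?Q. ?d r w < 1 / real (Suc n)"
    \<comment> \<open>The distance attains its minimum on the compact interval, and small values at
      rational times force that minimum to be 0.\<close>
    have "continuous_on {0..t} (\<lambda>r. ?d r w)"
      by (intro continuous_on_infdist continuous_on_subset[OF X_cont[OF w]]) auto
    then obtain z where z: "z \<in> {0..t}" "\<And>r. r \<in> {0..t} \<Longrightarrow> ?d z w \<le> ?d r w"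
      using continuous_attains_inf[of "{0..t}" "\<lambda>r. ?d r w"] t by auto
    have "?d z w = 0"
    proof (rule ccontr)
      assume "?d z w \<noteq> 0"
      then have "0 < ?d z w" using infdist_nonneg[of "X z w" "bdry \<Omega>"] by linarith
      then obtain n where "1 / real (Suc n) < ?d z w" using nat_approx_posE by blast
      moreover from small obtain r where "r \<in> ?Q" "?d r w < 1 / real (Suc n)" by blast
      ultimately show False using z(2)[of r] by auto
    qed
    then have "X z w \<in> bdry \<Omega>" using in_closed_iff_infdist_zero[OF closed_bdry ne] by blast
    from T_le[OF _ this] z(1) show "T w \<le> ereal t" by (auto intro: order_trans)
  qed
  have c: "countable ?Q" by (intro countable_Int1 countable_rat)
  have "{w \<in> space M. T w \<le> ereal t} = {w \<in> space (F t). \<forall>n::nat. \<exists>r\<in>?Q. ?d r w < 1 / real (Suc n)}"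
    using iff by auto
  also have "\<dots> \<in> sets (F t)"
  proof (intro sets.sets_Collect_countable_All sets.sets_Collect_countable_Ex' c)
    fix n :: nat and r assume r: "r \<in> ?Q"
    have "X r \<in> borel_measurable (F t)" using r by (intro measurable_F_mono[OF X_adapted]) auto
    then have "(\<lambda>w. ?d r w) \<in> borel_measurable (F t)"
      by (rule measurable_compose[OF _ borel_measurable_continuous_onI[OF continuous_on_infdist[OF continuous_on_id]]])
    then show "{w \<in> space (F t). ?d r w < 1 / real (Suc n)} \<in> sets (F t)" by measurable
  qed
  finally show ?thesis .
qed

lemma T_measurable [measurable]: "T \<in> borel_measurable M"
proof (rule borel_measurableI_le)
  fix y :: ereal
  show "{w \<in> space M. T w \<le> y} \<in> sets M"
  proof (cases y)
    case (real r)
    show ?thesis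
    proof (cases "0 \<le> r")
      case True
      have "{w \<in> space M. T w \<le> y} \<in> sets (F r)" unfolding real by (rule hit_before_measurable[OF True])
      then show ?thesis using subalg[of r] by (auto simp: subalgebra_def)
    next
      case False
      then have "ereal r < 0" by (simp add: zero_ereal_def)
      then have "\<not> T w \<le> y" for w
        unfolding real not_le by (rule less_le_trans[OF _ T_nonneg])
      then have "{w \<in> space M. T w \<le> y} = {}" by blast
      then show ?thesis by (simp only: sets.empty_sets)
    qed
  next
    case MInf
    have "\<not> T w \<le> y" for w
      unfolding MInf not_le by (rule less_le_trans[OF _ T_nonneg]) simp
    then have "{w \<in> space M. T w \<le> y} = {}" by blast
    then show ?thesis by (simp only: sets.empty_sets)
  qed simp
qed

lemma alive_adapted:
  assumes "0 \<le> s"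
  shows "alive s \<in> borel_measurable (F s)"
proof -
  have "{w \<in> space (F s). ereal s < T w} = space (F s) - {w \<in> space M. T w \<le> ereal s}" by auto
  then have "{w \<in> space (F s). ereal s < T w} \<in> sets (F s)"
    using hit_before_measurable[OF assms] by (simp add: sets.compl_sets del: space_F)
  then have "(\<lambda>w. if ereal s < T w then 1 else 0 :: real) \<in> borel_measurable (F s)" by measurable
  then show ?thesis using assms by (simp add: alive_eq[abs_def])
qed

lemma alive_measurable [measurable]: "(\<lambda>z. alive (snd z) (fst z)) \<in> borel_measurable PP"
  unfolding alive_eq by measurable

text \<open>A continuous path is the limit of the step paths that sample it on finer and finer
  grids, and those are jointly measurable. The maximum with 0 is taken since continuity and
  adaptedness are known for nonnegative times only.\<close>

lemma X_measurable_PP [measurable]: "(\<lambda>z. X (max 0 (snd z)) (fst z)) \<in> borel_measurable PP"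
proof (rule borel_measurable_LIMSEQ_metric)
  \<comment> \<open>The index of the last grid point before the current time, for the mesh 1 / (n +
    1); each step path thus uses countably many times.\<close>
  define u where "u n r = nat \<lfloor>max 0 r * real (Suc n)\<rfloor>" for n r
  fix n
  show "(\<lambda>z. X (real (u n (snd z)) / real (Suc n)) (fst z)) \<in> borel_measurable PP"
  proof (rule measurable_compose_countable[where f="\<lambda>i z. X (real i / real (Suc n)) (fst z)"])
    show "(\<lambda>z. X (real i / real (Suc n)) (fst z)) \<in> borel_measurable PP" for i
      by (rule measurable_compose[OF measurable_fst X_measurable_M]) simp
    show "(\<lambda>z. u n (snd z)) \<in> PP \<rightarrow>\<^sub>M count_space UNIV" unfolding u_def by measurable
  qed
next
  define u where "u n r = nat \<lfloor>max 0 r * real (Suc n)\<rfloor>" for n r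
  fix z assume z: "z \<in> space PP"
  define r where "r = max 0 (snd z)"
  have w: "fst z \<in> space M" using z by (auto simp: space_pair_measure)
  have r: "0 \<le> r" by (simp add: r_def)
  have "(\<lambda>n. real (u n (snd z)) / real (Suc n)) \<longlonglongrightarrow> r"
  proof (rule tendsto_sandwich)
    have b: "real (u n (snd z)) \<le> r * real (Suc n)" "r * real (Suc n) - 1 \<le> real (u n (snd z))" for n
    proof -
      have "0 \<le> r * real (Suc n)" using r by simp
      then show "real (u n (snd z)) \<le> r * real (Suc n)" unfolding u_def r_def[symmetric] by (simp add: of_nat_floor)
      show "r * real (Suc n) - 1 \<le> real (u n (snd z))" unfolding u_def r_def[symmetric] by linarith
    qed
    show "\<forall>\<^sub>F n in sequentially. real (u n (snd z)) / real (Suc n) \<le> r"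
      using b(1) by (intro always_eventually allI) (simp add: divide_le_eq)
    show "\<forall>\<^sub>F n in sequentially. r - 1 / real (Suc n) \<le> real (u n (snd z)) / real (Suc n)"
      using b(2) by (intro always_eventually allI) (simp add: le_divide_eq left_diff_distrib)
    have "(\<lambda>n. r - 1 / real (Suc n)) \<longlonglongrightarrow> r - 0" by (intro tendsto_diff tendsto_const LIMSEQ_Suc lim_1_over_n)
    then show "(\<lambda>n. r - 1 / real (Suc n)) \<longlonglongrightarrow> r" by simp
  qed (rule tendsto_const)
  then show "(\<lambda>n. X (real (u n (snd z)) / real (Suc n)) (fst z)) \<longlonglongrightarrow> X (max 0 (snd z)) (fst z)"
    unfolding r_def[symmetric]
    by (rule continuous_on_tendsto_compose[OF X_cont[OF w]]) (use r in auto)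
qed

text \<open>\<open>alive\<close> vanishes at negative times, so X may be replaced by its version
  frozen at time 0 there.\<close>

lemma alive_X_measurable:
  fixes \<phi> :: "real^'n \<Rightarrow> 'b::{second_countable_topology, real_normed_vector}"
  assumes [measurable]: "\<phi> \<in> borel_measurable borel"
  shows "(\<lambda>z. alive (snd z) (fst z) *\<^sub>R \<phi> (X (snd z) (fst z))) \<in> borel_measurable PP"
proof -
  have eq: "alive (snd z) (fst z) *\<^sub>R \<phi> (X (snd z) (fst z)) = alive (snd z) (fst z) *\<^sub>R \<phi> (X (max 0 (snd z)) (fst z))" for z
    by (simp add: alive_eq)
  show ?thesis unfolding eq by measurable
qed

lemma Y_measurable [measurable]:
  assumes "0 \<le> t"
  shows "Y t \<in> borel_measurable M"
proof -
  have "(\<lambda>w. X (max 0 (snd (w, real_of_ereal (min (ereal t) (T w))))) (fst (w, real_of_ereal (min (ereal t) (T w))))) \<in> borel_measurable M"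
    by (rule measurable_compose[OF _ X_measurable_PP]) measurable
  moreover have "0 \<le> real_of_ereal (min (ereal t) (T w))" for w
    using T_nonneg[of w] assms by (intro real_of_ereal_pos) (simp add: zero_ereal_def)
  ultimately show ?thesis by (simp add: Y_def[abs_def] max_absorb2)
qed

text \<open>A null set of paths times the whole time axis is null, since 0 times infinity is 0 in
  \<open>ennreal\<close>.\<close>

lemma AE_PP_fst:
  assumes "AE w in M. P w"
  shows "AE z in PP. P (fst z)"
proof -
  from assms obtain N where N: "N \<in> null_sets M" "{w \<in> space M. \<not> P w} \<subseteq> N"
    unfolding eventually_ae_filter by (elim bexE) (rule that)
  have "emeasure PP (N \<times> UNIV) = emeasure M N * emeasure lborel (UNIV :: real set)"
    using N(1) by (intro lborel.emeasure_pair_measure_Times) auto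
  moreover have "N \<times> UNIV \<in> sets PP" using N(1) by auto
  ultimately have "N \<times> UNIV \<in> null_sets PP"
    using N(1) by (intro null_setsI) (simp_all add: null_setsD1)
  then show ?thesis by (rule AE_I') (use N(2) in \<open>auto simp: space_pair_measure\<close>)
qed

end

section \<open>Dynkin inequality for stopped diffusions\<close>

lemma cube_add_le: "0 \<le> (x::real) \<Longrightarrow> 0 \<le> y \<Longrightarrow> (x + y) ^ 3 \<le> 4 * (x ^ 3 + y ^ 3)"
proof -
  assume "0 \<le> x" "0 \<le> y"
  have "4 * (x ^ 3 + y ^ 3) - (x + y) ^ 3 = 3 * ((x + y) * (x - y)\<^sup>2)" by algebra
  moreover have "0 \<le> 3 * ((x + y) * (x - y)\<^sup>2)" using \<open>0 \<le> x\<close> \<open>0 \<le> y\<close> by simp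
  ultimately show ?thesis by linarith
qed

text \<open>
  All powers of the martingale increment \<open>D\<close> are traded for its fourth power, weighted by
  \<open>\<eta>\<close> (the square root of the step size) so that every error term has size \<open>\<eta>\<^sup>3\<close> in the mean.
\<close>

lemma taylor_step_bound:
  fixes z D b :: "real^'n" and A :: "real^'n^'n"
  assumes \<eta>: "0 < \<eta>" "\<eta> \<le> 1" and b: "norm b \<le> Kb * \<eta>\<^sup>2" and A: "norm A \<le> ca" and C: "0 \<le> C" "0 \<le> Kb"
  shows "z \<bullet> (D + b) + 1/2 * ((D + b) \<bullet> (A *v (D + b))) + C * norm (D + b) ^ 3 \<le>
    z \<bullet> D + z \<bullet> b + 1/2 * ((A *v D) \<bullet> D) + (3/4 * (ca * Kb) + 1/2 * (ca * Kb\<^sup>2) + C + 4 * C * Kb ^ 3) * \<eta> ^ 3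
     + (ca * Kb / 4 + 3 * C) * (norm D ^ 4 / \<eta>)"
proof -
  define d where "d = norm D"
  have d: "0 \<le> d" by (simp add: d_def)
  have ca: "0 \<le> ca" using A norm_ge_zero[of A] by linarith
  have h2: "\<eta> ^ 4 \<le> \<eta> ^ 3" "\<eta> ^ 6 \<le> \<eta> ^ 3" using \<eta> by (auto intro!: power_decreasing)
  \<comment> \<open>Young's inequality for \<eta> and d, divided by \<eta>: the mixed term of drift
    and martingale is brought to the scales \<eta>^3 and d^4 / \<eta>.\<close>
  have p1: "d * \<eta>\<^sup>2 \<le> 3/4 * \<eta> ^ 3 + 1/4 * (d ^ 4 / \<eta>)"
  proof -
    have "(d * \<eta>\<^sup>2) * \<eta> \<le> (3/4 * \<eta> ^ 3 + 1/4 * (d ^ 4 / \<eta>)) * \<eta>"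
      using young_cubic[of \<eta> d] \<eta> d by (simp add: algebra_simps power2_eq_square power3_eq_cube power4_eq_xxxx)
    then show ?thesis using \<eta>(1) by simp
  qed
  have p3: "d ^ 3 \<le> 1/4 * \<eta> ^ 3 + 3/4 * (d ^ 4 / \<eta>)"
  proof -
    have "d ^ 3 * \<eta> \<le> (1/4 * \<eta> ^ 3 + 3/4 * (d ^ 4 / \<eta>)) * \<eta>"
      using young_cubic[of d \<eta>] \<eta> d by (simp add: algebra_simps power2_eq_square power3_eq_cube power4_eq_xxxx)
    then show ?thesis using \<eta>(1) by simp
  qed
  have Av: "norm (A *v v) \<le> ca * norm v" for v
    by (rule order_trans[OF norm_matrix_vector_mult_le]) (intro mult_right_mono A norm_ge_zero)
  have quad: "(D + b) \<bullet> (A *v (D + b)) \<le> (A *v D) \<bullet> D + 2 * (ca * d * (Kb * \<eta>\<^sup>2)) + ca * (Kb * \<eta>\<^sup>2) * (Kb * \<eta>\<^sup>2)"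
  proof -
    have "(D + b) \<bullet> (A *v (D + b)) = (A *v D) \<bullet> D + (A *v b) \<bullet> D + (A *v D) \<bullet> b + (A *v b) \<bullet> b"
      by (simp add: matrix_vector_right_distrib inner_add_left inner_add_right inner_commute)
    moreover have "(A *v b) \<bullet> D \<le> ca * d * (Kb * \<eta>\<^sup>2)"
    proof -
      have "(A *v b) \<bullet> D \<le> norm (A *v b) * norm D" by (rule norm_cauchy_schwarz)
      also have "\<dots> \<le> (ca * (Kb * \<eta>\<^sup>2)) * d" unfolding d_def
        by (intro mult_right_mono order_trans[OF Av] mult_left_mono b ca norm_ge_zero)
      finally show ?thesis by (simp add: mult_ac)
    qed
    moreover have "(A *v D) \<bullet> b \<le> ca * d * (Kb * \<eta>\<^sup>2)"
    proof -
      have "(A *v D) \<bullet> b \<le> norm (A *v D) * norm b" by (rule norm_cauchy_schwarz)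
      also have "\<dots> \<le> (ca * d) * (Kb * \<eta>\<^sup>2)" unfolding d_def
        by (intro mult_mono Av b) (use ca in auto)
      finally show ?thesis .
    qed
    moreover have "(A *v b) \<bullet> b \<le> ca * (Kb * \<eta>\<^sup>2) * (Kb * \<eta>\<^sup>2)"
    proof -
      have "(A *v b) \<bullet> b \<le> norm (A *v b) * norm b" by (rule norm_cauchy_schwarz)
      also have "\<dots> \<le> (ca * (Kb * \<eta>\<^sup>2)) * (Kb * \<eta>\<^sup>2)"
        by (intro mult_mono order_trans[OF Av] mult_left_mono b ca norm_ge_zero) (use ca C \<eta> in auto)
      finally show ?thesis .
    qed
    ultimately show ?thesis by linarith
  qed
  have "norm (D + b) ^ 3 \<le> (d + Kb * \<eta>\<^sup>2) ^ 3"
    unfolding d_def by (intro power_mono norm_triangle_le add_left_mono b norm_ge_zero)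
  also have "\<dots> \<le> 4 * (d ^ 3 + (Kb * \<eta>\<^sup>2) ^ 3)"
    using d C \<eta> by (intro cube_add_le) auto
  also have "(Kb * \<eta>\<^sup>2) ^ 3 = Kb ^ 3 * \<eta> ^ 6" by (simp add: power_mult_distrib power_mult[symmetric])
  finally have cub: "norm (D + b) ^ 3 \<le> 4 * d ^ 3 + 4 * (Kb ^ 3 * \<eta> ^ 6)" by simp
  have "4 * d ^ 3 + 4 * (Kb ^ 3 * \<eta> ^ 6) \<le> 4 * (1/4 * \<eta> ^ 3 + 3/4 * (d ^ 4 / \<eta>)) + 4 * (Kb ^ 3 * \<eta> ^ 3)"
    using p3 h2 C by (intro add_mono mult_left_mono) auto
  with cub have "norm (D + b) ^ 3 \<le> 4 * (1/4 * \<eta> ^ 3 + 3/4 * (d ^ 4 / \<eta>)) + 4 * (Kb ^ 3 * \<eta> ^ 3)" by linarith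
  from mult_left_mono[OF this C(1)]
  have c: "C * norm (D + b) ^ 3 \<le> (C + 4 * C * Kb ^ 3) * \<eta> ^ 3 + 3 * C * (d ^ 4 / \<eta>)"
    by (simp add: algebra_simps)
  have "ca * Kb * (d * \<eta>\<^sup>2) \<le> ca * Kb * (3/4 * \<eta> ^ 3 + 1/4 * (d ^ 4 / \<eta>))"
    using p1 ca C by (intro mult_left_mono) auto
  then have l: "ca * d * (Kb * \<eta>\<^sup>2) \<le> 3/4 * (ca * Kb) * \<eta> ^ 3 + ca * Kb / 4 * (d ^ 4 / \<eta>)"
    by (simp add: algebra_simps)
  have "ca * Kb\<^sup>2 * \<eta> ^ 4 \<le> ca * Kb\<^sup>2 * \<eta> ^ 3" using h2 ca by (intro mult_left_mono) auto
  moreover have "ca * (Kb * \<eta>\<^sup>2) * (Kb * \<eta>\<^sup>2) = ca * Kb\<^sup>2 * \<eta> ^ 4" by algebra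
  ultimately have q: "ca * (Kb * \<eta>\<^sup>2) * (Kb * \<eta>\<^sup>2) \<le> ca * Kb\<^sup>2 * \<eta> ^ 3" by (simp only:)
  have "1/2 * ((D + b) \<bullet> (A *v (D + b))) \<le> 1/2 * ((A *v D) \<bullet> D) + (3/4 * (ca * Kb) * \<eta> ^ 3 + ca * Kb / 4 * (d ^ 4 / \<eta>)) + 1/2 * (ca * Kb\<^sup>2) * \<eta> ^ 3"
    using quad l q by linarith
  with c show ?thesis unfolding d_def[symmetric] inner_add_right by (simp add: algebra_simps)
qed

text \<open>In the application \<beta> and \<sigma> are the drift under feedback and the noise
  matrix, both set to 0 outside \<Omega>; this is how bounds on the whole space can be asked
  for.\<close>

locale stopped_diffusion = stopped_path M F S W \<Omega> X x0
  for M :: "'w measure" and F and S :: "real^'l^'l" and W and \<Omega> :: "(real^'n) set" and X x0 +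
  fixes \<beta> :: "real^'n \<Rightarrow> real^'n" and \<sigma> :: "real^'n \<Rightarrow> real^'l^'n" and Kb K :: real
  assumes \<beta> [measurable]: "\<beta> \<in> borel_measurable borel" and \<beta>_bound: "\<And>x. norm (\<beta> x) \<le> Kb"
    and \<sigma> [measurable]: "\<sigma> \<in> borel_measurable borel" and \<sigma>_bound: "\<And>x. norm (\<sigma> x) \<le> K"
    and ito: "\<And>t. 0 \<le> t \<Longrightarrow> ito_limit t (\<lambda>r w. alive r w *\<^sub>R \<sigma> (X r w))
      (\<lambda>w. Y t w - x0 - (\<integral>r. indicator {0..t} r *\<^sub>R (alive r w *\<^sub>R \<beta> (X r w)) \<partial>lborel))"
begin

definition drift where "drift t w = (\<integral>r. indicator {0..t} r *\<^sub>R (alive r w *\<^sub>R \<beta> (X r w)) \<partial>lborel)"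
text \<open>The stochastic integral, recovered as what the start and the drift leave of the stopped
  path. In this form its boundedness can be read off from that of \<Omega>.\<close>

definition mart where "mart t w = Y t w - x0 - drift t w"

lemma Kb_nonneg: "0 \<le> Kb" and K_nonneg: "0 \<le> K"
  using \<beta>_bound[of 0] \<sigma>_bound[of 0] norm_ge_zero order_trans by blast+

lemma drift_section_measurable:
  assumes "w \<in> space M"
  shows "(\<lambda>r. alive r w *\<^sub>R \<beta> (X r w)) \<in> borel_measurable lborel"
  using measurable_compose[OF measurable_Pair1'[OF assms, of lborel] alive_X_measurable[OF \<beta>]] by simp

lemma drift_section_bound: "norm (alive r w *\<^sub>R \<beta> (X r w)) \<le> Kb"
  using \<beta>_bound[of "X r w"] Kb_nonneg by (auto simp: alive_eq)

lemma drift_integrable: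
  assumes w: "w \<in> space M" and J: "J \<in> sets lborel" "emeasure lborel J < \<infinity>"
  shows "integrable lborel (\<lambda>r. indicator J r *\<^sub>R (alive r w *\<^sub>R \<beta> (X r w)))"
proof (rule Bochner_Integration.integrable_bound)
  show "integrable lborel (\<lambda>r. Kb * indicator J r)"
    using J by (intro integrable_mult_right integrable_real_indicator)
  show "AE r in lborel. norm (indicator J r *\<^sub>R (alive r w *\<^sub>R \<beta> (X r w))) \<le> norm (Kb * indicator J r)"
    using drift_section_bound Kb_nonneg by (intro AE_I2) (auto simp: indicator_def)
  show "(\<lambda>r. indicator J r *\<^sub>R (alive r w *\<^sub>R \<beta> (X r w))) \<in> borel_measurable lborel"
    by (rule borel_measurable_scaleR[OF borel_measurable_indicator[OF J(1)] drift_section_measurable[OF w]])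
qed

lemma drift_diff:
  assumes w: "w \<in> space M" and st: "0 \<le> s" "s \<le> t"
  shows "drift t w - drift s w = (\<integral>r. indicator {s<..t} r *\<^sub>R (alive r w *\<^sub>R \<beta> (X r w)) \<partial>lborel)"
    "norm (drift t w - drift s w) \<le> Kb * (t - s)"
proof -
  have i: "integrable lborel (\<lambda>r. indicator {a..b} r *\<^sub>R (alive r w *\<^sub>R \<beta> (X r w)))"
    "integrable lborel (\<lambda>r. indicator {a<..b} r *\<^sub>R (alive r w *\<^sub>R \<beta> (X r w)))" for a b
    by (intro drift_integrable w emeasure_bounded_finite; simp)+
  have "drift t w - drift s w = (\<integral>r. indicator {0..t} r *\<^sub>R (alive r w *\<^sub>R \<beta> (X r w)) - indicator {0..s} r *\<^sub>R (alive r w *\<^sub>R \<beta> (X r w)) \<partial>lborel)"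
    unfolding drift_def by (rule Bochner_Integration.integral_diff[symmetric]) (rule i)+
  also have "\<dots> = (\<integral>r. indicator {s<..t} r *\<^sub>R (alive r w *\<^sub>R \<beta> (X r w)) \<partial>lborel)"
    using st by (intro Bochner_Integration.integral_cong refl) (auto simp: indicator_def)
  finally show eq: "drift t w - drift s w = (\<integral>r. indicator {s<..t} r *\<^sub>R (alive r w *\<^sub>R \<beta> (X r w)) \<partial>lborel)" .
  have "norm (drift t w - drift s w) \<le> (\<integral>r. norm (indicator {s<..t} r *\<^sub>R (alive r w *\<^sub>R \<beta> (X r w))) \<partial>lborel)"
    unfolding eq by (rule integral_norm_bound)
  also have "\<dots> \<le> (\<integral>r. Kb * indicator {s<..t} r \<partial>lborel)"
  proof (rule integral_mono)
    show "integrable lborel (\<lambda>r. Kb * indicat_real {s<..t} r)"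
      by (intro integrable_mult_right integrable_real_indicator emeasure_bounded_finite) auto
    show "norm (indicator {s<..t} r *\<^sub>R (alive r w *\<^sub>R \<beta> (X r w))) \<le> Kb * indicat_real {s<..t} r" for r
      using drift_section_bound by (auto simp: indicator_def)
  qed (intro integrable_norm i)
  also have "\<dots> = Kb * (t - s)" using st by simp
  finally show "norm (drift t w - drift s w) \<le> Kb * (t - s)" .
qed

lemma H_measurable: "(\<lambda>z. alive (snd z) (fst z) *\<^sub>R \<sigma> (X (snd z) (fst z))) \<in> borel_measurable PP"
  by (rule alive_X_measurable[OF \<sigma>])

lemma H_bound: "norm (alive r w *\<^sub>R \<sigma> (X r w)) \<le> K"
  using \<sigma>_bound[of "X r w"] K_nonneg by (auto simp: alive_eq)

lemma Y_diff_bound: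
  assumes "w \<in> space M" "X 0 w = x0" "0 \<le> s" "0 \<le> t"
  shows "norm (Y t w - Y s w) \<le> diameter \<Omega>"
  using diameter_bounded_bound[OF compact_imp_bounded[OF \<Omega>(1)] Y_in_\<Omega>[OF assms(1,2,4)] Y_in_\<Omega>[OF assms(1,2,3)]]
  by (simp add: dist_norm)

lemma mart_diff: "Y t w - Y s w = (mart t w - mart s w) + (drift t w - drift s w)"
  by (simp add: mart_def)

text \<open>The stopped path moves within the diameter of \<Omega> and the drift is bounded. This
  supplies the almost sure bound R under which the moments of increments were computed.\<close>

lemma mart_bound:
  assumes st: "0 \<le> s" "s \<le> t"
  shows "AE w in M. norm (mart t w - mart s w) \<le> diameter \<Omega> + Kb * (t - s)"
  using AE_start
proof eventually_elim
  case (elim w)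
  have "mart t w - mart s w = (Y t w - Y s w) - (drift t w - drift s w)" by (simp add: mart_def)
  then have "norm (mart t w - mart s w) \<le> norm (Y t w - Y s w) + norm (drift t w - drift s w)"
    by (simp only: norm_triangle_ineq4)
  then show ?case using Y_diff_bound[of w s t] drift_diff(2)[of w s t] elim st by auto
qed

lemma mart_bound_nonneg: "s \<le> t \<Longrightarrow> 0 \<le> diameter \<Omega> + Kb * (t - s)"
  using diameter_ge_0[OF compact_imp_bounded[OF \<Omega>(1)]] Kb_nonneg by simp

lemma mart_ito: "0 \<le> t \<Longrightarrow> ito_limit t (\<lambda>r w. alive r w *\<^sub>R \<sigma> (X r w)) (mart t)"
  using ito[of t] by (simp add: mart_def[abs_def] drift_def[abs_def])

lemma mart_measurable: "0 \<le> t \<Longrightarrow> mart t \<in> borel_measurable M"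
  using mart_ito[of t] by (simp add: ito_limit_def)

lemma mart_mean:
  assumes st: "0 \<le> s" "s \<le> t" and z: "z \<in> borel_measurable (F s)" "\<And>w. w \<in> space M \<Longrightarrow> norm (z w) \<le> c"
  shows "expectation (\<lambda>w. z w \<bullet> (mart t w - mart s w)) = 0"
  by (rule ito_increment_mean[OF st H_measurable K_nonneg H_bound mart_ito mart_ito refl mart_bound_nonneg mart_bound z])
     (use st in auto)

lemma mart_quadratic:
  assumes st: "0 \<le> s" "s \<le> t" and A: "A \<in> borel_measurable (F s)" "\<And>w. w \<in> space M \<Longrightarrow> norm (A w) \<le> c"
  shows "expectation (\<lambda>w. (A w *v (mart t w - mart s w)) \<bullet> (mart t w - mart s w)) =
    (\<integral>z. indicator {s<..t} (snd z) * (alive (snd z) (fst z) * cov_form S (A (fst z) ** \<sigma> (X (snd z) (fst z))) (\<sigma> (X (snd z) (fst z)))) \<partial>PP)"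
proof -
  have "cov_form S (A w ** (alive r w *\<^sub>R \<sigma> (X r w))) (alive r w *\<^sub>R \<sigma> (X r w)) = alive r w * cov_form S (A w ** \<sigma> (X r w)) (\<sigma> (X r w))" for r w
    unfolding matrix_mult_scaleR_right cov_form_scale by (simp add: alive_eq)
  moreover have "expectation (\<lambda>w. (A w *v (mart t w - mart s w)) \<bullet> (mart t w - mart s w)) =
    (\<integral>z. indicator {s<..t} (snd z) * cov_form S (A (fst z) ** (alive (snd z) (fst z) *\<^sub>R \<sigma> (X (snd z) (fst z)))) (alive (snd z) (fst z) *\<^sub>R \<sigma> (X (snd z) (fst z))) \<partial>PP)"
    by (rule ito_increment_quadratic[OF st H_measurable K_nonneg H_bound mart_ito mart_ito refl mart_bound_nonneg mart_bound A])
       (use st in auto)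
  ultimately show ?thesis by simp
qed

lemma mart_fourth:
  assumes st: "0 \<le> s" "s \<le> t"
  shows "expectation (\<lambda>w. norm (mart t w - mart s w) ^ 4) \<le> fourth_const * K ^ 4 * (t - s)\<^sup>2"
    "integrable M (\<lambda>w. norm (mart t w - mart s w) ^ 4)"
proof -
  show "expectation (\<lambda>w. norm (mart t w - mart s w) ^ 4) \<le> fourth_const * K ^ 4 * (t - s)\<^sup>2"
    by (rule ito_increment_fourth[OF st H_measurable K_nonneg H_bound mart_ito mart_ito refl mart_bound_nonneg mart_bound])
       (use st in auto)
  show "integrable M (\<lambda>w. norm (mart t w - mart s w) ^ 4)"
  proof (rule integrable_const_bound)
    show "AE w in M. norm (norm (mart t w - mart s w) ^ 4) \<le> (diameter \<Omega> + Kb * (t - s)) ^ 4"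
      using mart_bound[OF st] by eventually_elim (simp add: power_mono)
    show "(\<lambda>w. norm (mart t w - mart s w) ^ 4) \<in> borel_measurable M"
      using mart_measurable st by (intro borel_measurable_power borel_measurable_norm borel_measurable_diff) auto
  qed
qed

text \<open>The first moment is taken from the fourth: Young's inequality gives d \<le> 3/4 \<eta> +
  d^4 / (4 \<eta>^3), and E d^4 is of order \<eta>^4. The drift contributes \<eta>^2, which is at
  most \<eta>.\<close>

lemma Y_diff_mean:
  assumes st: "0 \<le> s" "s \<le> r" and \<eta>: "0 < \<eta>" "\<eta> \<le> 1" "r - s \<le> \<eta>\<^sup>2"
  shows "expectation (\<lambda>w. norm (Y r w - Y s w)) \<le> (3/4 + fourth_const * K ^ 4 / 4 + Kb) * \<eta>"
    "integrable M (\<lambda>w. norm (Y r w - Y s w))"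
proof -
  define d where "d w = norm (mart r w - mart s w)" for w
  have i4: "integrable M (\<lambda>w. d w ^ 4)" unfolding d_def by (rule mart_fourth(2)[OF st])
  have le: "AE w in M. norm (Y r w - Y s w) \<le> 3/4 * \<eta> + d w ^ 4 * (1 / (4 * \<eta> ^ 3)) + Kb * \<eta>"
    using AE_start
  proof eventually_elim
    case (elim w)
    have "norm (Y r w - Y s w) \<le> d w + norm (drift r w - drift s w)"
      unfolding mart_diff d_def by (rule norm_triangle_ineq)
    moreover have "norm (drift r w - drift s w) \<le> Kb * (r - s)" using drift_diff(2) elim st by blast
    moreover have "Kb * (r - s) \<le> Kb * \<eta>"
    proof (intro mult_left_mono Kb_nonneg)
      have "\<eta>\<^sup>2 \<le> \<eta> ^ 1" using \<eta> by (intro power_decreasing) auto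
      with \<eta>(3) show "r - s \<le> \<eta>" by simp
    qed
    moreover have "d w \<le> 3/4 * \<eta> + d w ^ 4 * (1 / (4 * \<eta> ^ 3))"
    proof -
      have "\<eta> ^ 3 * d w \<le> 3/4 * \<eta> ^ 4 + 1/4 * d w ^ 4" using \<eta>(1) by (intro young_cubic) (auto simp: d_def)
      then have "\<eta> ^ 3 * d w \<le> \<eta> ^ 3 * (3/4 * \<eta> + d w ^ 4 * (1 / (4 * \<eta> ^ 3)))"
        using \<eta>(1) by (simp add: distrib_left power4_eq_xxxx power3_eq_cube)
      then show ?thesis using \<eta>(1) by simp
    qed
    ultimately show ?case by linarith
  qed
  show i: "integrable M (\<lambda>w. norm (Y r w - Y s w))"
  proof (rule integrable_const_bound)
    show "AE w in M. norm (norm (Y r w - Y s w)) \<le> diameter \<Omega>"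
      using AE_start by eventually_elim (use Y_diff_bound[of _ s r] st in auto)
    show "(\<lambda>w. norm (Y r w - Y s w)) \<in> borel_measurable M" using st by simp
  qed
  have i': "integrable M (\<lambda>w. 3/4 * \<eta> + d w ^ 4 * (1 / (4 * \<eta> ^ 3)) + Kb * \<eta>)" using i4 by simp
  have "expectation (\<lambda>w. norm (Y r w - Y s w)) \<le> expectation (\<lambda>w. 3/4 * \<eta> + d w ^ 4 * (1 / (4 * \<eta> ^ 3)) + Kb * \<eta>)"
    by (rule integral_mono_AE[OF i i' le])
  also have "\<dots> = 3/4 * \<eta> + expectation (\<lambda>w. d w ^ 4) * (1 / (4 * \<eta> ^ 3)) + Kb * \<eta>"
    using i4 by (simp add: prob_space)
  also have "\<dots> \<le> 3/4 * \<eta> + (fourth_const * K ^ 4 * \<eta> ^ 4) * (1 / (4 * \<eta> ^ 3)) + Kb * \<eta>"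
  proof (intro add_mono mult_right_mono order_refl)
    have "0 \<le> fourth_const" unfolding fourth_const_def using noise_fourth_nonneg by simp
    moreover have "(r - s)\<^sup>2 \<le> \<eta> ^ 4" using power_mono[OF \<eta>(3), of 2] st by (simp add: power_mult[symmetric])
    ultimately have "fourth_const * K ^ 4 * (r - s)\<^sup>2 \<le> fourth_const * K ^ 4 * \<eta> ^ 4"
      using K_nonneg by (intro mult_left_mono) auto
    then show "expectation (\<lambda>w. d w ^ 4) \<le> fourth_const * K ^ 4 * \<eta> ^ 4"
      using mart_fourth(1)[OF st] unfolding d_def by linarith
  qed (use \<eta> in auto)
  also have "\<dots> = (3/4 + fourth_const * K ^ 4 / 4 + Kb) * \<eta>"
    using \<eta>(1) by (simp add: algebra_simps power4_eq_xxxx power3_eq_cube)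
  finally show "expectation (\<lambda>w. norm (Y r w - Y s w)) \<le> (3/4 + fourth_const * K ^ 4 / 4 + Kb) * \<eta>" .
qed

lemma integrable_PP_bounded:
  fixes f :: "'w \<times> real \<Rightarrow> real"
  assumes f: "f \<in> borel_measurable PP" and b: "\<And>z. z \<in> space PP \<Longrightarrow> \<bar>f z\<bar> \<le> c"
  shows "integrable PP (\<lambda>z. indicator {s<..t} (snd z) * f z)"
proof (rule Bochner_Integration.integrable_bound)
  have "integrable lborel (\<lambda>r. c * indicat_real {s<..t} r)"
    by (intro integrable_mult_right integrable_real_indicator emeasure_bounded_finite) auto
  from has_bochner_integral_prod[OF _ this, of "\<lambda>_. 1"]
  show "integrable PP (\<lambda>z. 1 * (c * indicat_real {s<..t} (snd z)))" by (simp add: has_bochner_integral_iff)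
  show "AE z in PP. norm (indicator {s<..t} (snd z) * f z) \<le> norm (1 * (c * indicat_real {s<..t} (snd z)))"
  proof (rule AE_I2)
    fix z assume "z \<in> space PP"
    from b[OF this] show "norm (indicator {s<..t} (snd z) * f z) \<le> norm (1 * (c * indicat_real {s<..t} (snd z)))"
      by (auto simp: indicator_def)
  qed
  show "(\<lambda>z. indicator {s<..t} (snd z) * f z) \<in> borel_measurable PP" using f by measurable
qed

end

section \<open>One time step with frozen gradient and Hessian\<close>

lemma matrix_mult_add_left: "((A :: real^'m^'n) + B) ** (X :: real^'k^'m) = A ** X + B ** X"
  by (simp add: matrix_matrix_mult_def vec_eq_iff sum.distrib distrib_right)

lemma cov_form_mult_bound:
  obtains c where "0 \<le> c" "\<And>(A :: real^'n^'n) (X :: real^'l^'n) (Y :: real^'l^'n). \<bar>cov_form S (A ** X) Y\<bar> \<le> c * norm A * (norm X * norm Y)"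
proof -
  obtain c1 where c1: "0 \<le> c1" "\<And>(X :: real^'n^'n) (Y :: real^'l^'n). norm (X ** Y) \<le> c1 * norm X * norm Y"
    by (rule matrix_mult_bound) blast
  obtain c2 where c2: "0 \<le> c2" "\<And>X Y :: real^'l^'n. \<bar>cov_form S X Y\<bar> \<le> c2 * (norm X * norm Y)"
    by (rule cov_form_bound[of S]) blast
  have "\<bar>cov_form S (A ** X) Y\<bar> \<le> (c2 * c1) * norm A * (norm X * norm Y)" for A :: "real^'n^'n" and X Y :: "real^'l^'n"
  proof -
    have "\<bar>cov_form S (A ** X) Y\<bar> \<le> c2 * (norm (A ** X) * norm Y)" by (rule c2)
    also have "\<dots> \<le> c2 * ((c1 * norm A * norm X) * norm Y)" by (intro mult_left_mono mult_right_mono c1 c2 norm_ge_zero)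
    finally show ?thesis by (simp add: mult_ac)
  qed
  then show ?thesis using that[of "c2 * c1"] c1(1) c2(1) by simp
qed

context stopped_diffusion
begin

context
  fixes V :: "real^'n \<Rightarrow> real" and g :: "real^'n \<Rightarrow> real^'n" and A :: "real^'n \<Rightarrow> real^'n^'n"
    and l :: "real^'n \<Rightarrow> real" and C cg ca L cV cl :: real
  assumes Vm [measurable]: "V \<in> borel_measurable borel" and Vb: "\<And>x. x \<in> \<Omega> \<Longrightarrow> \<bar>V x\<bar> \<le> cV"
    and gm [measurable]: "g \<in> borel_measurable borel" and gb: "\<And>x. norm (g x) \<le> cg"
    and gL: "\<And>x y. x \<in> \<Omega> \<Longrightarrow> y \<in> \<Omega> \<Longrightarrow> norm (g x - g y) \<le> L * norm (x - y)"
    and Am [measurable]: "A \<in> borel_measurable borel" and Ab: "\<And>x. norm (A x) \<le> ca"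
    and AL: "\<And>x y. x \<in> \<Omega> \<Longrightarrow> y \<in> \<Omega> \<Longrightarrow> norm (A x - A y) \<le> L * norm (x - y)"
    and lm [measurable]: "l \<in> borel_measurable borel" and l0: "\<And>x. 0 \<le> l x" and lb: "\<And>x. l x \<le> cl"
    and C0: "0 \<le> C" and L0: "0 \<le> L"
    and taylor: "\<And>x y. x \<in> \<Omega> \<Longrightarrow> y \<in> \<Omega> \<Longrightarrow>
      V y \<le> V x + g x \<bullet> (y - x) + 1/2 * ((y - x) \<bullet> (A x *v (y - x))) + C * norm (y - x) ^ 3"
    and gen: "\<And>x. x \<in> \<Omega> \<Longrightarrow> g x \<bullet> \<beta> x + 1/2 * cov_form S (A x ** \<sigma> x) (\<sigma> x) \<le> - l x"
begin

lemma V_integrable: "0 \<le> t \<Longrightarrow> integrable M (\<lambda>w. V (Y t w))"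
proof (rule integrable_const_bound[where B=cV])
  assume t: "0 \<le> t"
  show "AE w in M. norm (V (Y t w)) \<le> cV"
    using AE_start by eventually_elim (use Vb Y_in_\<Omega> t in auto)
  show "(\<lambda>w. V (Y t w)) \<in> borel_measurable M" using t by measurable
qed

text \<open>The expected running cost up to the hit, as one integral over paths and times; half-open
  intervals make it additive over adjacent steps.\<close>

definition running :: "real \<Rightarrow> real \<Rightarrow> real" where
  "running s t = (\<integral>z. indicator {s<..t} (snd z) * (alive (snd z) (fst z) *\<^sub>R l (X (snd z) (fst z))) \<partial>PP)"

lemma running_integrable: "integrable PP (\<lambda>z. indicator {s<..t} (snd z) * (alive (snd z) (fst z) *\<^sub>R l (X (snd z) (fst z))))"
proof (rule integrable_PP_bounded[where c=cl])
  show "(\<lambda>z. alive (snd z) (fst z) *\<^sub>R l (X (snd z) (fst z))) \<in> borel_measurable PP" by (rule alive_X_measurable[OF lm])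
  fix z :: "'w \<times> real"
  show "\<bar>alive (snd z) (fst z) *\<^sub>R l (X (snd z) (fst z))\<bar> \<le> cl"
    using l0[of "X (snd z) (fst z)"] lb[of "X (snd z) (fst z)"] by (auto simp: alive_eq)
qed

text \<open>\<open>gen\<close> needs all fields at one point, but Taylor's formula takes gradient
  and Hessian at time s, drift and noise at later times r. The discrepancy is a Lipschitz constant
  times the displacement from s to r, whose mean is O(\<eta>); over a step of length \<eta>^2 it
  joins the other errors of order \<eta>^3.\<close>

lemma generator_step:
  obtains k where "0 \<le> k" "\<And>s t \<eta>. 0 \<le> s \<Longrightarrow> 0 < \<eta> \<Longrightarrow> \<eta> \<le> 1 \<Longrightarrow> t = s + \<eta>\<^sup>2 \<Longrightarrow>
    expectation (\<lambda>w. V (Y t w)) + running s t \<le> expectation (\<lambda>w. V (Y s w)) + k * \<eta> ^ 3"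
proof -
  obtain c0 where c0: "0 \<le> c0" "\<And>(A :: real^'n^'n) (X :: real^'l^'n) (Y :: real^'l^'n). \<bar>cov_form S (A ** X) Y\<bar> \<le> c0 * norm A * (norm X * norm Y)"
    by (rule cov_form_mult_bound[of S]) blast
  \<comment> \<open>k1 and k2 are the constants of \<open>taylor_step_bound\<close>, k2 being
    multiplied by the fourth-moment constant in k. k3 is the error of freezing per unit of
    displacement, and k4 \<eta> bounds the mean displacement.\<close>
  define k1 where "k1 = 3/4 * (ca * Kb) + 1/2 * (ca * Kb\<^sup>2) + C + 4 * C * Kb ^ 3"
  define k2 where "k2 = ca * Kb / 4 + 3 * C"
  define k3 where "k3 = L * Kb + 1/2 * (c0 * L * (K * K))"
  define k4 where "k4 = 3/4 + fourth_const * K ^ 4 / 4 + Kb"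
  define k where "k = k1 + k2 * (fourth_const * K ^ 4) + k3 * k4"
  have ca0: "0 \<le> ca" and cg0: "0 \<le> cg" using Ab[of 0] gb[of 0] norm_ge_zero order_trans by blast+
  have fc: "0 \<le> fourth_const" unfolding fourth_const_def using noise_fourth_nonneg by simp
  have k0: "0 \<le> k1" "0 \<le> k2" "0 \<le> k3" "0 \<le> k4"
    using ca0 C0 L0 c0(1) Kb_nonneg K_nonneg fc by (auto simp: k1_def k2_def k3_def k4_def)
  have "expectation (\<lambda>w. V (Y t w)) + running s t \<le> expectation (\<lambda>w. V (Y s w)) + k * \<eta> ^ 3"
    if s: "0 \<le> s" and \<eta>: "0 < \<eta>" "\<eta> \<le> 1" and t: "t = s + \<eta>\<^sup>2" for s t \<eta>
  proof -
    have st: "s \<le> t" "0 \<le> t" and h: "t - s = \<eta>\<^sup>2" using s by (auto simp: t)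
    \<comment> \<open>The factor \<open>alive s\<close> switches gradient and Hessian off on paths
      already stopped and keeps both measurable at time s.\<close>
    define z where "z w = alive s w *\<^sub>R g (X s w)" for w
    define B where "B w = alive s w *\<^sub>R A (X s w)" for w
    define D where "D w = mart t w - mart s w" for w
    define b where "b w = drift t w - drift s w" for w
    have zF: "z \<in> borel_measurable (F s)"
      unfolding z_def[abs_def]
      by (intro borel_measurable_scaleR alive_adapted s measurable_compose[OF X_adapted[OF s] gm])
    have BF: "B \<in> borel_measurable (F s)"
      unfolding B_def[abs_def]
      by (intro borel_measurable_scaleR alive_adapted s measurable_compose[OF X_adapted[OF s] Am])
    have zb: "norm (z w) \<le> cg" for w using gb[of "X s w"] cg0 by (auto simp: z_def alive_eq)
    have Bb: "norm (B w) \<le> ca" for w using Ab[of "X s w"] ca0 by (auto simp: B_def alive_eq)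
    have Dm: "D \<in> borel_measurable M"
      unfolding D_def[abs_def] using mart_measurable s st by (intro borel_measurable_diff) auto
    have zM: "z \<in> borel_measurable M" and BM: "B \<in> borel_measurable M" using zF BF by (auto intro: measurable_F_M)
    note [measurable] = Dm zM BM
    have bb: "norm (b w) \<le> Kb * \<eta>\<^sup>2" if "w \<in> space M" for w
      using drift_diff(2)[OF that s st(1)] unfolding b_def h .
    have pw: "AE w in M. V (Y t w) \<le> V (Y s w) + (z w \<bullet> D w + z w \<bullet> b w + 1/2 * ((B w *v D w) \<bullet> D w) + k1 * \<eta> ^ 3 + k2 * (norm (D w) ^ 4 / \<eta>))"
      using AE_start
    proof eventually_elim
      case (elim w)
      show ?case
      proof (cases "alive s w = 1")
        case True
        then have "Y s w = X s w" by (rule Y_alive)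
        then have zB: "z w = g (Y s w)" "B w = A (Y s w)" using True by (auto simp: z_def B_def)
        have diff: "Y t w - Y s w = D w + b w" unfolding D_def b_def by (rule mart_diff)
        have "V (Y t w) \<le> V (Y s w) + z w \<bullet> (D w + b w) + 1/2 * ((D w + b w) \<bullet> (B w *v (D w + b w))) + C * norm (D w + b w) ^ 3"
          using taylor[of "Y s w" "Y t w"] Y_in_\<Omega>[of w] elim s st unfolding zB diff by simp
        moreover have "z w \<bullet> (D w + b w) + 1/2 * ((D w + b w) \<bullet> (B w *v (D w + b w))) + C * norm (D w + b w) ^ 3 \<le>
            z w \<bullet> D w + z w \<bullet> b w + 1/2 * ((B w *v D w) \<bullet> D w) + k1 * \<eta> ^ 3 + k2 * (norm (D w) ^ 4 / \<eta>)"
          unfolding k1_def k2_def using elim by (intro taylor_step_bound \<eta> bb Bb C0 Kb_nonneg) auto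
        ultimately show ?thesis by linarith
      next
        \<comment> \<open>A stopped path no longer moves and z and B vanish, so only the nonnegative
          error terms are left.\<close>
        case False
        then have "alive s w = 0" using alive_01 by blast
        have "Y t w = Y s w" by (rule Y_dead[OF \<open>alive s w = 0\<close> s st(1)])
        moreover have "z w = 0" "B w = 0" using \<open>alive s w = 0\<close> by (simp_all add: z_def B_def)
        moreover have "0 \<le> k1 * \<eta> ^ 3 + k2 * (norm (D w) ^ 4 / \<eta>)" using k0 \<eta> by simp
        ultimately show ?thesis by simp
      qed
    qed
    have Db: "AE w in M. norm (D w) \<le> diameter \<Omega> + Kb * (t - s)" unfolding D_def by (rule mart_bound[OF s st(1)])
    \<comment> \<open>Densities over paths and times: U1 of the drift term, U2 of the quadratic
      term, U3 of the running cost. U4 is the displacement since s, capped at the diameter so that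
      it is bounded even on the null set of paths with the wrong start.\<close>
    define U1 where "U1 y = z (fst y) \<bullet> (alive (snd y) (fst y) *\<^sub>R \<beta> (X (snd y) (fst y)))" for y :: "'w \<times> real"
    define U2 where "U2 y = cov_form S (B (fst y) ** (alive (snd y) (fst y) *\<^sub>R \<sigma> (X (snd y) (fst y)))) (alive (snd y) (fst y) *\<^sub>R \<sigma> (X (snd y) (fst y)))" for y :: "'w \<times> real"
    define U3 where "U3 y = alive (snd y) (fst y) *\<^sub>R l (X (snd y) (fst y))" for y :: "'w \<times> real"
    define U4 where "U4 y = min (diameter \<Omega>) (norm (alive (snd y) (fst y) *\<^sub>R X (snd y) (fst y) - alive (snd y) (fst y) *\<^sub>R Y s (fst y)))" for y :: "'w \<times> real"
    have \<beta>z: "(\<lambda>y. alive (snd y) (fst y) *\<^sub>R \<beta> (X (snd y) (fst y))) \<in> borel_measurable PP" by (rule alive_X_measurable[OF \<beta>])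
    have Xz: "(\<lambda>y. alive (snd y) (fst y) *\<^sub>R X (snd y) (fst y)) \<in> borel_measurable PP"
      using alive_X_measurable[of "\<lambda>x. x"] by simp
    have zP: "(\<lambda>y. z (fst y)) \<in> borel_measurable PP" "(\<lambda>y. B (fst y)) \<in> borel_measurable PP" by measurable
    have YsP: "(\<lambda>y. Y s (fst y)) \<in> borel_measurable PP" using Y_measurable[OF s] by measurable
    have U1m: "U1 \<in> borel_measurable PP" unfolding U1_def[abs_def] by (intro borel_measurable_inner zP \<beta>z)
    have U2m: "U2 \<in> borel_measurable PP" unfolding U2_def[abs_def] by (intro cov_form_measurable mat_mult_measurable zP H_measurable)
    have U4m: "U4 \<in> borel_measurable PP"
      unfolding U4_def[abs_def]
      by (intro borel_measurable_min borel_measurable_const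
          measurable_compose[OF borel_measurable_diff[OF Xz borel_measurable_scaleR[OF alive_measurable YsP]] borel_measurable_norm])
    have i1: "integrable PP (\<lambda>y. indicator {s<..t} (snd y) * U1 y)"
    proof (rule integrable_PP_bounded[OF U1m])
      fix y :: "'w \<times> real"
      show "\<bar>U1 y\<bar> \<le> cg * Kb" unfolding U1_def
        by (rule order_trans[OF Cauchy_Schwarz_ineq2]) (intro mult_mono zb drift_section_bound cg0 norm_ge_zero)
    qed
    have i2: "integrable PP (\<lambda>y. indicator {s<..t} (snd y) * U2 y)"
    proof (rule integrable_PP_bounded[OF U2m])
      fix y :: "'w \<times> real"
      show "\<bar>U2 y\<bar> \<le> c0 * ca * (K * K)" unfolding U2_def
        by (rule order_trans[OF c0(2)])
           (intro mult_mono Bb H_bound c0(1) order_refl mult_nonneg_nonneg ca0 K_nonneg norm_ge_zero)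
    qed
    have i3: "integrable PP (\<lambda>y. indicator {s<..t} (snd y) * U3 y)" unfolding U3_def by (rule running_integrable)
    have i4: "integrable PP (\<lambda>y. indicator {s<..t} (snd y) * U4 y)"
    proof (rule integrable_PP_bounded[OF U4m])
      fix y :: "'w \<times> real"
      show "\<bar>U4 y\<bar> \<le> diameter \<Omega>" unfolding U4_def
        using diameter_ge_0[OF compact_imp_bounded[OF \<Omega>(1)]] by auto
    qed
    have zD: "expectation (\<lambda>w. z w \<bullet> D w) = 0" unfolding D_def by (rule mart_mean[OF s st(1) zF zb])
    have zDi: "integrable M (\<lambda>w. z w \<bullet> D w)"
    proof (rule integrable_const_bound)
      show "AE w in M. norm (z w \<bullet> D w) \<le> cg * (diameter \<Omega> + Kb * (t - s))"
        using Db
      proof eventually_elim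
        case (elim w)
        have "\<bar>z w \<bullet> D w\<bar> \<le> norm (z w) * norm (D w)" by (rule Cauchy_Schwarz_ineq2)
        also have "\<dots> \<le> cg * (diameter \<Omega> + Kb * (t - s))" by (intro mult_mono zb elim cg0 norm_ge_zero)
        finally show ?case by simp
      qed
    qed measurable
    have zb_eq: "z w \<bullet> b w = (\<integral>r. indicator {s<..t} r * U1 (w, r) \<partial>lborel)" if w: "w \<in> space M" for w
    proof -
      have "z w \<bullet> b w = (\<integral>r. z w \<bullet> (indicator {s<..t} r *\<^sub>R (alive r w *\<^sub>R \<beta> (X r w))) \<partial>lborel)"
        unfolding b_def drift_diff(1)[OF w s st(1)]
        by (rule integral_inner_right[symmetric]) (intro drift_integrable w emeasure_bounded_finite; simp)
      then show ?thesis by (simp add: U1_def mult.assoc)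
    qed
    have zbi: "integrable M (\<lambda>w. z w \<bullet> b w)" and zbE: "expectation (\<lambda>w. z w \<bullet> b w) = (\<integral>y. indicator {s<..t} (snd y) * U1 y \<partial>PP)"
    proof -
      have "integrable M (\<lambda>w. \<integral>r. indicator {s<..t} r * U1 (w, r) \<partial>lborel)"
        using PP.integrable_fst'[OF i1] by simp
      then show "integrable M (\<lambda>w. z w \<bullet> b w)" by (simp add: zb_eq cong: Bochner_Integration.integrable_cong)
      have "expectation (\<lambda>w. z w \<bullet> b w) = (\<integral>w. (\<integral>r. indicator {s<..t} r * U1 (w, r) \<partial>lborel) \<partial>M)"
        by (intro Bochner_Integration.integral_cong refl zb_eq)
      also have "\<dots> = (\<integral>y. indicator {s<..t} (snd y) * U1 y \<partial>PP)" using PP.integral_fst'[OF i1] by simp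
      finally show "expectation (\<lambda>w. z w \<bullet> b w) = (\<integral>y. indicator {s<..t} (snd y) * U1 y \<partial>PP)" .
    qed
    have BDE: "expectation (\<lambda>w. (B w *v D w) \<bullet> D w) = (\<integral>y. indicator {s<..t} (snd y) * U2 y \<partial>PP)"
    proof -
      have "U2 y = alive (snd y) (fst y) * cov_form S (B (fst y) ** \<sigma> (X (snd y) (fst y))) (\<sigma> (X (snd y) (fst y)))" for y
        unfolding U2_def matrix_mult_scaleR_right cov_form_scale by (simp add: alive_eq)
      then show ?thesis unfolding D_def mart_quadratic[OF s st(1) BF Bb] by simp
    qed
    have BDi: "integrable M (\<lambda>w. (B w *v D w) \<bullet> D w)"
    proof (rule integrable_const_bound)
      show "AE w in M. norm ((B w *v D w) \<bullet> D w) \<le> (ca * (diameter \<Omega> + Kb * (t - s))) * (diameter \<Omega> + Kb * (t - s))"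
        using Db
      proof eventually_elim
        case (elim w)
        have "\<bar>(B w *v D w) \<bullet> D w\<bar> \<le> norm (B w *v D w) * norm (D w)" by (rule Cauchy_Schwarz_ineq2)
        also have "\<dots> \<le> (norm (B w) * norm (D w)) * norm (D w)"
          by (intro mult_right_mono norm_matrix_vector_mult_le norm_ge_zero)
        also have "\<dots> \<le> (ca * (diameter \<Omega> + Kb * (t - s))) * (diameter \<Omega> + Kb * (t - s))"
          by (intro mult_mono Bb elim ca0 norm_ge_zero mult_nonneg_nonneg mart_bound_nonneg st)
        finally show ?case by simp
      qed
      show "(\<lambda>w. (B w *v D w) \<bullet> D w) \<in> borel_measurable M"
        by (intro borel_measurable_inner mat_measurable(1) Dm BM)
    qed
    have D4i: "integrable M (\<lambda>w. norm (D w) ^ 4)" unfolding D_def by (rule mart_fourth(2)[OF s st(1)])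
    have D4: "expectation (\<lambda>w. norm (D w) ^ 4) / \<eta> \<le> (fourth_const * K ^ 4) * \<eta> ^ 3"
    proof -
      have "expectation (\<lambda>w. norm (D w) ^ 4) \<le> fourth_const * K ^ 4 * (\<eta>\<^sup>2)\<^sup>2"
        using mart_fourth(1)[OF s st(1)] unfolding D_def h .
      also have "(\<eta>\<^sup>2)\<^sup>2 = \<eta> ^ 3 * \<eta>" by algebra
      finally show ?thesis using \<eta>(1) by (simp add: divide_le_eq mult.assoc)
    qed
    let ?R = "\<lambda>w. V (Y s w) + (z w \<bullet> D w + z w \<bullet> b w + 1/2 * ((B w *v D w) \<bullet> D w) + k1 * \<eta> ^ 3 + k2 * (norm (D w) ^ 4 / \<eta>))"
    have Ri: "integrable M ?R"
      by (intro Bochner_Integration.integrable_add V_integrable s zDi zbi integrable_mult_right BDi integrable_divide D4i) simp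
    have "expectation (\<lambda>w. V (Y t w)) \<le> expectation ?R"
      by (rule integral_mono_AE[OF V_integrable[OF st(2)] Ri pw])
    also have "expectation ?R = expectation (\<lambda>w. V (Y s w)) + (expectation (\<lambda>w. z w \<bullet> D w) + expectation (\<lambda>w. z w \<bullet> b w)
        + 1/2 * expectation (\<lambda>w. (B w *v D w) \<bullet> D w) + k1 * \<eta> ^ 3 + k2 * (expectation (\<lambda>w. norm (D w) ^ 4) / \<eta>))"
      using V_integrable[OF s] zDi zbi BDi D4i by (simp add: prob_space)
    also have "\<dots> \<le> expectation (\<lambda>w. V (Y s w)) + ((\<integral>y. indicator {s<..t} (snd y) * U1 y \<partial>PP)
        + 1/2 * (\<integral>y. indicator {s<..t} (snd y) * U2 y \<partial>PP) + k1 * \<eta> ^ 3 + k2 * ((fourth_const * K ^ 4) * \<eta> ^ 3))"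
      unfolding zD zbE BDE using mult_left_mono[OF D4 k0(2)] by linarith
    finally have main: "expectation (\<lambda>w. V (Y t w)) \<le> expectation (\<lambda>w. V (Y s w)) + ((\<integral>y. indicator {s<..t} (snd y) * U1 y \<partial>PP)
        + 1/2 * (\<integral>y. indicator {s<..t} (snd y) * U2 y \<partial>PP) + k1 * \<eta> ^ 3 + k2 * ((fourth_const * K ^ 4) * \<eta> ^ 3))" .
    have "(\<integral>y. indicator {s<..t} (snd y) * U1 y \<partial>PP) + 1/2 * (\<integral>y. indicator {s<..t} (snd y) * U2 y \<partial>PP) + running s t
      = (\<integral>y. indicator {s<..t} (snd y) * U1 y + 1/2 * (indicator {s<..t} (snd y) * U2 y) + indicator {s<..t} (snd y) * U3 y \<partial>PP)"
      unfolding running_def U3_def[symmetric] using i1 i2 i3 by simp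
    also have "\<dots> \<le> (\<integral>y. k3 * (indicator {s<..t} (snd y) * U4 y) \<partial>PP)"
    proof (rule integral_mono_AE)
      show "integrable PP (\<lambda>y. indicator {s<..t} (snd y) * U1 y + 1/2 * (indicator {s<..t} (snd y) * U2 y) + indicator {s<..t} (snd y) * U3 y)"
        by (intro Bochner_Integration.integrable_add integrable_mult_right i1 i2 i3)
      show "integrable PP (\<lambda>y. k3 * (indicator {s<..t} (snd y) * U4 y))" by (intro integrable_mult_right i4)
      show "AE y in PP. indicator {s<..t} (snd y) * U1 y + 1/2 * (indicator {s<..t} (snd y) * U2 y) + indicator {s<..t} (snd y) * U3 y
          \<le> k3 * (indicator {s<..t} (snd y) * U4 y)"
        using AE_PP_fst[OF AE_start]
      proof eventually_elim
        case (elim y)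
        define w r where "w = fst y" and "r = snd y"
        have w: "w \<in> space M" "X 0 w = x0" using elim by (auto simp: w_def)
        show ?case
        proof (cases "r \<in> {s<..t} \<and> alive r w = 1")
          case True
          then have r: "s < r" "r \<le> t" and ar: "alive r w = 1" by auto
          \<comment> \<open>The times before the hit form an initial segment, so s precedes the hit
            as well and Y agrees with X at both times.\<close>
          have as: "alive s w = 1" by (rule alive_mono[OF ar s]) (use r in simp)
          define p q where "p = X s w" and "q = X r w"
          have pq: "p \<in> \<Omega>" "q \<in> \<Omega>" "Y s w = p"
            using Y_in_\<Omega>[OF w s] Y_in_\<Omega>[OF w, of r] Y_alive[OF as] Y_alive[OF ar] s r by (auto simp: p_def q_def)
          have U: "U1 y = g p \<bullet> \<beta> q" "U2 y = cov_form S (A p ** \<sigma> q) (\<sigma> q)" "U3 y = l q"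
            using ar as by (auto simp: U1_def U2_def U3_def w_def[symmetric] r_def[symmetric] z_def B_def p_def q_def)
          have "norm (q - p) \<le> diameter \<Omega>"
            using diameter_bounded_bound[OF compact_imp_bounded[OF \<Omega>(1)] pq(2,1)] by (simp add: dist_norm)
          then have U4: "U4 y = norm (p - q)"
            using ar pq(3) by (simp add: U4_def w_def[symmetric] r_def[symmetric] q_def[symmetric] norm_minus_commute)
          have 1: "(g p - g q) \<bullet> \<beta> q \<le> L * Kb * norm (p - q)"
          proof -
            have "(g p - g q) \<bullet> \<beta> q \<le> norm (g p - g q) * norm (\<beta> q)" by (rule norm_cauchy_schwarz)
            also have "\<dots> \<le> (L * norm (p - q)) * Kb"
              by (intro mult_mono gL pq \<beta>_bound mult_nonneg_nonneg L0 norm_ge_zero)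
            finally show ?thesis by (simp add: mult_ac)
          qed
          have 2: "cov_form S ((A p - A q) ** \<sigma> q) (\<sigma> q) \<le> c0 * L * (K * K) * norm (p - q)"
          proof -
            have "cov_form S ((A p - A q) ** \<sigma> q) (\<sigma> q) \<le> c0 * norm (A p - A q) * (norm (\<sigma> q) * norm (\<sigma> q))"
              by (rule order_trans[OF abs_ge_self c0(2)])
            also have "\<dots> \<le> c0 * (L * norm (p - q)) * (K * K)"
              by (intro mult_mono mult_left_mono AL pq \<sigma>_bound c0(1) mult_nonneg_nonneg L0 K_nonneg norm_ge_zero)
            finally show ?thesis by (simp add: mult_ac)
          qed
          have aux: "u + v + 1/2 * (m + n) + e \<le> a + 1/2 * b"
            if "u + 1/2 * m \<le> - e" "v \<le> a" "n \<le> b" for u v m n e a b :: real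
            using that unfolding distrib_left by linarith
          \<comment> \<open>\<open>gen\<close> is used at the current point q; moving gradient and
            Hessian back to the starting point p costs the two Lipschitz errors.\<close>
          have e1: "g p \<bullet> \<beta> q = g q \<bullet> \<beta> q + (g p - g q) \<bullet> \<beta> q" by (simp add: inner_diff_left)
          have e2: "cov_form S (A p ** \<sigma> q) (\<sigma> q) = cov_form S (A q ** \<sigma> q) (\<sigma> q) + cov_form S ((A p - A q) ** \<sigma> q) (\<sigma> q)"
            unfolding cov_form_add_left[symmetric] matrix_mult_add_left[symmetric] by simp
          have "g p \<bullet> \<beta> q + 1/2 * cov_form S (A p ** \<sigma> q) (\<sigma> q) + l q \<le> L * Kb * norm (p - q) + 1/2 * (c0 * L * (K * K) * norm (p - q))"
            unfolding e1 e2 by (rule aux[OF gen[OF pq(2)] 1 2])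
          also have "\<dots> = k3 * norm (p - q)" by (simp add: k3_def distrib_right)
          finally show ?thesis using True unfolding U U4 r_def[symmetric] by simp
        next
          case False
          have "0 \<le> k3 * (indicator {s<..t} (snd y) * U4 y)"
            using k0(3) diameter_ge_0[OF compact_imp_bounded[OF \<Omega>(1)]] by (auto simp: U4_def)
          moreover have "indicator {s<..t} (snd y) * U1 y = 0" "indicator {s<..t} (snd y) * U2 y = 0" "indicator {s<..t} (snd y) * U3 y = 0"
            using False alive_01[of r w] by (auto simp: U1_def U2_def U3_def w_def r_def cov_form_def indicator_def)
          ultimately show ?thesis by (simp only: mult_zero_right add_0_right)
        qed
      qed
    qed
    also have "\<dots> = k3 * (\<integral>y. indicator {s<..t} (snd y) * U4 y \<partial>PP)" by simp
    also have "\<dots> \<le> k3 * (k4 * \<eta> * \<eta>\<^sup>2)"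
    proof (rule mult_left_mono[OF _ k0(3)])
      have i4': "integrable PP (\<lambda>(w, r). indicator {s<..t} r * U4 (w, r))" using i4 by (simp add: case_prod_unfold)
      \<comment> \<open>Time is moved to the outer integral: for fixed r the mean displacement is at
        most k4 \<eta>, and the interval has length \<eta>^2.\<close>
      have "(\<integral>y. indicator {s<..t} (snd y) * U4 y \<partial>PP) = (\<integral>r. (\<integral>w. indicator {s<..t} r * U4 (w, r) \<partial>M) \<partial>lborel)"
        using PP.integral_snd[OF i4'] by (simp add: case_prod_unfold)
      also have "\<dots> \<le> (\<integral>r. k4 * \<eta> * indicator {s<..t} r \<partial>lborel)"
      proof (rule integral_mono)
        show "integrable lborel (\<lambda>r. \<integral>w. indicator {s<..t} r * U4 (w, r) \<partial>M)" using PP.integrable_snd[OF i4'] .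
        show "integrable lborel (\<lambda>r. k4 * \<eta> * indicat_real {s<..t} r)"
          by (intro integrable_mult_right integrable_real_indicator emeasure_bounded_finite) auto
        fix r
        show "(\<integral>w. indicator {s<..t} r * U4 (w, r) \<partial>M) \<le> k4 * \<eta> * indicator {s<..t} r"
        proof (cases "r \<in> {s<..t}")
          case True
          then have sr: "s \<le> r" and rs: "r - s \<le> \<eta>\<^sup>2" using h by auto
          have U4Y: "U4 (w, r) \<le> norm (Y r w - Y s w)" for w
            unfolding U4_def by (rule min.coboundedI2) (use alive_01[of r w] Y_alive[of r w] in auto)
          have "(\<integral>w. U4 (w, r) \<partial>M) \<le> expectation (\<lambda>w. norm (Y r w - Y s w))"
          proof (rule integral_mono_AE')
            show "integrable M (\<lambda>w. norm (Y r w - Y s w))" by (rule Y_diff_mean(2)[OF s sr \<eta> rs])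
            show "AE w in M. U4 (w, r) \<le> norm (Y r w - Y s w)" by (intro AE_I2 U4Y)
            show "AE w in M. 0 \<le> norm (Y r w - Y s w)" by simp
          qed
          also have "\<dots> \<le> k4 * \<eta>" unfolding k4_def by (rule Y_diff_mean(1)[OF s sr \<eta> rs])
          finally show ?thesis using True by simp
        qed simp
      qed
      also have "\<dots> = k4 * \<eta> * \<eta>\<^sup>2" using st h by simp
      finally show "(\<integral>y. indicator {s<..t} (snd y) * U4 y \<partial>PP) \<le> k4 * \<eta> * \<eta>\<^sup>2" .
    qed
    also have "\<dots> = k3 * k4 * \<eta> ^ 3" by (simp add: power2_eq_square power3_eq_cube)
    finally have "(\<integral>y. indicator {s<..t} (snd y) * U1 y \<partial>PP) + 1/2 * (\<integral>y. indicator {s<..t} (snd y) * U2 y \<partial>PP) + running s t \<le> k3 * k4 * \<eta> ^ 3" .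
    moreover have "k * \<eta> ^ 3 = k1 * \<eta> ^ 3 + k2 * ((fourth_const * K ^ 4) * \<eta> ^ 3) + k3 * k4 * \<eta> ^ 3"
      by (simp add: k_def algebra_simps)
    ultimately show ?thesis using main by linarith
  qed
  moreover have "0 \<le> k" using k0 fc K_nonneg by (simp add: k_def)
  ultimately show ?thesis using that by blast
qed

section \<open>Summation over the steps and infinite time horizon\<close>

lemma running_add:
  assumes "r \<le> s" "s \<le> t"
  shows "running r t = running r s + running s t"
proof -
  have "running r s + running s t = (\<integral>z. indicator {r<..s} (snd z) * (alive (snd z) (fst z) *\<^sub>R l (X (snd z) (fst z)))
      + indicator {s<..t} (snd z) * (alive (snd z) (fst z) *\<^sub>R l (X (snd z) (fst z))) \<partial>PP)"
    unfolding running_def by (rule Bochner_Integration.integral_add[symmetric]) (rule running_integrable)+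
  also have "\<dots> = running r t"
    unfolding running_def using assms by (intro Bochner_Integration.integral_cong refl) (auto simp: indicator_def)
  finally show ?thesis by simp
qed

lemma dynkin_le:
  assumes t: "0 < t"
  shows "expectation (\<lambda>w. V (Y t w)) + running 0 t \<le> V x0"
proof -
  obtain k where k: "0 \<le> k" "\<And>s t \<eta>. 0 \<le> s \<Longrightarrow> 0 < \<eta> \<Longrightarrow> \<eta> \<le> 1 \<Longrightarrow> t = s + \<eta>\<^sup>2 \<Longrightarrow>
    expectation (\<lambda>w. V (Y t w)) + running s t \<le> expectation (\<lambda>w. V (Y s w)) + k * \<eta> ^ 3"
    by (rule generator_step) blast
  have V0: "expectation (\<lambda>w. V (Y 0 w)) = V x0"
  proof -
    have "expectation (\<lambda>w. V (Y 0 w)) = expectation (\<lambda>w. V x0)"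
    proof (rule integral_cong_AE)
      show "AE w in M. V (Y 0 w) = V x0" using X_0 by eventually_elim (simp add: Y_0)
      show "(\<lambda>w. V (Y 0 w)) \<in> borel_measurable M" by (rule measurable_compose[OF Y_measurable Vm]) simp
    qed simp
    then show ?thesis by (simp add: prob_space)
  qed
  have bound: "expectation (\<lambda>w. V (Y t w)) + running 0 t \<le> V x0 + k * t * sqrt (t / real n)" if n: "0 < n" "t \<le> real n" for n
  proof -
    \<comment> \<open>The condition t \<le> n makes \<eta> at most 1, as
      \<open>generator_step\<close> requires.\<close>
    define \<eta> where "\<eta> = sqrt (t / real n)"
    have \<eta>2: "\<eta>\<^sup>2 = t / real n" using t n by (simp add: \<eta>_def)
    have \<eta>: "0 < \<eta>" "\<eta> \<le> 1" using t n by (auto simp: \<eta>_def)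
    have "expectation (\<lambda>w. V (Y (real i * \<eta>\<^sup>2) w)) + running 0 (real i * \<eta>\<^sup>2) \<le> V x0 + real i * (k * \<eta> ^ 3)" for i
    proof (induction i)
      case 0
      have "running 0 0 = 0" by (simp add: running_def)
      then show ?case by (simp add: V0)
    next
      case (Suc i)
      have e: "real (Suc i) * \<eta>\<^sup>2 = real i * \<eta>\<^sup>2 + \<eta>\<^sup>2" by (simp add: distrib_right)
      have "running 0 (real (Suc i) * \<eta>\<^sup>2) = running 0 (real i * \<eta>\<^sup>2) + running (real i * \<eta>\<^sup>2) (real (Suc i) * \<eta>\<^sup>2)"
        by (rule running_add) (simp_all add: e del: of_nat_Suc)
      moreover have "expectation (\<lambda>w. V (Y (real (Suc i) * \<eta>\<^sup>2) w)) + running (real i * \<eta>\<^sup>2) (real (Suc i) * \<eta>\<^sup>2)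
          \<le> expectation (\<lambda>w. V (Y (real i * \<eta>\<^sup>2) w)) + k * \<eta> ^ 3"
        by (rule k(2)[OF _ \<eta> e]) simp
      moreover have "real (Suc i) * (k * \<eta> ^ 3) = real i * (k * \<eta> ^ 3) + k * \<eta> ^ 3" by (simp add: distrib_right)
      ultimately show ?case using Suc by linarith
    qed
    from this[of n] have "expectation (\<lambda>w. V (Y t w)) + running 0 t \<le> V x0 + real n * (k * \<eta> ^ 3)"
      unfolding \<eta>2 using n by simp
    \<comment> \<open>n errors of size \<eta>^3 add up to t \<eta>, because n \<eta>^2 = t.\<close>
    moreover have "real n * (k * \<eta> ^ 3) = k * (real n * \<eta>\<^sup>2) * \<eta>" by (simp add: power2_eq_square power3_eq_cube)
    moreover have "real n * \<eta>\<^sup>2 = t" unfolding \<eta>2 using n by simp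
    ultimately show ?thesis unfolding \<eta>_def by simp
  qed
  have "(\<lambda>n. sqrt (t / real n)) \<longlonglongrightarrow> sqrt 0" by (intro tendsto_real_sqrt lim_const_over_n)
  then have "(\<lambda>n. V x0 + k * t * sqrt (t / real n)) \<longlonglongrightarrow> V x0 + k * t * 0"
    by (intro tendsto_add tendsto_mult tendsto_const) simp
  then have lim: "(\<lambda>n. V x0 + k * t * sqrt (t / real n)) \<longlonglongrightarrow> V x0" by simp
  show ?thesis
  proof (rule LIMSEQ_le_const[OF lim], intro exI allI impI)
    fix n assume "max 1 (nat \<lceil>t\<rceil>) \<le> n"
    then show "expectation (\<lambda>w. V (Y t w)) + running 0 t \<le> V x0 + k * t * sqrt (t / real n)"
      using t by (intro bound) linarith+
  qed
qed

lemma cost_le: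
  fixes \<phi> :: "real^'n \<Rightarrow> real"
  assumes \<phi>m [measurable]: "\<phi> \<in> borel_measurable borel" and \<phi>V: "\<And>x. x \<in> bdry \<Omega> \<Longrightarrow> \<phi> x \<le> V x"
    and V0: "\<And>x. x \<in> \<Omega> \<Longrightarrow> 0 \<le> V x"
  shows "(\<integral>\<^sup>+w. ((if T w < \<infinity> then ennreal (\<phi> (X (real_of_ereal (T w)) w)) else 0)
      + (\<integral>\<^sup>+r. ennreal (alive r w *\<^sub>R l (X r w)) \<partial>lborel)) \<partial>M) \<le> ennreal (V x0)"
proof -
  define f where "f y = alive (snd y) (fst y) *\<^sub>R l (X (snd y) (fst y))" for y :: "'w \<times> real"
  have f0: "0 \<le> f y" for y using l0 by (simp add: f_def alive_eq)
  have fm [measurable]: "f \<in> borel_measurable PP" unfolding f_def[abs_def] by (rule alive_X_measurable[OF lm])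
  define P where "P n w = (if T w \<le> ereal (real n) then ennreal (\<phi> (Y (real n) w)) else 0)" for n w
  define Q where "Q n w = (\<integral>\<^sup>+r. ennreal (indicator {0<..real n} r * f (w, r)) \<partial>lborel)" for n w
  have Pm [measurable]: "P n \<in> borel_measurable M" for n
    unfolding P_def[abs_def] using Y_measurable[of "real n"] by measurable
  have Qm [measurable]: "Q n \<in> borel_measurable M" for n
    unfolding Q_def[abs_def] by measurable
  have bound: "(\<integral>\<^sup>+w. P n w + Q n w \<partial>M) \<le> ennreal (V x0)" if n: "0 < n" for n
  proof -
    have "(\<integral>\<^sup>+w. P n w \<partial>M) \<le> (\<integral>\<^sup>+w. ennreal (V (Y (real n) w)) \<partial>M)"
    proof (rule nn_integral_mono_AE)
      show "AE w in M. P n w \<le> ennreal (V (Y (real n) w))"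
        using AE_start
      proof eventually_elim
        case (elim w)
        show ?case
        proof (cases "T w \<le> ereal (real n)")
          case True
          then have "T w < \<infinity>" by (rule le_less_trans) simp
          from hit_attained[OF _ this] elim obtain z where z: "0 \<le> z" "T w = ereal z" "X z w \<in> bdry \<Omega>" by blast
          have "min (ereal (real n)) (T w) = ereal z" using True z(2) by (simp add: min_def)
          then have "Y (real n) w \<in> bdry \<Omega>" using z(3) by (simp add: Y_def)
          from \<phi>V[OF this] show ?thesis by (simp add: P_def ennreal_leI)
        qed (simp add: P_def)
      qed
    qed
    also have "\<dots> = ennreal (expectation (\<lambda>w. V (Y (real n) w)))"
    proof (rule nn_integral_eq_integral)
      show "integrable M (\<lambda>w. V (Y (real n) w))" by (rule V_integrable) simp
      show "AE w in M. 0 \<le> V (Y (real n) w)"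
        using AE_start by eventually_elim (simp add: V0 Y_in_\<Omega>)
    qed
    finally have 1: "(\<integral>\<^sup>+w. P n w \<partial>M) \<le> ennreal (expectation (\<lambda>w. V (Y (real n) w)))" .
    have "(\<integral>\<^sup>+w. Q n w \<partial>M) = (\<integral>\<^sup>+y. ennreal (indicator {0<..real n} (snd y) * f y) \<partial>PP)"
      unfolding Q_def by (subst lborel.nn_integral_fst[symmetric]) simp_all
    also have "\<dots> = ennreal (running 0 (real n))"
      unfolding running_def f_def[symmetric]
    proof (rule nn_integral_eq_integral)
      show "integrable PP (\<lambda>y. indicator {0<..real n} (snd y) * f y)" unfolding f_def by (rule running_integrable)
      show "AE y in PP. 0 \<le> indicat_real {0<..real n} (snd y) * f y" by (intro AE_I2 mult_nonneg_nonneg f0) simp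
    qed
    finally have 2: "(\<integral>\<^sup>+w. Q n w \<partial>M) = ennreal (running 0 (real n))" .
    have r0: "0 \<le> running 0 (real n)"
      unfolding running_def f_def[symmetric] by (intro integral_nonneg_AE AE_I2 mult_nonneg_nonneg f0) simp
    have e0: "0 \<le> expectation (\<lambda>w. V (Y (real n) w))"
    proof (rule integral_nonneg_AE)
      show "AE w in M. 0 \<le> V (Y (real n) w)"
        using AE_start by eventually_elim (simp add: V0 Y_in_\<Omega>)
    qed
    have "(\<integral>\<^sup>+w. P n w + Q n w \<partial>M) = (\<integral>\<^sup>+w. P n w \<partial>M) + (\<integral>\<^sup>+w. Q n w \<partial>M)"
      by (rule nn_integral_add) measurable
    also have "\<dots> \<le> ennreal (expectation (\<lambda>w. V (Y (real n) w))) + ennreal (running 0 (real n))"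
      unfolding 2 by (intro add_right_mono 1)
    also have "\<dots> = ennreal (expectation (\<lambda>w. V (Y (real n) w)) + running 0 (real n))"
      using e0 r0 by simp
    also have "\<dots> \<le> ennreal (V x0)"
      by (intro ennreal_leI dynkin_le) (use n in simp)
    finally show ?thesis .
  qed
  have incP: "incseq (\<lambda>n. P n w)" for w
  proof (rule incseq_SucI)
    fix n
    show "P n w \<le> P (Suc n) w"
    proof (cases "T w \<le> ereal (real n)")
      case True
      then have "T w \<le> ereal (real (Suc n))" by (rule order_trans) simp
      with True show ?thesis by (simp add: P_def Y_def min_absorb2)
    qed (simp add: P_def)
  qed
  have incQ: "incseq (\<lambda>n. Q n w)" for w
    unfolding Q_def
    by (intro incseq_SucI nn_integral_mono ennreal_leI mult_right_mono f0) (auto simp: indicator_def)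
  have "(\<integral>\<^sup>+w. ((if T w < \<infinity> then ennreal (\<phi> (X (real_of_ereal (T w)) w)) else 0)
      + (\<integral>\<^sup>+r. ennreal (alive r w *\<^sub>R l (X r w)) \<partial>lborel)) \<partial>M) \<le> (\<integral>\<^sup>+w. (SUP n. P n w + Q n w) \<partial>M)"
  proof (rule nn_integral_mono)
    fix w assume w: "w \<in> space M"
    have PQ: "(SUP n. P n w) + (SUP n. Q n w) = (SUP n. P n w + Q n w)"
      by (rule ennreal_SUP_add[OF incP incQ, symmetric])
    have "(if T w < \<infinity> then ennreal (\<phi> (X (real_of_ereal (T w)) w)) else 0) \<le> (SUP n. P n w)"
    proof (cases "T w < \<infinity>")
      case True
      from hit_attained[OF w this] obtain z where z: "T w = ereal z" by blast
      obtain n where "z \<le> real n" using real_arch_simple by blast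
      then have "P n w = ennreal (\<phi> (X (real_of_ereal (T w)) w))"
        using z by (simp add: P_def Y_def min_def)
      moreover have "P n w \<le> (SUP n. P n w)" by (rule SUP_upper) simp
      ultimately show ?thesis using True by simp
    qed simp
    moreover have "(\<integral>\<^sup>+r. ennreal (alive r w *\<^sub>R l (X r w)) \<partial>lborel) \<le> (SUP n. Q n w)"
    proof -
      have fw: "(\<lambda>r. f (w, r)) \<in> borel_measurable lborel"
        using measurable_compose[OF measurable_Pair1'[OF w, of lborel] fm] by simp
      have "(SUP n. Q n w) = (\<integral>\<^sup>+r. (SUP n. ennreal (indicator {0<..real n} r * f (w, r))) \<partial>lborel)"
        unfolding Q_def
      proof (rule nn_integral_monotone_convergence_SUP[symmetric])
        show "incseq (\<lambda>n r. ennreal (indicator {0<..real n} r * f (w, r)))"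
          by (intro incseq_SucI le_funI ennreal_leI mult_right_mono f0) (auto simp: indicator_def)
        show "(\<lambda>r. ennreal (indicator {0<..real n} r * f (w, r))) \<in> borel_measurable lborel" for n
          using fw by measurable
      qed
      moreover have "(\<integral>\<^sup>+r. ennreal (alive r w *\<^sub>R l (X r w)) \<partial>lborel) \<le> (\<integral>\<^sup>+r. (SUP n. ennreal (indicator {0<..real n} r * f (w, r))) \<partial>lborel)"
      proof (rule nn_integral_mono_AE)
        \<comment> \<open>\<open>Q n\<close> integrates over a half-open interval without its left
          end, so time 0 is removed as a null set.\<close>
        have "AE r in lborel. r \<noteq> (0::real)" by (rule AE_lborel_singleton)
        then show "AE r in lborel. ennreal (alive r w *\<^sub>R l (X r w)) \<le> (SUP n. ennreal (indicator {0<..real n} r * f (w, r)))"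
        proof eventually_elim
          case (elim r)
          show ?case
          proof (cases "0 < r")
            case True
            obtain n where "r \<le> real n" using real_arch_simple by blast
            then have "ennreal (alive r w *\<^sub>R l (X r w)) = ennreal (indicator {0<..real n} r * f (w, r))"
              using True by (simp add: f_def)
            also have "\<dots> \<le> (SUP n. ennreal (indicator {0<..real n} r * f (w, r)))"
              by (rule SUP_upper) simp
            finally show ?thesis .
          next
            case False
            then have "alive r w = 0" using elim by (simp add: alive_eq)
            then show ?thesis by simp
          qed
        qed
      qed
      ultimately show ?thesis by simp
    qed
    ultimately show "(if T w < \<infinity> then ennreal (\<phi> (X (real_of_ereal (T w)) w)) else 0)
      + (\<integral>\<^sup>+r. ennreal (alive r w *\<^sub>R l (X r w)) \<partial>lborel) \<le> (SUP n. P n w + Q n w)"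
      unfolding PQ[symmetric] by (rule add_mono)
  qed
  also have "\<dots> = (SUP n. \<integral>\<^sup>+w. P n w + Q n w \<partial>M)"
  proof (rule nn_integral_monotone_convergence_SUP)
    show "incseq (\<lambda>n w. P n w + Q n w)"
      using incP incQ by (auto simp: incseq_def le_fun_def intro!: add_mono)
  qed measurable
  also have "\<dots> \<le> ennreal (V x0)"
  proof (rule SUP_least)
    fix n
    \<comment> \<open>\<open>bound\<close> holds for positive n only, since \<open>dynkin_le\<close>
      needs a positive time; passing to Suc n also covers n = 0.\<close>
    have "(\<integral>\<^sup>+w. P n w + Q n w \<partial>M) \<le> (\<integral>\<^sup>+w. P (Suc n) w + Q (Suc n) w \<partial>M)"
      by (intro nn_integral_mono add_mono incseq_SucD[OF incP] incseq_SucD[OF incQ])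
    also have "\<dots> \<le> ennreal (V x0)" by (rule bound) simp
    finally show "(\<integral>\<^sup>+w. P n w + Q n w \<partial>M) \<le> ennreal (V x0)" .
  qed
  finally show ?thesis .
qed

end

end

section \<open>Comparison and feedback cost\<close>

text \<open>Off \<open>bdry\<close> a point of \<Omega> is interior, so an extremum over \<Omega> is
  also a local one in the punctured neighbourhoods that test functions refer to.\<close>

lemma interior_max_eventually:
  assumes "x \<in> \<Omega> - bdry \<Omega>" "\<And>y. y \<in> \<Omega> \<Longrightarrow> P y"
  shows "\<forall>\<^sub>F y in at x. P y"
proof -
  have "x \<in> interior \<Omega>"
    using assms(1) closure_subset[of \<Omega>] by (auto simp: bdry_def frontier_def)
  then have "\<forall>\<^sub>F y in at x. y \<in> interior \<Omega> - {x}"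
    by (intro eventually_at_in_open open_interior)
  then show ?thesis by (rule eventually_mono) (use assms(2) interior_subset[of \<Omega>] in auto)
qed

text \<open>
  The comparison functions are smooth, so they serve as test functions at the extremum of the
  difference; the strictly positive zeroth-order coefficient gives the contradiction.
\<close>

lemma subsolution_le_poly:
  fixes \<Omega> :: "(real^'n) set"
  assumes \<Omega>: "compact \<Omega>" and U: "continuous_on \<Omega> U"
    and sub: "viscosity_subsolution (\<Omega> - bdry \<Omega>) (linear_op q f B S lam) U"
    and P: "real_polynomial_function P" "\<And>x. x \<in> \<Omega> \<Longrightarrow> 0 \<le> 1 / lam * q x * P x - gen_L f B S P x"
    and q: "\<And>x. x \<in> \<Omega> - {0} \<Longrightarrow> 0 < q x" and "0 < lam"
    and bd: "\<And>x. x \<in> bdry \<Omega> \<Longrightarrow> U x \<le> P x" and x: "x \<in> \<Omega>"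
  shows "U x \<le> P x"
proof (rule ccontr)
  assume neg: "\<not> U x \<le> P x"
  have "continuous_on \<Omega> (\<lambda>y. U y - P y)" by (intro continuous_on_diff U poly_continuous_on P)
  then obtain z where z: "z \<in> \<Omega>" "\<And>y. y \<in> \<Omega> \<Longrightarrow> U y - P y \<le> U z - P z"
    using continuous_attains_sup[OF \<Omega>, of "\<lambda>y. U y - P y"] x by blast
  have pos: "P z < U z" using z(2)[OF x] neg by simp
  then have zD: "z \<in> \<Omega> - bdry \<Omega>" using bd[of z] z(1) by force
  \<comment> \<open>The origin counts as a boundary point, so the extremum lies where q is strictly
    positive.\<close>
  then have "z \<noteq> 0" by (auto simp: bdry_def)
  with q z(1) have qz: "0 < q z" by simp
  have "\<forall>\<^sub>F y in at z. U y - P y \<le> U z - P z" by (rule interior_max_eventually[OF zD z(2)])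
  with sub zD have "linear_op q f B S lam z (U z) (grad P z) (hess P z) \<le> 0"
    using poly_C2_on[OF P(1)] unfolding viscosity_subsolution_def by blast
  then have "1 / lam * q z * U z \<le> gen_L f B S P z" by (simp add: linear_op_def gen_L_def)
  also have "\<dots> \<le> 1 / lam * q z * P z" using P(2)[OF z(1)] by simp
  finally have le: "1 / lam * q z * U z \<le> 1 / lam * q z * P z" .
  have c: "0 < 1 / lam * q z" using qz \<open>0 < lam\<close> by simp
  from le pos show False unfolding mult_le_cancel_left_pos[OF c] by simp
qed

lemma poly_le_supersolution:
  fixes \<Omega> :: "(real^'n) set"
  assumes \<Omega>: "compact \<Omega>" and U: "continuous_on \<Omega> U"
    and sup: "viscosity_supersolution (\<Omega> - bdry \<Omega>) (linear_op q f B S lam) U"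
    and P: "real_polynomial_function P" "\<And>x. x \<in> \<Omega> \<Longrightarrow> 1 / lam * q x * P x - gen_L f B S P x \<le> 0"
    and q: "\<And>x. x \<in> \<Omega> - {0} \<Longrightarrow> 0 < q x" and "0 < lam"
    and bd: "\<And>x. x \<in> bdry \<Omega> \<Longrightarrow> P x \<le> U x" and x: "x \<in> \<Omega>"
  shows "P x \<le> U x"
proof (rule ccontr)
  assume neg: "\<not> P x \<le> U x"
  have "continuous_on \<Omega> (\<lambda>y. U y - P y)" by (intro continuous_on_diff U poly_continuous_on P)
  then obtain z where z: "z \<in> \<Omega>" "\<And>y. y \<in> \<Omega> \<Longrightarrow> U z - P z \<le> U y - P y"
    using continuous_attains_inf[OF \<Omega>, of "\<lambda>y. U y - P y"] x by blast
  have pos: "U z < P z" using z(2)[OF x] neg by simp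
  then have zD: "z \<in> \<Omega> - bdry \<Omega>" using bd[of z] z(1) by force
  then have "z \<noteq> 0" by (auto simp: bdry_def)
  with q z(1) have qz: "0 < q z" by simp
  have "\<forall>\<^sub>F y in at z. U z - P z \<le> U y - P y" by (rule interior_max_eventually[OF zD z(2)])
  with sup zD have "0 \<le> linear_op q f B S lam z (U z) (grad P z) (hess P z)"
    using poly_C2_on[OF P(1)] unfolding viscosity_supersolution_def by blast
  then have "gen_L f B S P z \<le> 1 / lam * q z * U z" by (simp add: linear_op_def gen_L_def)
  with P(2)[OF z(1)] have le: "1 / lam * q z * P z \<le> 1 / lam * q z * U z" by linarith
  have c: "0 < 1 / lam * q z" using qz \<open>0 < lam\<close> by simp
  from le pos show False unfolding mult_le_cancel_left_pos[OF c] by simp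
qed

text \<open>A path starts at x, and hence stays in \<Omega>, only almost surely. With cut-off
  coefficients the integrand and the integral therefore change on a null set, which leaves both L2
  distances to the approximants as they were.\<close>

lemma (in brownian_basis) ito_limit_cong_AE:
  assumes ito: "ito_integral M F W t H' I'" and I: "I \<in> borel_measurable M"
    and eqI: "AE w in M. I w = I' w" and eqH: "AE w in M. \<forall>s. H s w = H' s w"
  shows "ito_limit t H I"
proof -
  obtain k \<tau> \<xi> where el: "\<forall>j. elementary F t (k j) (\<tau> j) (\<xi> j)" and
    a: "(\<lambda>j. \<integral>\<^sup>+w. (\<integral>\<^sup>+s\<in>{0..t}. ennreal ((norm (elem_process (k j) (\<tau> j) (\<xi> j) s w - H' s w))\<^sup>2) \<partial>lborel) \<partial>M) \<longlonglongrightarrow> 0" and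
    b: "(\<lambda>j. \<integral>\<^sup>+w. ennreal ((norm (elem_integral W (k j) (\<tau> j) (\<xi> j) w - I' w))\<^sup>2) \<partial>M) \<longlonglongrightarrow> 0"
    using ito unfolding ito_integral_def by (elim exE conjE) (rule that)
  have "(\<integral>\<^sup>+w. (\<integral>\<^sup>+s\<in>{0..t}. ennreal ((norm (elem_process (k j) (\<tau> j) (\<xi> j) s w - H s w))\<^sup>2) \<partial>lborel) \<partial>M)
    = (\<integral>\<^sup>+w. (\<integral>\<^sup>+s\<in>{0..t}. ennreal ((norm (elem_process (k j) (\<tau> j) (\<xi> j) s w - H' s w))\<^sup>2) \<partial>lborel) \<partial>M)" for j
    by (rule nn_integral_cong_AE) (use eqH in eventually_elim, simp)
  moreover have "(\<integral>\<^sup>+w. ennreal ((norm (elem_integral W (k j) (\<tau> j) (\<xi> j) w - I w))\<^sup>2) \<partial>M)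
    = (\<integral>\<^sup>+w. ennreal ((norm (elem_integral W (k j) (\<tau> j) (\<xi> j) w - I' w))\<^sup>2) \<partial>M)" for j
    by (rule nn_integral_cong_AE) (use eqI in eventually_elim, simp)
  ultimately show ?thesis
    using el a b I unfolding ito_limit_def by (intro conjI exI[of _ k] exI[of _ \<tau>] exI[of _ \<xi>]) simp_all
qed

text \<open>Polynomial coefficients are bounded on the compact \<Omega> only, and the fields built
  from ln \<Psi> are controlled only there. Extension by 0 makes them bounded Borel functions on the
  whole space, at the price of continuity across the frontier.\<close>

definition cutoff :: "'a set \<Rightarrow> ('a \<Rightarrow> 'b::real_normed_vector) \<Rightarrow> 'a \<Rightarrow> 'b" where
  "cutoff \<Omega> h x = indicator \<Omega> x *\<^sub>R h x"

lemma cutoff_in [simp]: "x \<in> \<Omega> \<Longrightarrow> cutoff \<Omega> h x = h x"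
  by (simp add: cutoff_def)

lemma cutoff_measurable:
  fixes h :: "'a::euclidean_space \<Rightarrow> 'b::euclidean_space"
  assumes "compact \<Omega>" "continuous_on \<Omega> h"
  shows "cutoff \<Omega> h \<in> borel_measurable borel"
  unfolding cutoff_def[abs_def]
  using assms by (intro borel_measurable_continuous_on_indicator borel_closed compact_imp_closed)

lemma cutoff_bound:
  fixes h :: "'a::euclidean_space \<Rightarrow> 'b::euclidean_space"
  assumes "compact \<Omega>" "continuous_on \<Omega> h"
  obtains c where "0 < c" "\<And>x. norm (cutoff \<Omega> h x) \<le> c"
proof -
  obtain c where c: "0 < c" "\<And>x. x \<in> \<Omega> \<Longrightarrow> norm (h x) \<le> c"
    by (rule compact_bound[OF assms]) blast
  have "norm (cutoff \<Omega> h x) \<le> c" for x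
    using c by (cases "x \<in> \<Omega>") (auto simp: cutoff_def)
  with c(1) show ?thesis by (rule that)
qed

lemma continuous_on_matrix_vector:
  assumes "continuous_on A (\<lambda>x. M x :: real^'m^'n)" "continuous_on A v"
  shows "continuous_on A (\<lambda>x. M x *v v x)"
proof -
  have "continuous_on UNIV (\<lambda>y :: (real^'m^'n) \<times> (real^'m). fst y *v snd y)"
    unfolding matrix_vector_mult_def by (intro continuous_intros)
  from continuous_on_compose2[OF this continuous_on_Pair[OF assms]] show ?thesis by simp
qed

lemma poly_matrix_continuous_on:
  assumes "\<And>i j. real_polynomial_function (\<lambda>x. G x $ i $ j)"
  shows "continuous_on A (G :: real^'n \<Rightarrow> real^'m^'k)"
proof -
  have "continuous_on A (\<lambda>x. \<chi> i j. G x $ i $ j)"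
    by (intro continuous_on_vec_lambda poly_continuous_on assms)
  then show ?thesis by (simp only: vec_lambda_eta)
qed

lemma poly_vector_continuous_on:
  assumes "\<And>i. real_polynomial_function (\<lambda>x. f x $ i)"
  shows "continuous_on A (f :: real^'n \<Rightarrow> real^'k)"
proof -
  have "continuous_on A (\<lambda>x. \<chi> i. f x $ i)"
    by (intro continuous_on_vec_lambda poly_continuous_on assms)
  then show ?thesis by (simp only: vec_lambda_eta)
qed

text \<open>Under feedback the state is a diffusion with drift b and running cost l. As long as it
  runs it lies in \<Omega>, where the cut-off fields are the true ones, so \<open>cost_le\<close>
  applies to the cut-off fields and still speaks of the original cost.\<close>

lemma feedback_cost_le:
  fixes \<Omega> :: "(real^'n) set" and G :: "real^'n \<Rightarrow> real^'m^'n" and B :: "real^'n \<Rightarrow> real^'l^'n"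
    and M :: "'w measure"
  assumes basis: "prob_space M" "filtration (space M) F" "\<And>t. subalgebra M (F t)"
    and S: "positive_semidefinite S" and W: "brownian_motion M F S W"
    and \<Omega>: "compact \<Omega>" "0 \<in> \<Omega>" "x \<in> \<Omega>"
    and f: "\<And>i. real_polynomial_function (\<lambda>x. f x $ i)"
    and G: "\<And>i j. real_polynomial_function (\<lambda>x. G x $ i $ j)"
    and B: "\<And>i j. real_polynomial_function (\<lambda>x. B x $ i $ j)"
    and R: "positive_definite R" and lam: "0 < lam"
    and cov: "\<And>x. x \<in> \<Omega> \<Longrightarrow> lam *\<^sub>R (G x ** matrix_inv R ** transpose (G x)) = noise_cov B S x"
    and q: "real_polynomial_function q" "\<And>x. x \<in> \<Omega> \<Longrightarrow> 0 \<le> q x"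
    and \<phi>: "real_polynomial_function \<phi>" "\<And>x. x \<in> bdry \<Omega> \<Longrightarrow> \<phi> x \<le> - lam * ln (\<Psi> x)"
    and \<Psi>: "real_polynomial_function \<Psi>" "\<And>x. x \<in> \<Omega> \<Longrightarrow> 0 < \<Psi> x" "\<And>x. x \<in> \<Omega> \<Longrightarrow> \<Psi> x \<le> 1"
      "\<And>x. x \<in> \<Omega> \<Longrightarrow> 1 / lam * q x * \<Psi> x - gen_L f B S \<Psi> x \<le> 0"
    and sde: "sde_solution M F W \<Omega> f G B x (\<lambda>s w. feedback G R (\<lambda>x. - lam * ln (\<Psi> x)) (X s w)) X"
  shows "expected_cost M \<Omega> \<phi> q R (\<lambda>s w. feedback G R (\<lambda>x. - lam * ln (\<Psi> x)) (X s w)) X \<le> ennreal (- lam * ln (\<Psi> x))"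
proof -
  define V where "V x = - lam * ln (\<Psi> x)" for x
  define u where "u x = - (matrix_inv R *v (transpose (G x) *v log_grad lam \<Psi> x))" for x
  define b where "b x = f x + G x *v u x" for x
  define l where "l x = q x + 1/2 * (u x \<bullet> (R *v u x))" for x
  \<comment> \<open>Positivity of \<Psi> at the point identifies the gradient in
    \<open>feedback\<close> with the closed form \<open>log_grad\<close>.\<close>
  have fb: "feedback G R (\<lambda>x. - lam * ln (\<Psi> x)) y = u y" if "y \<in> \<Omega>" for y
    using grad_neg_log[OF \<Psi>(1) \<Psi>(2)[OF that]] by (simp add: feedback_def u_def)
  have pos: "\<forall>x\<in>\<Omega>. 0 < \<Psi> x" using \<Psi>(2) by blast
  have lg: "\<exists>L. L-lipschitz_on \<Omega> (log_grad lam \<Psi>)" and lh: "\<exists>L. L-lipschitz_on \<Omega> (log_hess lam \<Psi>)"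
    by (rule log_grad_lipschitz[OF \<Omega>(1) \<Psi>(1) pos])+
  have cg: "continuous_on \<Omega> (log_grad lam \<Psi>)" and ch: "continuous_on \<Omega> (log_hess lam \<Psi>)"
    using lg lh lipschitz_on_continuous_on by blast+
  have cV: "continuous_on \<Omega> V"
    unfolding V_def[abs_def] using \<Psi>(2)
    by (intro continuous_intros poly_continuous_on \<Psi>(1)) force
  have cG: "continuous_on \<Omega> G" and cB: "continuous_on \<Omega> B" and cf: "continuous_on \<Omega> f"
    by (intro poly_matrix_continuous_on G B poly_vector_continuous_on f)+
  have cGt: "continuous_on \<Omega> (\<lambda>x. transpose (G x))"
    by (rule poly_matrix_continuous_on) (simp add: transpose_def G)
  have cu: "continuous_on \<Omega> u"
    unfolding u_def[abs_def]
    by (intro continuous_on_minus continuous_on_matrix_vector continuous_on_const cGt cg)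
  have cb: "continuous_on \<Omega> b"
    unfolding b_def[abs_def] by (intro continuous_on_add cf continuous_on_matrix_vector cG cu)
  have cl: "continuous_on \<Omega> l"
    unfolding l_def[abs_def]
    by (intro continuous_on_add poly_continuous_on q continuous_on_mult continuous_on_const continuous_on_inner
        cu continuous_on_matrix_vector)
  have sdeD: "\<And>t. 0 \<le> t \<Longrightarrow> X t \<in> borel_measurable (F t)" "\<And>w. w \<in> space M \<Longrightarrow> continuous_on {0..} (\<lambda>t. X t w)"
    "AE w in M. X 0 w = x"
    and sde_ito: "\<And>t. 0 \<le> t \<Longrightarrow> ito_integral M F W t (\<lambda>s w. indicator (before_hit (bdry \<Omega>) X w) s *\<^sub>R B (X s w))
          (\<lambda>w. X (real_of_ereal (min (ereal t) (hit_time (bdry \<Omega>) X w))) w - x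
             - (LINT s:{0..t} \<inter> before_hit (bdry \<Omega>) X w|lborel.
                  f (X s w) + G (X s w) *v feedback G R (\<lambda>x. - lam * ln (\<Psi> x)) (X s w)))"
    using sde unfolding sde_solution_def by blast+
  interpret stopped_path M F S W \<Omega> X x
    using basis S W \<Omega> sdeD
    by (simp add: stopped_path_def stopped_path_axioms_def brownian_basis_def brownian_basis_axioms_def)
  obtain Kb where Kb: "\<And>x. norm (cutoff \<Omega> b x) \<le> Kb" by (rule cutoff_bound[OF \<Omega>(1) cb]) blast
  obtain K where K: "\<And>x. norm (cutoff \<Omega> B x) \<le> K" by (rule cutoff_bound[OF \<Omega>(1) cB]) blast
  have alive_\<Omega>: "X r w \<in> \<Omega>" if "w \<in> space M \<and> X 0 w = x" "alive r w \<noteq> 0" for r w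
    using alive_in_\<Omega>[of w r] that by (auto simp: alive_eq split: if_splits)
  have ito: "ito_limit t (\<lambda>r w. alive r w *\<^sub>R cutoff \<Omega> B (X r w))
      (\<lambda>w. Y t w - x - (\<integral>r. indicator {0..t} r *\<^sub>R (alive r w *\<^sub>R cutoff \<Omega> b (X r w)) \<partial>lborel))" if t: "0 \<le> t" for t
  proof (rule ito_limit_cong_AE[OF sde_ito[OF t]])
    have "(\<lambda>y. indicator {0..t} (snd y) *\<^sub>R (alive (snd y) (fst y) *\<^sub>R cutoff \<Omega> b (X (snd y) (fst y)))) \<in> borel_measurable PP"
      using alive_X_measurable[OF cutoff_measurable[OF \<Omega>(1) cb]] by measurable
    then have "(\<lambda>w. \<integral>r. indicator {0..t} r *\<^sub>R (alive r w *\<^sub>R cutoff \<Omega> b (X r w)) \<partial>lborel) \<in> borel_measurable M"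
      by (intro lborel.borel_measurable_lebesgue_integral) (simp add: case_prod_unfold)
    then show "(\<lambda>w. Y t w - x - (\<integral>r. indicator {0..t} r *\<^sub>R (alive r w *\<^sub>R cutoff \<Omega> b (X r w)) \<partial>lborel)) \<in> borel_measurable M"
      using Y_measurable[OF t] by (intro borel_measurable_diff borel_measurable_const)
    show "AE w in M. \<forall>s. alive s w *\<^sub>R cutoff \<Omega> B (X s w) = indicator (before_hit (bdry \<Omega>) X w) s *\<^sub>R B (X s w)"
      using AE_start
    proof eventually_elim
      case (elim w)
      have "alive s w *\<^sub>R cutoff \<Omega> B (X s w) = alive s w *\<^sub>R B (X s w)" for s
        using alive_\<Omega>[OF elim, of s] by (cases "alive s w = 0") auto
      then show ?case by (simp add: alive_def)
    qed
    show "AE w in M. Y t w - x - (\<integral>r. indicator {0..t} r *\<^sub>R (alive r w *\<^sub>R cutoff \<Omega> b (X r w)) \<partial>lborel) =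
        X (real_of_ereal (min (ereal t) (hit_time (bdry \<Omega>) X w))) w - x
             - (LINT s:{0..t} \<inter> before_hit (bdry \<Omega>) X w|lborel.
                  f (X s w) + G (X s w) *v feedback G R (\<lambda>x. - lam * ln (\<Psi> x)) (X s w))"
      using AE_start
    proof eventually_elim
      case (elim w)
      \<comment> \<open>Before the hit the cut-off drift is f + G u with the feedback formula; after
        it both integrands are 0.\<close>
      have "indicator {0..t} s *\<^sub>R (alive s w *\<^sub>R cutoff \<Omega> b (X s w)) = indicator ({0..t} \<inter> before_hit (bdry \<Omega>) X w) s *\<^sub>R
          (f (X s w) + G (X s w) *v feedback G R (\<lambda>x. - lam * ln (\<Psi> x)) (X s w))" for s
        using alive_\<Omega>[OF elim, of s] fb[of "X s w"]
        by (cases "alive s w = 0") (auto simp: b_def alive_def indicator_def)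
      then show ?case by (simp add: Y_def T_def set_lebesgue_integral_def)
    qed
  qed
  interpret stopped_diffusion M F S W \<Omega> X x "cutoff \<Omega> b" "cutoff \<Omega> B" Kb K
    by unfold_locales (intro cutoff_measurable \<Omega> cb cB Kb K ito; assumption)+
  obtain Lg where Lg: "Lg-lipschitz_on \<Omega> (log_grad lam \<Psi>)" using lg by blast
  obtain Lh where Lh: "Lh-lipschitz_on \<Omega> (log_hess lam \<Psi>)" using lh by blast
  define L where "L = max Lg Lh"
  obtain C where C: "0 \<le> C" "\<And>x y. x \<in> \<Omega> \<Longrightarrow> y \<in> \<Omega> \<Longrightarrow>
    - lam * ln (\<Psi> y) \<le> - lam * ln (\<Psi> x) + log_grad lam \<Psi> x \<bullet> (y - x)
      + 1/2 * ((y - x) \<bullet> (log_hess lam \<Psi> x *v (y - x))) + C * norm (y - x) ^ 3"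
    by (rule neg_log_poly_taylor[OF \<Omega>(1) \<Psi>(1) pos lam]) blast
  obtain cV where cVb: "\<And>x. norm (cutoff \<Omega> V x) \<le> cV" by (rule cutoff_bound[OF \<Omega>(1) cV]) blast
  obtain cg where cgb: "\<And>x. norm (cutoff \<Omega> (log_grad lam \<Psi>) x) \<le> cg" by (rule cutoff_bound[OF \<Omega>(1) cg]) blast
  obtain ca where cab: "\<And>x. norm (cutoff \<Omega> (log_hess lam \<Psi>) x) \<le> ca" by (rule cutoff_bound[OF \<Omega>(1) ch]) blast
  obtain cl where clb: "\<And>x. norm (cutoff \<Omega> l x) \<le> cl" by (rule cutoff_bound[OF \<Omega>(1) cl]) blast
  have l0: "0 \<le> cutoff \<Omega> l y" for y
  proof (cases "y \<in> \<Omega>")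
    case True
    have "0 \<le> u y \<bullet> (R *v u y)"
      using R by (cases "u y = 0") (auto simp: positive_definite_def less_imp_le)
    with q(2)[OF True] show ?thesis using True by (simp add: l_def)
  qed (simp add: cutoff_def)
  have lip: "norm (cutoff \<Omega> (log_grad lam \<Psi>) y - cutoff \<Omega> (log_grad lam \<Psi>) z) \<le> L * norm (y - z)"
    "norm (cutoff \<Omega> (log_hess lam \<Psi>) y - cutoff \<Omega> (log_hess lam \<Psi>) z) \<le> L * norm (y - z)" if "y \<in> \<Omega>" "z \<in> \<Omega>" for y z
  proof -
    have "Lg * norm (y - z) \<le> L * norm (y - z)" "Lh * norm (y - z) \<le> L * norm (y - z)"
      by (intro mult_right_mono; simp add: L_def)+
    then show "norm (cutoff \<Omega> (log_grad lam \<Psi>) y - cutoff \<Omega> (log_grad lam \<Psi>) z) \<le> L * norm (y - z)"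
      "norm (cutoff \<Omega> (log_hess lam \<Psi>) y - cutoff \<Omega> (log_hess lam \<Psi>) z) \<le> L * norm (y - z)"
      using lipschitz_onD[OF Lg that] lipschitz_onD[OF Lh that] that by (auto simp: dist_norm)
  qed
  have gen: "cutoff \<Omega> (log_grad lam \<Psi>) y \<bullet> cutoff \<Omega> b y + 1/2 * cov_form S (cutoff \<Omega> (log_hess lam \<Psi>) y ** cutoff \<Omega> B y) (cutoff \<Omega> B y)
      \<le> - cutoff \<Omega> l y" if y: "y \<in> \<Omega>" for y
  proof -
    have "cov_form S (log_hess lam \<Psi> y ** B y) (B y) = trace (log_hess lam \<Psi> y ** noise_cov B S y)"
      unfolding cov_form_trace noise_cov_def by (simp add: matrix_mul_assoc)
    then show ?thesis
      using generator_log_le[where f=f and G=G and B=B and S=S and q=q and R=R and lam=lam and \<Psi>=\<Psi> and x=y and u="u y", OF R lam \<Psi>(2)[OF y] \<Psi>(4)[OF y] cov[OF y] u_def[of y]] y by (simp add: b_def l_def)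
  qed
  have cost: "(\<integral>\<^sup>+w. ((if T w < \<infinity> then ennreal (\<phi> (X (real_of_ereal (T w)) w)) else 0)
      + (\<integral>\<^sup>+r. ennreal (alive r w *\<^sub>R cutoff \<Omega> l (X r w)) \<partial>lborel)) \<partial>M) \<le> ennreal (cutoff \<Omega> V x)"
  proof (rule cost_le[where g="cutoff \<Omega> (log_grad lam \<Psi>)" and A="cutoff \<Omega> (log_hess lam \<Psi>)" and C=C and L=L and cV=cV and cg=cg and ca=ca and cl=cl])
    show "cutoff \<Omega> V \<in> borel_measurable borel" by (rule cutoff_measurable[OF \<Omega>(1) cV])
    show "cutoff \<Omega> (log_grad lam \<Psi>) \<in> borel_measurable borel" by (rule cutoff_measurable[OF \<Omega>(1) cg])
    show "cutoff \<Omega> (log_hess lam \<Psi>) \<in> borel_measurable borel" by (rule cutoff_measurable[OF \<Omega>(1) ch])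
    show "cutoff \<Omega> l \<in> borel_measurable borel" by (rule cutoff_measurable[OF \<Omega>(1) cl])
    show "\<bar>cutoff \<Omega> V y\<bar> \<le> cV" for y using cVb[of y] by simp
    show "cutoff \<Omega> l y \<le> cl" for y using clb[of y] by simp
    show "0 \<le> L" using lipschitz_on_nonneg[OF Lg] by (simp add: L_def)
    show "cutoff \<Omega> V z \<le> cutoff \<Omega> V y + cutoff \<Omega> (log_grad lam \<Psi>) y \<bullet> (z - y)
       + 1/2 * ((z - y) \<bullet> (cutoff \<Omega> (log_hess lam \<Psi>) y *v (z - y))) + C * norm (z - y) ^ 3" if "y \<in> \<Omega>" "z \<in> \<Omega>" for y z
      using C(2)[OF that] that by (simp add: V_def)
    show "\<phi> \<in> borel_measurable borel" by (intro borel_measurable_continuous_onI poly_continuous_on \<phi>)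
    show "\<phi> y \<le> cutoff \<Omega> V y" if "y \<in> bdry \<Omega>" for y
      using \<phi>(2)[OF that] bdry_subset[OF closed_\<Omega> \<Omega>(2)] that by (auto simp: V_def)
    show "0 \<le> cutoff \<Omega> V y" if "y \<in> \<Omega>" for y
      using that \<Psi>(2,3)[OF that] lam by (simp add: V_def mult_le_0_iff)
  qed (use cgb cab l0 lip gen C(1) in auto)
  have "expected_cost M \<Omega> \<phi> q R (\<lambda>s w. feedback G R (\<lambda>x. - lam * ln (\<Psi> x)) (X s w)) X
    = (\<integral>\<^sup>+w. ((if T w < \<infinity> then ennreal (\<phi> (X (real_of_ereal (T w)) w)) else 0)
      + (\<integral>\<^sup>+r. ennreal (alive r w *\<^sub>R cutoff \<Omega> l (X r w)) \<partial>lborel)) \<partial>M)"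
    unfolding expected_cost_def T_def[symmetric]
  proof (rule nn_integral_cong_AE)
    show "AE w in M. (if T w < \<infinity> then ennreal (\<phi> (X (real_of_ereal (T w)) w)) else 0)
           + (\<integral>\<^sup>+s\<in>before_hit (bdry \<Omega>) X w. ennreal (q (X s w) + 1/2 * (feedback G R (\<lambda>x. - lam * ln (\<Psi> x)) (X s w) \<bullet>
               (R *v feedback G R (\<lambda>x. - lam * ln (\<Psi> x)) (X s w)))) \<partial>lborel)
       = (if T w < \<infinity> then ennreal (\<phi> (X (real_of_ereal (T w)) w)) else 0)
      + (\<integral>\<^sup>+r. ennreal (alive r w *\<^sub>R cutoff \<Omega> l (X r w)) \<partial>lborel)"
      using AE_start
    proof eventually_elim
      case (elim w)
      have "ennreal (q (X s w) + 1/2 * (feedback G R (\<lambda>x. - lam * ln (\<Psi> x)) (X s w) \<bullet>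
               (R *v feedback G R (\<lambda>x. - lam * ln (\<Psi> x)) (X s w)))) * indicator (before_hit (bdry \<Omega>) X w) s
          = ennreal (alive s w *\<^sub>R cutoff \<Omega> l (X s w))" for s
        using alive_\<Omega>[OF elim, of s] fb[of "X s w"]
        by (cases "alive s w = 0") (auto simp: l_def alive_def indicator_def)
      then show ?case by simp
    qed
  qed
  with cost show ?thesis using \<Omega>(3) by (simp add: V_def)
qed

theorem theorem23:
  fixes \<Omega> :: "(real^'n) set"
    and g h :: "nat \<Rightarrow> real^'n \<Rightarrow> real" and k m :: nat
    and f :: "real^'n \<Rightarrow> real^'n" and G :: "real^'n \<Rightarrow> real^'m^'n" and B :: "real^'n \<Rightarrow> real^'l^'n"
    and S\<^sub>\<epsilon> :: "real^'l^'l" and R :: "real^'m^'m"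
    and q \<phi> \<psi> :: "real^'n \<Rightarrow> real" and lam :: real
    and M :: "'w measure" and F :: "real \<Rightarrow> 'w measure" and W :: "real \<Rightarrow> 'w \<Rightarrow> real^'l"
    and Vs \<Psi>s :: "real^'n \<Rightarrow> real"
    and \<Psi>l \<Psi>u Vu :: "real^'n \<Rightarrow> real" and eps eta :: real
  assumes g_poly: "\<forall>i\<in>{1..k}. real_polynomial_function (g i)"
    and Omega: "\<Omega> = {x. \<forall>i\<in>{1..k}. 0 \<le> g i x}" "compact \<Omega>" "0 \<in> \<Omega>"
    and h_poly: "\<forall>i\<in>{1..m}. real_polynomial_function (h i)"
    and boundary: "frontier \<Omega> = {x. (\<Prod>i=1..m. h i x) = 0}"
    and coeff_poly:
      "\<forall>i. real_polynomial_function (\<lambda>x. f x $ i)"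
      "\<forall>i j. real_polynomial_function (\<lambda>x. G x $ i $ j)"
      "\<forall>i j. real_polynomial_function (\<lambda>x. B x $ i $ j)"
    and coeff_0: "f 0 = 0" "G 0 = 0" "B 0 = 0"
    and R: "positive_definite R"
    and S: "positive_semidefinite S\<^sub>\<epsilon>"
    and q: "real_polynomial_function q" "positive_definite_on \<Omega> q"
    and phi: "real_polynomial_function \<phi>" "positive_definite_on \<Omega> \<phi>"
    and lam: "0 < lam"
      "\<forall>x\<in>\<Omega>. lam *\<^sub>R (G x ** matrix_inv R ** transpose (G x)) = noise_cov B S\<^sub>\<epsilon> x"
    and psi: "\<psi> = (\<lambda>x. exp (- \<phi> x / lam))"
    and basis: "prob_space M" "filtration (space M) F" "\<forall>t. subalgebra M (F t)"
    and W: "brownian_motion M F S\<^sub>\<epsilon> W"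
    and Vs_visc: "unique_viscosity_solution \<Omega> (hjb_op q f G B S\<^sub>\<epsilon> R) \<phi> Vs"
    and Psis_visc: "unique_viscosity_solution \<Omega> (linear_op q f B S\<^sub>\<epsilon> lam) \<psi> \<Psi>s"
    and Vs_Psis: "\<forall>x\<in>\<Omega>. 0 < \<Psi>s x \<and> Vs x = - lam * ln (\<Psi>s x)"
    and Vs_value: "\<forall>x\<in>\<Omega>. enn2ereal (value_function M F W \<Omega> f G B \<phi> q R x) = ereal (Vs x)"
    and sol: "P_solution \<Omega> q f B S\<^sub>\<epsilon> lam \<psi> \<Psi>l \<Psi>u eps"
    and Psil_pos: "\<forall>x\<in>\<Omega>. 0 < \<Psi>l x"
    and Vu: "Vu = (\<lambda>x. - lam * ln (\<Psi>l x))"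
    and eta: "eta = exp (- (SUP x\<in>\<Omega>. \<bar>Vs x\<bar>) / lam)"
  shows "\<forall>x\<in>\<Omega>.
     (\<forall>X. sde_solution M F W \<Omega> f G B x (\<lambda>s w. feedback G R Vu (X s w)) X \<longrightarrow>
        enn2ereal (expected_cost M \<Omega> \<phi> q R (\<lambda>s w. feedback G R Vu (X s w)) X) \<le> ereal (Vu x)) \<and>
     ereal (Vu x) \<le> ereal (Vs x) +
        (if eps < eta then ereal (- lam * ln (1 - min 1 (eps / eta))) else \<infinity>)"
proof -
  have feas: "P_feasible \<Omega> q f B S\<^sub>\<epsilon> lam \<psi> \<Psi>l \<Psi>u eps" using sol by (simp add: P_solution_def)
  have poly: "real_polynomial_function \<Psi>l" "real_polynomial_function \<Psi>u"
    and l_ineq: "\<And>x. x \<in> \<Omega> \<Longrightarrow> 1 / lam * q x * \<Psi>l x - gen_L f B S\<^sub>\<epsilon> \<Psi>l x \<le> 0"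
    and u_ineq: "\<And>x. x \<in> \<Omega> \<Longrightarrow> 0 \<le> 1 / lam * q x * \<Psi>u x - gen_L f B S\<^sub>\<epsilon> \<Psi>u x"
    and gap: "\<And>x. x \<in> \<Omega> \<Longrightarrow> \<Psi>u x - \<Psi>l x \<le> eps"
    and bd: "\<And>x. x \<in> bdry \<Omega> \<Longrightarrow> \<Psi>l x \<le> \<psi> x" "\<And>x. x \<in> bdry \<Omega> \<Longrightarrow> \<psi> x \<le> \<Psi>u x"
    using feas unfolding P_feasible_def by blast+
  have q_pos: "\<And>x. x \<in> \<Omega> - {0} \<Longrightarrow> 0 < q x" and q0: "q 0 = 0"
    using q(2) by (auto simp: positive_definite_on_def)
  have q_nn: "0 \<le> q x" if "x \<in> \<Omega>" for x
    using q_pos[of x] q0 that by (cases "x = 0") auto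
  have vs: "continuous_on \<Omega> \<Psi>s" "\<And>x. x \<in> bdry \<Omega> \<Longrightarrow> \<Psi>s x = \<psi> x"
    "viscosity_subsolution (\<Omega> - bdry \<Omega>) (linear_op q f B S\<^sub>\<epsilon> lam) \<Psi>s"
    "viscosity_supersolution (\<Omega> - bdry \<Omega>) (linear_op q f B S\<^sub>\<epsilon> lam) \<Psi>s"
    using Psis_visc unfolding unique_viscosity_solution_def viscosity_solution_def by blast+
  have lower: "\<Psi>l x \<le> \<Psi>s x" if "x \<in> \<Omega>" for x
    by (rule poly_le_supersolution[OF Omega(2) vs(1,4) poly(1) l_ineq q_pos lam(1) _ that]) (simp_all add: vs(2) bd(1))
  have upper: "\<Psi>s x \<le> \<Psi>u x" if "x \<in> \<Omega>" for x
    by (rule subsolution_le_poly[OF Omega(2) vs(1,3) poly(2) u_ineq q_pos lam(1) _ that]) (simp_all add: vs(2) bd(2))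
  have Psis_pos: "0 < \<Psi>s x" and Vs: "Vs x = - lam * ln (\<Psi>s x)" if "x \<in> \<Omega>" for x
    using Vs_Psis that by blast+
  \<comment> \<open>The value function takes values in the extended nonnegative reals, so
    \<open>Vs \<ge> 0\<close>, which under the exponential says
    \<open>\<Psi>s \<le> 1\<close>.\<close>
  have Psis_le1: "\<Psi>s x \<le> 1" if "x \<in> \<Omega>" for x
  proof -
    have "0 \<le> enn2ereal (value_function M F W \<Omega> f G B \<phi> q R x)" by (rule enn2ereal_nonneg)
    then have "0 \<le> Vs x" using Vs_value that by simp
    then have "ln (\<Psi>s x) \<le> 0" using Vs[OF that] lam(1) by (simp add: mult_le_0_iff)
    then show ?thesis using Psis_pos[OF that] by simp
  qed
  have Psil_le1: "\<Psi>l x \<le> 1" if "x \<in> \<Omega>" for x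
    using lower[OF that] Psis_le1[OF that] by simp
  have bsub: "bdry \<Omega> \<subseteq> \<Omega>" by (rule bdry_subset[OF compact_imp_closed[OF Omega(2)] Omega(3)])
  \<comment> \<open>The boundary constraint bounds \<open>\<Psi>l\<close> by exp (- \<phi> / lam);
    under the logarithm, \<open>Vu\<close> dominates the terminal cost.\<close>
  have phi_le: "\<phi> x \<le> - lam * ln (\<Psi>l x)" if x: "x \<in> bdry \<Omega>" for x
  proof -
    have "0 < \<Psi>l x" using Psil_pos bsub x by blast
    then have "ln (\<Psi>l x) \<le> ln (exp (- \<phi> x / lam))"
      using bd(1)[OF x] unfolding psi by (subst ln_le_cancel_iff) auto
    then have "ln (\<Psi>l x) \<le> - \<phi> x / lam" by simp
    then show ?thesis using lam(1) by (simp add: field_simps)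
  qed
  \<comment> \<open>At the origin \<psi> lies between the two polynomials, so their gap there is
    nonnegative.\<close>
  have eps0: "0 \<le> eps"
  proof -
    have "0 \<in> bdry \<Omega>" by (simp add: bdry_def)
    then show ?thesis using bd[of 0] gap[OF Omega(3)] by simp
  qed
  show ?thesis
  proof (intro ballI conjI allI impI)
    fix x X assume x: "x \<in> \<Omega>"
      and sde: "sde_solution M F W \<Omega> f G B x (\<lambda>s w. feedback G R Vu (X s w)) X"
    have "expected_cost M \<Omega> \<phi> q R (\<lambda>s w. feedback G R Vu (X s w)) X \<le> ennreal (Vu x)"
      unfolding Vu
      by (rule feedback_cost_le[where S="S\<^sub>\<epsilon>" and F=F and W=W and f=f and B=B and lam=lam and \<Omega>=\<Omega>])
         (use basis S W Omega x coeff_poly R lam q q_nn phi phi_le poly(1) Psil_pos Psil_le1 l_ineq sde[unfolded Vu] in simp_all)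
    \<comment> \<open>\<open>ennreal\<close> maps negative numbers to 0, so returning to
      \<open>ereal\<close> requires this sign.\<close>
    moreover have "0 \<le> Vu x"
      using Psil_pos Psil_le1[OF x] lam(1) x by (simp add: Vu mult_le_0_iff)
    ultimately show "enn2ereal (expected_cost M \<Omega> \<phi> q R (\<lambda>s w. feedback G R Vu (X s w)) X) \<le> ereal (Vu x)"
      by (simp add: less_eq_ennreal.rep_eq)
  next
    fix x assume x: "x \<in> \<Omega>"
    show "ereal (Vu x) \<le> ereal (Vs x) + (if eps < eta then ereal (- lam * ln (1 - min 1 (eps / eta))) else \<infinity>)"
    proof (cases "eps < eta")
      case True
      have eta0: "0 < eta" by (simp add: eta)
      \<comment> \<open>The supremum in \<open>eta\<close> bounds \<open>Vs\<close> only if the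
        values are bounded, which continuity on the compact \<Omega> ensures.\<close>
      have "continuous_on \<Omega> (\<lambda>x. \<bar>Vs x\<bar>)"
        using Vs_visc unfolding unique_viscosity_solution_def viscosity_solution_def
        by (intro continuous_on_rabs) blast
      then have "bdd_above ((\<lambda>x. \<bar>Vs x\<bar>) ` \<Omega>)"
        by (intro bounded_imp_bdd_above compact_imp_bounded compact_continuous_image Omega(2))
      then have "\<bar>Vs x\<bar> \<le> (SUP x\<in>\<Omega>. \<bar>Vs x\<bar>)" by (rule cSUP_upper[OF x])
      then have "Vs x / lam \<le> (SUP x\<in>\<Omega>. \<bar>Vs x\<bar>) / lam" using lam(1) by (intro divide_right_mono) auto
      then have "eta \<le> exp (- (Vs x / lam))" unfolding eta by simp
      also have "exp (- (Vs x / lam)) = \<Psi>s x" using Vs[OF x] Psis_pos[OF x] lam(1) by simp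
      finally have eta_le: "eta \<le> \<Psi>s x" .
      have ratio: "0 < 1 - eps / eta" using True eta0 by simp
      \<comment> \<open>Since \<open>eta \<le> \<Psi>s\<close>, the absolute gap eps is at most the
        fraction eps / eta of \<open>\<Psi>s\<close>. As a relative gap it becomes the factor 1 -
        eps / eta, which the logarithm splits off.\<close>
      have "eps = eta * (eps / eta)" using eta0 by simp
      also have "\<dots> \<le> \<Psi>s x * (eps / eta)" using eta_le eps0 eta0 by (intro mult_right_mono) auto
      finally have "\<Psi>s x * (1 - eps / eta) \<le> \<Psi>l x"
        using gap[OF x] upper[OF x] by (simp add: right_diff_distrib)
      then have "ln (\<Psi>s x * (1 - eps / eta)) \<le> ln (\<Psi>l x)"
        using Psis_pos[OF x] ratio Psil_pos x by (subst ln_le_cancel_iff) auto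
      then have "ln (\<Psi>s x) + ln (1 - eps / eta) \<le> ln (\<Psi>l x)"
        using Psis_pos[OF x] ratio True by (auto simp: ln_mult split: if_splits)
      then have "lam * (ln (\<Psi>s x) + ln (1 - eps / eta)) \<le> lam * ln (\<Psi>l x)"
        using lam(1) by (intro mult_left_mono) auto
      then have "Vu x \<le> Vs x + - lam * ln (1 - eps / eta)"
        unfolding Vu Vs[OF x] by (simp add: distrib_left)
      moreover have "min 1 (eps / eta) = eps / eta" using ratio by simp
      ultimately show ?thesis using True by simp
    qed simp
  qed
qed

end
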